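(* For every $n\ge1$: (1) $(\mathbb{P}_f)_f$, $f$ ranging over red-packed forests of weight $n$, is a basis of $\mathbf{WQSym}^*_n$; (2) $(\mathbb{P}_t)_t$, $t$ ranging over red-packed trees of weight $n$, is a basis of $\mathrm{Prim}^*_n$; (3) $(\mathbb{P}_t)_t$, $t$ ranging over red-packed trees of weight $n$ whose root has an empty left forest, is a basis of $\mathrm{TPrim}^*_n$.
   Context: Words are finite words over the positive integers; $|w|$ is the length, $\max(w)$ the largest letter ($\max(\varepsilon)=0$), $w^{[k]}$ adds $k$ to every letter. A word is packed if every integer $1,\dots,\max(w)$ occurs in it; $\mathrm{PW}_n$ is the set of packed words of length $n$; $\mathrm{pack}(w)$ replaces the $j$-th smallest distinct letter by $j$. For $w\in\mathrm{PW}_n$, $p\ge1$ and $I=\{i_1<\dots<i_p\}$ a set of positive integers, if $i_p\le n+p$ then $\phi_I(w)$ is the word of length $n+p$ with letter $\max(w)+1$ at the positions in $I$ and the letters of $w$, in order, at the other positions. $\mathbf{WQSym}^*_n$ has basis $(\mathbb{R}_w)_{w\in\mathrm{PW}_n}$; $(\mathbf{WQSym}^* )_+=\bigoplus_{n\ge1}\mathbf{WQSym}^*_n$. For nonempty packed $u,v$, with $v'=v^{[\max(u)]}$: $\mathbb{R}_u\prec\mathbb{R}_v=\sum\mathbb{R}_w$ over the shuffles $w$ of $u$ and $v'$ whose last letter is the last letter of $u$, and $\mathbb{R}_u\succ\mathbb{R}_v=\sum\mathbb{R}_w$ over shuffles whose last letter is the last letter of $v'$ (extended bilinearly). For $u=u_1\cdots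 u_n$, $\Delta_\prec(\mathbb{R}_u)$ (resp. $\Delta_\succ(\mathbb{R}_u)$) is $\sum\mathbb{R}_{\mathrm{pack}(u_1\cdots u_i)}\otimes\mathbb{R}_{\mathrm{pack}(u_{i+1}\cdots u_n)}$ over $1\le i\le n-1$ with $\{u_1,\dots,u_i\}\cap\{u_{i+1},\dots,u_n\}=\emptyset$ and $\max(u)\in\{u_1,\dots,u_i\}$ (resp. $\notin$). $\mathrm{Prim}^*_n=\mathbf{WQSym}^*_n\cap\ker(\Delta_\prec+\Delta_\succ)$, $\mathrm{TPrim}^*_n=\mathbf{WQSym}^*_n\cap\ker\Delta_\prec\cap\ker\Delta_\succ$. The linear map $\Phi_I$ sends $\mathbb{R}_w$ ($w\in\mathrm{PW}_n$) to $\mathbb{R}_{\phi_I(w)}$ if $i_p\le n+p$ and to $0$ otherwise. Brace brackets: for $n\ge2$ and $p_1,\dots,p_n\in(\mathbf{WQSym}^* )_+$, $\langle p_1,\dots,p_{n-1};p_n\rangle=\sum_{i=0}^{n-1}(-1)^{n-1-i}\,(p_1\prec(p_2\prec(\cdots\prec p_i)\cdots))\succ p_n\prec((\cdots(p_{i+1}\succ p_{i+2})\succ\cdots)\succ p_{n-1})$, where for $i=0$ the left factor and "$\succ$" are omitted and for $i=n-1$ the right factor and "$\prec$" are omitted (the expression is unambiguous since $(a\succ b)\prec c=a\succ(b\prec c)$). Biplane trees: recursively $\mathrm{Node}(x,f_\ell,f_r)$ with root label $x$ and ordered (possibly empty) lists $f_\ell,f_r$ of trees; forests are ordered lists of trees.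 Red-packed trees are labeled by nonempty finite sets $I=\{i_1<\dots<i_p\}$ of positive integers; weight $\omega(\mathrm{Node}(I,f_\ell,f_r))=|I|+$ weights of all trees in $f_\ell,f_r$ (forest weight = sum). $\mathrm{Node}(I,[\ell_1..\ell_g],[r_1..r_d])$ is red-packed if all $\ell_j,r_j$ are red-packed and either ($d=0$, $I=\{1,\dots,p\}$) or ($d\ge1$, $1\le i_1\le\omega(r_1)$, $1\le p+\sum_j\omega(r_j)+1-i_p\le\omega(r_d)$). Red-packed forest: list of red-packed trees. Definition of $\mathbb{P}$: $\mathbb{P}_{[]}=\mathbb{R}_\varepsilon$; $\mathbb{P}_{[t_1,\dots,t_k]}=\mathbb{P}_{t_k}\prec(\mathbb{P}_{t_{k-1}}\prec(\cdots\prec\mathbb{P}_{t_1})\cdots)$ for $k\ge1$; $\mathbb{P}_{\mathrm{Node}(I,[],f_r)}=\Phi_I(\mathbb{P}_{f_r})$; and for $g\ge1$, $\mathbb{P}_{\mathrm{Node}(I,[\ell_1,\dots,\ell_g],f_r)}=\langle\mathbb{P}_{\ell_1},\dots,\mathbb{P}_{\ell_g};\mathbb{P}_{\mathrm{Node}(I,[],f_r)}\rangle$. *)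

theory Defs
  imports Complex_Main "HOL-Library.Poly_Mapping"
begin

subsection \<open>Free vector spaces on a set of words\<close>

definition scale :: "'k::field \<Rightarrow> ('b \<Rightarrow>\<^sub>0 'k) \<Rightarrow> ('b \<Rightarrow>\<^sub>0 'k)" where
  "scale c x = Poly_Mapping.map ((*) c) x"

lemma lookup_scale [simp]:
  "Poly_Mapping.lookup (scale c x) b = c * Poly_Mapping.lookup x b"
  by (simp add: scale_def map.rep_eq when_def)

interpretation free_vs: vector_space "scale :: 'k::field \<Rightarrow> ('b \<Rightarrow>\<^sub>0 'k) \<Rightarrow> ('b \<Rightarrow>\<^sub>0 'k)"
  by unfold_locales (auto intro!: poly_mapping_eqI simp: lookup_add algebra_simps)

text \<open>The family \<open>(b i)\<close>, \<open>i \<in> S\<close>, is a basis of the subspace \<open>V\<close>; injectivity is required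
  because a basis is meant as an indexed family, not as a set of vectors.\<close>

definition basis_family :: "('i \<Rightarrow> ('b \<Rightarrow>\<^sub>0 'k::field)) \<Rightarrow> 'i set \<Rightarrow> ('b \<Rightarrow>\<^sub>0 'k) set \<Rightarrow> bool" where
  "basis_family b S V \<longleftrightarrow>
     inj_on b S \<and> free_vs.independent (b ` S) \<and> free_vs.span (b ` S) = V"

definition linear_ext :: "('b \<Rightarrow> ('c \<Rightarrow>\<^sub>0 'k)) \<Rightarrow> ('b \<Rightarrow>\<^sub>0 'k) \<Rightarrow> ('c \<Rightarrow>\<^sub>0 'k::field)" where
  "linear_ext f x = (\<Sum>u\<in>Poly_Mapping.keys x. scale (Poly_Mapping.lookup x u) (f u))"

definition bilinear_ext ::
    "('a \<Rightarrow> 'b \<Rightarrow> ('c \<Rightarrow>\<^sub>0 'k)) \<Rightarrow> ('a \<Rightarrow>\<^sub>0 'k) \<Rightarrow> ('b \<Rightarrow>\<^sub>0 'k) \<Rightarrow> ('c \<Rightarrow>\<^sub>0 'k::field)" where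
  "bilinear_ext f x y = linear_ext (\<lambda>u. linear_ext (f u) y) x"


subsection \<open>Packed words\<close>

type_synonym word = "nat list"

definition wmax :: "word \<Rightarrow> nat" where
  "wmax w = Max (insert 0 (set w))"

definition shift :: "nat \<Rightarrow> word \<Rightarrow> word" where
  "shift k w = map (\<lambda>a. a + k) w"

definition packed :: "word \<Rightarrow> bool" where
  "packed w \<longleftrightarrow> set w = {1..wmax w}"

definition PW :: "nat \<Rightarrow> word set" where
  "PW n = {w. packed w \<and> length w = n}"

definition pack :: "word \<Rightarrow> word" where
  "pack w = map (\<lambda>a. card {b \<in> set w. b \<le> a}) w"

text \<open>Positions are counted from 1; \<open>{1..<j} - I\<close> are the positions before \<open>j\<close> already
  filled by letters of \<open>w\<close>.\<close>

definition phi :: "nat set \<Rightarrow> word \<Rightarrow> word" where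
  "phi I w = map (\<lambda>j. if j \<in> I then wmax w + 1 else w ! card ({1..<j} - I))
                 [1..<length w + card I + 1]"


subsection \<open>The bidendriform structure of the dual of WQSym\<close>

text \<open>Elements are finitely supported functions on all words; the graded components
  \<open>WQSym n\<close> single out those supported on packed words.\<close>

type_synonym 'k wqsym = "word \<Rightarrow>\<^sub>0 'k"

definition R :: "word \<Rightarrow> 'k::field wqsym" where
  "R w = Poly_Mapping.single w 1"

definition WQSym :: "nat \<Rightarrow> 'k::field wqsym set" where
  "WQSym n = free_vs.span (R ` PW n)"

text \<open>The letters of \<open>u\<close> and of the shifted \<open>v\<close> are disjoint, so each shuffle arises exactly
  once and summing over the set of shuffles loses no multiplicity. The half-products are
  only meaningful in positive degree; they are set to 0 on the empty word.\<close>

definition prec_word :: "word \<Rightarrow> word \<Rightarrow> 'k::field wqsym" where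
  "prec_word u v = (if u = [] \<or> v = [] then 0
     else \<Sum>w | w \<in> shuffles u (shift (wmax u) v) \<and> last w = last u. R w)"

definition succ_word :: "word \<Rightarrow> word \<Rightarrow> 'k::field wqsym" where
  "succ_word u v = (if u = [] \<or> v = [] then 0
     else \<Sum>w | w \<in> shuffles u (shift (wmax u) v) \<and> last w = last (shift (wmax u) v). R w)"

definition prec :: "'k::field wqsym \<Rightarrow> 'k wqsym \<Rightarrow> 'k wqsym" (infixr \<open>\<lless>\<close> 70) where
  "x \<lless> y = bilinear_ext prec_word x y"

definition succ :: "'k::field wqsym \<Rightarrow> 'k wqsym \<Rightarrow> 'k wqsym" (infixl \<open>\<ggreater>\<close> 70) where
  "x \<ggreater> y = bilinear_ext succ_word x y"

text \<open>The tensor square is the free vector space on pairs of words, \<open>R u \<otimes> R v\<close> being the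
  basis vector of the pair \<open>(u, v)\<close>.\<close>

definition R_tensor :: "word \<Rightarrow> word \<Rightarrow> (word \<times> word \<Rightarrow>\<^sub>0 'k::field)" where
  "R_tensor u v = Poly_Mapping.single (u, v) 1"

definition Delta_prec :: "'k::field wqsym \<Rightarrow> (word \<times> word \<Rightarrow>\<^sub>0 'k)" where
  "Delta_prec = linear_ext (\<lambda>u.
     \<Sum>i | 1 \<le> i \<and> i < length u \<and> set (take i u) \<inter> set (drop i u) = {} \<and> wmax u \<in> set (take i u).
       R_tensor (pack (take i u)) (pack (drop i u)))"

definition Delta_succ :: "'k::field wqsym \<Rightarrow> (word \<times> word \<Rightarrow>\<^sub>0 'k)" where
  "Delta_succ = linear_ext (\<lambda>u.
     \<Sum>i | 1 \<le> i \<and> i < length u \<and> set (take i u) \<inter> set (drop i u) = {} \<and> wmax u \<notin> set (take i u).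
       R_tensor (pack (take i u)) (pack (drop i u)))"

definition Prim :: "nat \<Rightarrow> 'k::field wqsym set" where
  "Prim n = {x \<in> WQSym n. Delta_prec x + Delta_succ x = 0}"

definition TPrim :: "nat \<Rightarrow> 'k::field wqsym set" where
  "TPrim n = {x \<in> WQSym n. Delta_prec x = 0 \<and> Delta_succ x = 0}"

definition Phi :: "nat set \<Rightarrow> 'k::field wqsym \<Rightarrow> 'k wqsym" where
  "Phi I = linear_ext (\<lambda>w. if Max I \<le> length w + card I then R (phi I w) else 0)"

text \<open>For nonempty \<open>[x\<^sub>1, \<dots>, x\<^sub>k]\<close>: \<open>x\<^sub>1 \<lless> (x\<^sub>2 \<lless> (\<dots> \<lless> x\<^sub>k))\<close> and
  \<open>((x\<^sub>1 \<ggreater> x\<^sub>2) \<ggreater> \<dots>) \<ggreater> x\<^sub>k\<close>.\<close>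

definition prec_comb :: "'k::field wqsym list \<Rightarrow> 'k wqsym" where
  "prec_comb xs = foldr (\<lless>) (butlast xs) (last xs)"

definition succ_comb :: "'k::field wqsym list \<Rightarrow> 'k wqsym" where
  "succ_comb xs = foldl (\<ggreater>) (hd xs) (tl xs)"

text \<open>\<open>brace [p\<^sub>1, \<dots>, p\<^sub>m] q\<close> is the bracket \<open>\<langle>p\<^sub>1, \<dots>, p\<^sub>m; q\<rangle>\<close>, with \<open>m = n - 1\<close>.\<close>

definition brace :: "'k::field wqsym list \<Rightarrow> 'k wqsym \<Rightarrow> 'k wqsym" where
  "brace ps q = (\<Sum>i = 0..length ps. scale ((-1) ^ (length ps - i))
     (let left = (if i = 0 then q else prec_comb (take i ps) \<ggreater> q)
      in if i = length ps then left else left \<lless> succ_comb (drop i ps)))"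


subsection \<open>Red-packed biplane trees and forests\<close>

datatype 'a biplane = Node 'a (left_forest: "'a biplane list") (right_forest: "'a biplane list")

fun weight :: "nat set biplane \<Rightarrow> nat" where
  "weight (Node I l r) = card I + sum_list (map weight l) + sum_list (map weight r)"

definition forest_weight :: "nat set biplane list \<Rightarrow> nat" where
  "forest_weight f = sum_list (map weight f)"

fun red_packed :: "nat set biplane \<Rightarrow> bool" where
  "red_packed (Node I l r) \<longleftrightarrow>
     finite I \<and> I \<noteq> {} \<and> 0 \<notin> I \<and>
     (\<forall>t\<in>set l. red_packed t) \<and> (\<forall>t\<in>set r. red_packed t) \<and>
     (if r = [] then I = {1..card I}
      else 1 \<le> Min I \<and> Min I \<le> weight (hd r) \<and>
           1 \<le> int (card I) + int (forest_weight r) + 1 - int (Max I) \<and>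
           int (card I) + int (forest_weight r) + 1 - int (Max I) \<le> int (weight (last r)))"

definition red_packed_forest :: "nat set biplane list \<Rightarrow> bool" where
  "red_packed_forest f \<longleftrightarrow> (\<forall>t\<in>set f. red_packed t)"


subsection \<open>The elements indexed by trees and forests\<close>

text \<open>Assembles the forest element from the elements of its trees, listed from left to right.\<close>

definition forest_prod :: "'k::field wqsym list \<Rightarrow> 'k wqsym" where
  "forest_prod xs = (if xs = [] then R [] else prec_comb (rev xs))"

fun P_tree :: "nat set biplane \<Rightarrow> 'k::field wqsym" where
  "P_tree (Node I l r) =
     (let q = Phi I (forest_prod (map P_tree r))
      in if l = [] then q else brace (map P_tree l) q)"

definition P_forest :: "nat set biplane list \<Rightarrow> 'k::field wqsym" where
  "P_forest f = forest_prod (map P_tree f)"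

end

theory Submission
  imports Defs
begin

text \<open>
  With unital conventions for the half-products, \<open>\<prec>\<close> and \<open>\<succ>\<close> satisfy the dendriform axioms
  and their compatibility with the coproduct reads \<open>\<Delta>(a \<prec> b) = a\<^sub>1 b\<^sub>1 \<otimes> a\<^sub>2 \<prec> b\<^sub>2 + (a \<prec> b) \<otimes> 1\<close>, and
  likewise for \<open>\<succ>\<close> and for \<open>\<Delta>\<^sub>\<succ>\<close>. Hence \<open>\<Delta>\<close> deconcatenates \<open>P\<close> of a forest, braces of primitive
  elements are primitive, and \<open>\<Phi>\<^sub>I(P\<^sub>f)\<close> is totally primitive: a cut of a word in it that does not split
  the letters inserted at \<open>I\<close> would have to cut the first or the last tree of \<open>f\<close>.

  Independence in weight \<open>n\<close> follows by induction on \<open>n\<close>. Contracting the right factor of \<open>\<Delta>\<close> with the coordinate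
  along a single tree of smaller weight removes the last tree of a forest, so in a vanishing combination
  only single trees survive. The coordinate along a tree \<open>s\<close> with empty left forest vanishes on all
  half-products, because the lower-weight elements span; contracting \<open>\<Delta>\<^sub>\<succ>\<close> with it sends \<open>P\<close> of a tree
  with left forest \<open>l\<close> over \<open>s\<close> to \<open>P\<close> of the reversed forest \<open>l\<close>, so only trees with empty left forest survive.
  These are separated by erasing the maximal letter.

  Spanning is a count: cutting a packed word at its global descents, and taking out the maximal letter
  when there are none, shows that every packed word comes from a red-packed forest of the same weight.
  The same contractions then identify the primitive and the totally primitive elements.
\<close>

section \<open>Linear maps between free vector spaces\<close>

text \<open>The elements of forests are not shown to be triangular over the words; they are told
  apart by coproducts alone. The obstacle is that the elements of trees are all primitive, so the
  full coproduct cannot separate trees from one another: only its half \<open>Delta_succ\<close>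
  sees a left forest, and neither half sees anything once the left forest is empty. This forces
  three separate readings, by the full coproduct, by \<open>Delta_succ\<close> and by the maximal
  letter. A coordinate along a tree exists only when the forests of that weight are known to be
  independent, and its vanishing on half-products needs the forests of smaller weight to span. So
  independence and spanning climb the degrees together, and the count closes each degree before the
  next one begins. The two bounds on \<open>I\<close> in \<open>red_packed\<close> enter from both
  sides: they make an insertion totally primitive, and they are what a packed word without global
  descent yields when its maximal letter is removed and the forest of the rest is split at the first
  place of that letter.\<close>

definition lin :: "(('a \<Rightarrow>\<^sub>0 'k::field) \<Rightarrow> ('b \<Rightarrow>\<^sub>0 'k)) \<Rightarrow> bool" where
  "lin F \<longleftrightarrow> (\<forall>x y. F (x + y) = F x + F y) \<and> (\<forall>c x. F (scale c x) = scale c (F x))"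

lemma lin_add: "lin F \<Longrightarrow> F (x + y) = F x + F y"
  and lin_scale: "lin F \<Longrightarrow> F (scale c x) = scale c (F x)"
  by (auto simp: lin_def)

lemma lin_0: "lin F \<Longrightarrow> F 0 = 0"
  by (metis add_cancel_left_right lin_add)

lemma lin_sum: "lin F \<Longrightarrow> F (sum g S) = (\<Sum>s\<in>S. F (g s))"
  by (induction S rule: infinite_finite_induct) (auto simp: lin_0 lin_add)

lemma lin_comp: "lin F \<Longrightarrow> lin G \<Longrightarrow> lin (\<lambda>x. F (G x))"
  by (simp add: lin_def)

lemma lin_plus: "lin F \<Longrightarrow> lin G \<Longrightarrow> lin (\<lambda>x. F x + G x)"
  by (simp add: lin_def free_vs.scale_right_distrib)

lemma lin_id: "lin (\<lambda>x. x)"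
  by (simp add: lin_def)

lemma lin_zero: "lin (\<lambda>x. 0)"
  by (simp add: lin_def)

lemma linear_ext_superset:
  assumes "finite S" "Poly_Mapping.keys x \<subseteq> S"
  shows "linear_ext f x = (\<Sum>u\<in>S. scale (Poly_Mapping.lookup x u) (f u))"
  unfolding linear_ext_def using assms
  by (intro sum.mono_neutral_left) (auto simp: in_keys_iff)

lemma lin_linear_ext [simp]: "lin (linear_ext f)"
  unfolding lin_def
proof safe
  fix x y :: "'a \<Rightarrow>\<^sub>0 'b"
  let ?S = "Poly_Mapping.keys x \<union> Poly_Mapping.keys y"
  have "Poly_Mapping.keys (x + y) \<subseteq> ?S" by (rule Poly_Mapping.keys_add)
  then show "linear_ext f (x + y) = linear_ext f x + linear_ext f y"
    by (simp add: linear_ext_superset[of ?S] lookup_add sum.distrib free_vs.scale_left_distrib)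
next
  fix c and x :: "'a \<Rightarrow>\<^sub>0 'b"
  have "Poly_Mapping.keys (scale c x) \<subseteq> Poly_Mapping.keys x"
    by (auto simp: in_keys_iff)
  then show "linear_ext f (scale c x) = scale c (linear_ext f x)"
    by (simp add: linear_ext_superset[of "Poly_Mapping.keys x"] free_vs.scale_sum_right)
qed

lemma linear_ext_single [simp]: "linear_ext f (Poly_Mapping.single u 1) = f u"
  by (simp add: linear_ext_def)

lemma linear_ext_R [simp]: "linear_ext f (R u) = f u"
  by (simp add: R_def)

lemma linear_ext_R_tensor [simp]: "linear_ext f (R_tensor u v) = f (u, v)"
  by (simp add: R_tensor_def)

lemma expand_single:
  "x = (\<Sum>u\<in>Poly_Mapping.keys x. scale (Poly_Mapping.lookup x u) (Poly_Mapping.single u 1))"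
proof (rule poly_mapping_eqI)
  fix v
  have "(\<Sum>u\<in>Poly_Mapping.keys x. Poly_Mapping.lookup x u * (1 when u = v)) = Poly_Mapping.lookup x v"
    by (cases "v \<in> Poly_Mapping.keys x") (auto simp: when_def in_keys_iff if_distrib cong: if_cong)
  then show "Poly_Mapping.lookup x v = Poly_Mapping.lookup (\<Sum>u\<in>Poly_Mapping.keys x. scale (Poly_Mapping.lookup x u) (Poly_Mapping.single u 1)) v"
    by (simp add: lookup_sum lookup_single)
qed

lemma keys_induct [consumes 1, case_names zero basis add scale]:
  assumes "Poly_Mapping.keys x \<subseteq> W"
    and "P 0" and "\<And>u. u \<in> W \<Longrightarrow> P (Poly_Mapping.single u 1)"
    and "\<And>x y. P x \<Longrightarrow> P y \<Longrightarrow> P (x + y)" and "\<And>c x. P x \<Longrightarrow> P (scale c x)"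
  shows "P x"
proof -
  have "P (\<Sum>u\<in>S. scale (Poly_Mapping.lookup x u) (Poly_Mapping.single u 1))"
    if "finite S" "S \<subseteq> W" for S
    using that by (induction S rule: finite_induct) (use assms in auto)
  from this[of "Poly_Mapping.keys x"] show ?thesis
    using assms(1) expand_single[of x] by simp
qed

lemma lin_eqI:
  assumes "lin F" "lin G" "Poly_Mapping.keys x \<subseteq> W"
    and "\<And>u. u \<in> W \<Longrightarrow> F (Poly_Mapping.single u 1) = G (Poly_Mapping.single u 1)"
  shows "F x = G x"
  using assms(3) by (induction x rule: keys_induct) (use assms in \<open>auto simp: lin_0 lin_add lin_scale\<close>)

lemma lin_zeroI:
  assumes "lin F" "Poly_Mapping.keys x \<subseteq> W"
    and "\<And>u. u \<in> W \<Longrightarrow> F (Poly_Mapping.single u 1) = 0"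
  shows "F x = 0"
  using lin_eqI[OF assms(1) lin_zero assms(2)] assms(3) by auto

lemma keys_scale: "Poly_Mapping.keys (scale c x) \<subseteq> Poly_Mapping.keys x"
  by (auto simp: in_keys_iff)

lemma keys_sum_subset:
  "(\<And>s. s \<in> S \<Longrightarrow> Poly_Mapping.keys (g s) \<subseteq> W) \<Longrightarrow> Poly_Mapping.keys (sum g S) \<subseteq> W"
proof (induction S rule: infinite_finite_induct)
  case (insert a S)
  then show ?case
    using Poly_Mapping.keys_add[of "g a" "sum g S"] by (simp add: subset_iff) blast
qed auto

lemma keys_lin_subset:
  assumes "lin F" "Poly_Mapping.keys x \<subseteq> W"
    and "\<And>u. u \<in> W \<Longrightarrow> Poly_Mapping.keys (F (Poly_Mapping.single u 1)) \<subseteq> V"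
  shows "Poly_Mapping.keys (F x) \<subseteq> V"
  using assms(2)
proof (induction x rule: keys_induct)
  case (add x y)
  then show ?case using Poly_Mapping.keys_add[of "F x" "F y"] by (auto simp: lin_add[OF assms(1)])
next
  case (scale c x)
  then show ?case using keys_scale[of c "F x"] by (auto simp: lin_scale[OF assms(1)])
qed (use assms in \<open>auto simp: lin_0\<close>)

lemma lin_bilinear_ext_left [simp]: "lin (\<lambda>x. bilinear_ext f x y)"
  by (simp add: bilinear_ext_def)

lemma lin_bilinear_ext_right [simp]: "lin (bilinear_ext f x)"
  unfolding lin_def bilinear_ext_def linear_ext_def[of _ x]
  by (simp add: lin_add[OF lin_linear_ext] lin_scale[OF lin_linear_ext] free_vs.scale_right_distrib
      sum.distrib free_vs.scale_sum_right mult.commute)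

lemma bilinear_ext_single [simp]:
  "bilinear_ext f (Poly_Mapping.single u 1) (Poly_Mapping.single v 1) = f u v"
  by (simp add: bilinear_ext_def)

lemma keys_bilinear_ext_subset:
  assumes "Poly_Mapping.keys x \<subseteq> U" "Poly_Mapping.keys y \<subseteq> V"
    and "\<And>u v. u \<in> U \<Longrightarrow> v \<in> V \<Longrightarrow> Poly_Mapping.keys (f u v) \<subseteq> W"
  shows "Poly_Mapping.keys (bilinear_ext f x y) \<subseteq> W"
  by (rule keys_lin_subset[OF lin_bilinear_ext_left assms(1)],
      rule keys_lin_subset[OF lin_bilinear_ext_right assms(2)])
     (use assms(3) in simp)

lemma bilin_eqI:
  assumes "\<And>y. lin (\<lambda>x. F x y)" "\<And>x. lin (F x)" "\<And>y. lin (\<lambda>x. G x y)" "\<And>x. lin (G x)"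
    and "Poly_Mapping.keys x \<subseteq> U" "Poly_Mapping.keys y \<subseteq> V"
    and "\<And>u v. u \<in> U \<Longrightarrow> v \<in> V \<Longrightarrow>
      F (Poly_Mapping.single u 1) (Poly_Mapping.single v 1) = G (Poly_Mapping.single u 1) (Poly_Mapping.single v 1)"
  shows "F x y = G x y"
  by (rule lin_eqI[OF assms(1,3,5)], rule lin_eqI[OF assms(2,4,6)]) (use assms(7) in simp)

lemma keys_R [simp]: "Poly_Mapping.keys (R u :: 'k::field wqsym) = {u}"
  by (simp add: R_def)

definition tens :: "('a \<Rightarrow>\<^sub>0 'k::field) \<Rightarrow> ('b \<Rightarrow>\<^sub>0 'k) \<Rightarrow> ('a \<times> 'b \<Rightarrow>\<^sub>0 'k)" where
  "tens = bilinear_ext (\<lambda>u v. Poly_Mapping.single (u, v) 1)"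

lemma tens_single [simp]:
  "tens (Poly_Mapping.single u 1) (Poly_Mapping.single v 1) = Poly_Mapping.single (u, v) 1"
  by (simp add: tens_def)

lemma tens_R: "tens (R u) (R v) = R_tensor u v"
  by (simp add: R_def R_tensor_def)

lemma keys_tens:
  "Poly_Mapping.keys x \<subseteq> U \<Longrightarrow> Poly_Mapping.keys y \<subseteq> V \<Longrightarrow> Poly_Mapping.keys (tens x y) \<subseteq> U \<times> V"
  unfolding tens_def by (erule keys_bilinear_ext_subset) auto

section \<open>Linear independence of families\<close>

text \<open>Coefficients are attached to indices and not to vectors, so a repetition in the family
  counts as a dependence, as \<open>basis_family\<close> demands, and a map can be applied to the
  family index by index.\<close>

definition indep_family :: "('i \<Rightarrow> ('b \<Rightarrow>\<^sub>0 'k::field)) \<Rightarrow> 'i set \<Rightarrow> bool" where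
  "indep_family b S \<longleftrightarrow>
     (\<forall>F c. finite F \<longrightarrow> F \<subseteq> S \<longrightarrow> (\<Sum>s\<in>F. scale (c s) (b s)) = 0 \<longrightarrow> (\<forall>s\<in>F. c s = 0))"

lemma indep_familyD:
  "indep_family b S \<Longrightarrow> finite F \<Longrightarrow> F \<subseteq> S \<Longrightarrow> (\<Sum>s\<in>F. scale (c s) (b s)) = 0 \<Longrightarrow> s \<in> F \<Longrightarrow> c s = 0"
  unfolding indep_family_def by blast

lemma indep_family_mono: "indep_family b S \<Longrightarrow> T \<subseteq> S \<Longrightarrow> indep_family b T"
  unfolding indep_family_def by blast

lemma indep_family_iff:
  "indep_family b S \<longleftrightarrow> inj_on b S \<and> free_vs.independent (b ` S)" (is "_ \<longleftrightarrow> ?R")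
proof
  assume ind: "indep_family b S"
  have inj: "inj_on b S"
  proof (rule inj_onI, rule ccontr)
    fix s t assume st: "s \<in> S" "t \<in> S" "b s = b t" "s \<noteq> t"
    define c where "c = (\<lambda>x. if x = s then 1 else -1 :: 'c)"
    have "(\<Sum>x\<in>{s,t}. scale (c x) (b x)) = 0"
      using st by (simp add: c_def)
    from indep_familyD[OF ind _ _ this, of s] st show False by (simp add: c_def)
  qed
  have "free_vs.independent (b ` S)"
    unfolding free_vs.independent_explicit_finite_subsets
  proof safe
    fix T u x assume T: "T \<subseteq> b ` S" "finite T" "(\<Sum>v\<in>T. scale (u v) v) = 0" "x \<in> T"
    obtain F where F: "F \<subseteq> S" "T = b ` F" using T(1) by (auto simp: subset_image_iff)
    have injF: "inj_on b F" using inj F(1) by (rule inj_on_subset)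
    have finF: "finite F" using T(2) F(2) injF finite_image_iff by blast
    have "(\<Sum>s\<in>F. scale (u (b s)) (b s)) = 0"
      using T(3) unfolding F(2) by (simp add: sum.reindex[OF injF])
    from indep_familyD[OF ind finF F(1) this] T(4) F(2) show "u x = 0" by auto
  qed
  with inj show ?R by simp
next
  assume R: ?R
  show "indep_family b S" unfolding indep_family_def
  proof safe
    fix F c s assume F: "finite F" "F \<subseteq> S" "(\<Sum>s\<in>F. scale (c s) (b s)) = 0" "s \<in> F"
    have inj: "inj_on b F" using R F(2) inj_on_subset by blast
    have "(\<Sum>v\<in>b ` F. scale (c (the_inv_into F b v)) v) = (\<Sum>s\<in>F. scale (c s) (b s))"
      unfolding sum.reindex[OF inj] o_def
      by (rule sum.cong) (auto simp: the_inv_into_f_f[OF inj])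
    then have "c (the_inv_into F b (b s)) = 0"
      using free_vs.independentD[of "b ` S" "b ` F" "\<lambda>v. c (the_inv_into F b v)" "b s"] R F by auto
    then show "c s = 0" using F(4) by (simp add: the_inv_into_f_f[OF inj])
  qed
qed

lemma basis_family_iff:
  "basis_family b S V \<longleftrightarrow> indep_family b S \<and> free_vs.span (b ` S) = V"
  by (auto simp: basis_family_def indep_family_iff)

lemma span_family_expand:
  assumes "x \<in> free_vs.span (b ` S)"
  obtains F c where "finite F" "F \<subseteq> S" "x = (\<Sum>s\<in>F. scale (c s) (b s))"
proof -
  obtain T r where T: "finite T" "T \<subseteq> b ` S" "x = (\<Sum>a\<in>T. scale (r a) a)"
    using assms unfolding free_vs.span_explicit by blast
  define F where "F = (\<lambda>a. SOME s. s \<in> S \<and> b s = a) ` T"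
  have *: "(SOME s. s \<in> S \<and> b s = a) \<in> S \<and> b (SOME s. s \<in> S \<and> b s = a) = a" if "a \<in> T" for a
    by (rule someI_ex) (use T(2) that in auto)
  have inj: "inj_on (\<lambda>a. SOME s. s \<in> S \<and> b s = a) T"
    by (rule inj_on_inverseI[of _ b]) (use * in blast)
  have "(\<Sum>s\<in>F. scale (r (b s)) (b s)) = x"
    unfolding F_def sum.reindex[OF inj] o_def T(3) by (rule sum.cong) (use * in auto)
  then show ?thesis using that[of F "\<lambda>s. r (b s)"] * T(1) by (auto simp: F_def)
qed

text \<open>The common core of all the independence arguments: \<open>K\<close> erases every member
  of the family outside \<open>h\<close> and turns the others into an independent family. Only the
  image of the combination under \<open>K\<close> has to vanish, not the combination itself; this is
  what later also determines the primitive elements.\<close>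

lemma indep_contract:
  assumes K: "lin K" and h: "inj_on h G" and e: "indep_family e G"
    and Kh: "\<And>g. g \<in> G \<Longrightarrow> K (b (h g)) = e g"
    and K0: "\<And>s. s \<in> S \<Longrightarrow> s \<notin> h ` G \<Longrightarrow> K (b s) = 0"
    and F: "finite F" "F \<subseteq> S" and z: "K (\<Sum>s\<in>F. scale (c s) (b s)) = 0"
    and s: "s \<in> F" "s \<in> h ` G"
  shows "c s = 0"
proof -
  define H where "H = {g \<in> G. h g \<in> F}"
  have injH: "inj_on h H" using h by (rule inj_on_subset) (auto simp: H_def)
  have hH: "h ` H = F \<inter> h ` G" by (auto simp: H_def)
  then have finH: "finite H" using F(1) injH finite_image_iff by (metis finite_Int)
  have "(\<Sum>g\<in>H. scale (c (h g)) (e g)) = (\<Sum>g\<in>H. scale (c (h g)) (K (b (h g))))"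
    by (rule sum.cong) (auto simp: Kh H_def)
  also have "\<dots> = (\<Sum>s\<in>F \<inter> h ` G. scale (c s) (K (b s)))"
    unfolding hH[symmetric] sum.reindex[OF injH] o_def ..
  also have "\<dots> = (\<Sum>s\<in>F. scale (c s) (K (b s)))"
    by (rule sum.mono_neutral_left) (use F K0 in auto)
  also have "\<dots> = 0" using z by (simp add: lin_sum[OF K] lin_scale[OF K])
  finally have "\<forall>g\<in>H. c (h g) = 0"
    using indep_familyD[OF e finH, of "\<lambda>g. c (h g)"] by (auto simp: H_def)
  then show ?thesis using s by (auto simp: H_def)
qed

text \<open>Scalars are encoded as multiples of \<open>R []\<close>, because \<open>lin\<close>
  speaks only of maps between free vector spaces.\<close>

lemma coordinate_functional:
  assumes "indep_family b S" "s \<in> S"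
  obtains L :: "('b \<Rightarrow>\<^sub>0 'k::field) \<Rightarrow> (word \<Rightarrow>\<^sub>0 'k)"
  where "lin L" "\<And>t. t \<in> S \<Longrightarrow> L (b t) = (if t = s then R [] else 0)"
proof -
  interpret vector_space_pair "scale :: 'k \<Rightarrow> ('b \<Rightarrow>\<^sub>0 'k) \<Rightarrow> _" "scale :: 'k \<Rightarrow> (word \<Rightarrow>\<^sub>0 'k) \<Rightarrow> _" ..
  have inj: "inj_on b S" and ind: "free_vs.independent (b ` S)" using assms(1) by (auto simp: indep_family_iff)
  obtain g where g: "Vector_Spaces.linear scale scale g" "\<forall>x\<in>b ` S. g x = (if x = b s then R [] else 0)"
    using linear_independent_extend[OF ind, of "\<lambda>x. if x = b s then R [] else 0"] by blast
  interpret g: Vector_Spaces.linear scale scale g by (rule g(1))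
  show ?thesis
  proof (rule that[of g])
    show "lin g" by (simp add: lin_def g.add g.scale)
    show "g (b t) = (if t = s then R [] else 0)" if "t \<in> S" for t
      using g(2) that assms(2) inj by (auto dest: inj_onD)
  qed
qed

section \<open>Shuffles\<close>

text \<open>The predicate tells from which of the two words a letter comes, so the recursion of
  \<open>shuffles\<close> can be traded for two filter equations.\<close>

lemma shuffles_filter_iff:
  assumes "\<And>a. a \<in> set u \<Longrightarrow> P a" "\<And>b. b \<in> set v \<Longrightarrow> \<not> P b"
  shows "w \<in> shuffles u v \<longleftrightarrow> filter P w = u \<and> filter (\<lambda>x. \<not> P x) w = v"
proof
  assume w: "w \<in> shuffles u v"
  have "filter P u = u" "filter P v = []" "filter (\<lambda>x. \<not> P x) u = []" "filter (\<lambda>x. \<not> P x) v = v"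
    using assms by (auto simp: filter_id_conv filter_empty_conv)
  then show "filter P w = u \<and> filter (\<lambda>x. \<not> P x) w = v"
    using filter_shuffles[of P u v] filter_shuffles[of "\<lambda>x. \<not> P x" u v]
      imageI[OF w, of "filter P"] imageI[OF w, of "filter (\<lambda>x. \<not> P x)"] by simp
next
  assume "filter P w = u \<and> filter (\<lambda>x. \<not> P x) w = v"
  then show "w \<in> shuffles u v" using partition_in_shuffles[of w P] by simp
qed

text \<open>The condition on \<open>z\<close> is symmetric in the three alphabets, and the
  intermediate word \<open>w\<close> is recovered from \<open>z\<close> by deleting one of them.
  Hence both bracketings of an iterated shuffle produce the same words.\<close>

lemma in_shuffles_shuffles_iff:
  assumes "set u \<inter> set v = {}" "set u \<inter> set x = {}" "set v \<inter> set x = {}"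
  shows "w \<in> shuffles u v \<and> z \<in> shuffles w x \<longleftrightarrow>
    w = filter (\<lambda>a. a \<notin> set x) z \<and> filter (\<lambda>a. a \<in> set u) z = u \<and>
    filter (\<lambda>a. a \<in> set v) z = v \<and> filter (\<lambda>a. a \<in> set x) z = x \<and> set z = set u \<union> set v \<union> set x"
  (is "?L \<longleftrightarrow> ?R")
proof
  assume L: ?L
  have sw: "set w = set u \<union> set v" using L set_shuffles by blast
  have sz: "set z = set u \<union> set v \<union> set x" using L set_shuffles[of z w x] sw by simp
  have z: "filter (\<lambda>a. a \<notin> set x) z = w" "filter (\<lambda>a. a \<in> set x) z = x"
    using L shuffles_filter_iff[of w "\<lambda>a. a \<notin> set x" x z] sw assms by auto
  have w: "filter (\<lambda>a. a \<in> set u) w = u" "filter (\<lambda>a. a \<notin> set u) w = v"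
    using L shuffles_filter_iff[of u "\<lambda>a. a \<in> set u" v w] assms by auto
  have "filter (\<lambda>a. a \<in> set u) z = filter (\<lambda>a. a \<in> set u) w"
    unfolding z(1)[symmetric] filter_filter by (rule filter_cong) (use assms in auto)
  moreover have "filter (\<lambda>a. a \<in> set v) z = filter (\<lambda>a. a \<notin> set u) w"
    unfolding z(1)[symmetric] filter_filter by (rule filter_cong) (use assms sz in auto)
  ultimately show ?R using z w sz by simp
next
  assume R: ?R
  then have wz: "w = filter (\<lambda>a. a \<notin> set x) z" and sz: "set z = set u \<union> set v \<union> set x" by blast+
  have "filter (\<lambda>a. a \<in> set u) w = filter (\<lambda>a. a \<in> set u) z"
    unfolding wz filter_filter by (rule filter_cong) (use sz assms in auto)
  moreover have "filter (\<lambda>a. a \<notin> set u) w = filter (\<lambda>a. a \<in> set v) z"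
    unfolding wz filter_filter by (rule filter_cong) (use sz assms in auto)
  ultimately have "w \<in> shuffles u v"
    using shuffles_filter_iff[of u "\<lambda>a. a \<in> set u" v w] R assms by auto
  moreover have "z \<in> shuffles w x"
    using shuffles_filter_iff[of w "\<lambda>a. a \<notin> set x" x z] R by auto
  ultimately show ?L by simp
qed

lemma sum_shuffles_assoc:
  assumes "set u \<inter> set v = {}" "set u \<inter> set x = {}" "set v \<inter> set x = {}"
  shows "(\<Sum>w\<in>shuffles u v. \<Sum>z\<in>shuffles w x. F z) = (\<Sum>w\<in>shuffles v x. \<Sum>z\<in>shuffles u w. F z)"
proof -
  note 1 = in_shuffles_shuffles_iff[OF assms]
  have 2: "w \<in> shuffles v x \<and> z \<in> shuffles u w \<longleftrightarrow>
      w = filter (\<lambda>a. a \<notin> set u) z \<and> filter (\<lambda>a. a \<in> set u) z = u \<and>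
      filter (\<lambda>a. a \<in> set v) z = v \<and> filter (\<lambda>a. a \<in> set x) z = x \<and> set z = set u \<union> set v \<union> set x" for w z
    using in_shuffles_shuffles_iff[of x v u w z] assms
    by (simp only: shuffles_commutes[of v x] shuffles_commutes[of u w] Int_commute Un_ac conj_ac)
  \<comment> \<open>Both double sums are sums over this one set of final words; the two index sets
    are graphs of functions on it.\<close>
  define Z where "Z = {z. filter (\<lambda>a. a \<in> set u) z = u \<and> filter (\<lambda>a. a \<in> set v) z = v \<and>
      filter (\<lambda>a. a \<in> set x) z = x \<and> set z = set u \<union> set v \<union> set x}"
  have S1: "(SIGMA w:shuffles u v. shuffles w x) = (\<lambda>z. (filter (\<lambda>a. a \<notin> set x) z, z)) ` Z"
  proof (rule set_eqI)
    fix p show "p \<in> (SIGMA w:shuffles u v. shuffles w x) \<longleftrightarrow> p \<in> (\<lambda>z. (filter (\<lambda>a. a \<notin> set x) z, z)) ` Z"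
      unfolding image_iff Z_def mem_Sigma_iff using 1[of "fst p" "snd p"] by (cases p) (simp only: mem_Sigma_iff fst_conv snd_conv prod.inject mem_Collect_eq, blast)
  qed
  have S2: "(SIGMA w:shuffles v x. shuffles u w) = (\<lambda>z. (filter (\<lambda>a. a \<notin> set u) z, z)) ` Z"
  proof (rule set_eqI)
    fix p show "p \<in> (SIGMA w:shuffles v x. shuffles u w) \<longleftrightarrow> p \<in> (\<lambda>z. (filter (\<lambda>a. a \<notin> set u) z, z)) ` Z"
      unfolding image_iff Z_def mem_Sigma_iff using 2[of "fst p" "snd p"] by (cases p) (simp only: mem_Sigma_iff fst_conv snd_conv prod.inject mem_Collect_eq, blast)
  qed
  have inj: "inj_on (\<lambda>z. (g z, z)) Z" for g :: "'a list \<Rightarrow> 'a list"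
    by (rule inj_onI) simp
  have "(\<Sum>w\<in>shuffles u v. \<Sum>z\<in>shuffles w x. F z)
      = (\<Sum>(w,z)\<in>(SIGMA w:shuffles u v. shuffles w x). F z)"
    by (rule sum.Sigma) auto
  also have "\<dots> = (\<Sum>(w,z)\<in>(SIGMA w:shuffles v x. shuffles u w). F z)"
    unfolding S1 S2 by (simp add: sum.reindex[OF inj])
  also have "\<dots> = (\<Sum>w\<in>shuffles v x. \<Sum>z\<in>shuffles u w. F z)"
    by (rule sum.Sigma[symmetric]) auto
  finally show ?thesis .
qed

text \<open>A cut of a shuffle induces a cut of each of the two words, at the number of its letters
  in the prefix. Conversely, shuffles of the two prefixes and of the two suffixes are glued by
  concatenation.\<close>

lemma sum_cut_shuffles:
  assumes "set u \<inter> set v = {}"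
  shows "(\<Sum>w\<in>shuffles u v. \<Sum>i\<le>length w. G (take i w) (drop i w)) =
    (\<Sum>j\<le>length u. \<Sum>k\<le>length v. \<Sum>x\<in>shuffles (take j u) (take k v). \<Sum>y\<in>shuffles (drop j u) (drop k v). G x y)"
proof -
  define P where "P = (\<lambda>a. a \<in> set u)"
  have sh: "w \<in> shuffles u v \<longleftrightarrow> filter P w = u \<and> filter (\<lambda>a. \<not> P a) w = v" for w
    by (rule shuffles_filter_iff) (use assms in \<open>auto simp: P_def\<close>)
  have sh1: "x \<in> shuffles (take j u) (take k v) \<longleftrightarrow> filter P x = take j u \<and> filter (\<lambda>a. \<not> P a) x = take k v" for x j k
    by (rule shuffles_filter_iff) (use assms in \<open>auto simp: P_def dest: in_set_takeD\<close>)
  have sh2: "x \<in> shuffles (drop j u) (drop k v) \<longleftrightarrow> filter P x = drop j u \<and> filter (\<lambda>a. \<not> P a) x = drop k v" for x j k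
    by (rule shuffles_filter_iff) (use assms in \<open>auto simp: P_def dest: in_set_dropD\<close>)
  have tk: "take (length (filter Q (take i w))) (filter Q w) = filter Q (take i w)"
       "drop (length (filter Q (take i w))) (filter Q w) = filter Q (drop i w)" for Q i and w :: "'a list"
    by (metis append_eq_conv_conj append_take_drop_id filter_append)+
  have le: "length (filter Q (take i w)) \<le> length (filter Q w)" for Q i and w :: "'a list"
    by (metis append_take_drop_id filter_append le_add1 length_append)
  have "(\<Sum>w\<in>shuffles u v. \<Sum>i\<le>length w. G (take i w) (drop i w))
      = (\<Sum>(w,i)\<in>(SIGMA w:shuffles u v. {..length w}). G (take i w) (drop i w))"
    by (rule sum.Sigma) auto
  also have "\<dots> = (\<Sum>(j,k,x,y)\<in>(SIGMA j:{..length u}. SIGMA k:{..length v}.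
      shuffles (take j u) (take k v) \<times> shuffles (drop j u) (drop k v)). G x y)"
  proof (rule sum.reindex_bij_witness[where
        i = "\<lambda>(j,k,x,y). (x @ y, length x)" and
        j = "\<lambda>(w,i). (length (filter P (take i w)), length (filter (\<lambda>a. \<not> P a) (take i w)), take i w, drop i w)"], goal_cases)
    case (1 a) then show ?case by (auto simp: min_def)
  next
    case (2 a) then show ?case by (auto simp: sh sh1 sh2 tk le)
  next
    case (3 b) then show ?case by (auto simp: sh1 sh2)
  next
    case (4 b) then show ?case by (auto simp: sh sh1 sh2)
  next
    case (5 a) then show ?case by auto
  qed
  also have "\<dots> = (\<Sum>j\<le>length u. \<Sum>k\<le>length v. \<Sum>x\<in>shuffles (take j u) (take k v). \<Sum>y\<in>shuffles (drop j u) (drop k v). G x y)"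
    by (simp add: sum.Sigma)
  finally show ?thesis .
qed

lemma shuffles_map: "shuffles (map h u) (map h v) = map h ` shuffles u v"
  by (induction u v rule: shuffles.induct) (auto simp: image_Un image_image)

section \<open>Packing\<close>

lemma wmax_Nil [simp]: "wmax [] = 0"
  by (simp add: wmax_def)

lemma wmax_ge: "a \<in> set w \<Longrightarrow> a \<le> wmax w"
  by (simp add: wmax_def)

lemma wmax_in: "w \<noteq> [] \<Longrightarrow> wmax w \<in> set w"
  unfolding wmax_def by (metis Max_in Max_insert List.finite_set max_0L set_empty)

lemma wmax_eqI: "m \<in> set w \<Longrightarrow> (\<And>a. a \<in> set w \<Longrightarrow> a \<le> m) \<Longrightarrow> wmax w = m"
  by (metis antisym empty_iff empty_set wmax_ge wmax_in)

lemma length_pack [simp]: "length (pack w) = length w"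
  by (simp add: pack_def)

lemma pack_Nil [simp]: "pack [] = []"
  by (simp add: pack_def)

lemma pack_eq_Nil_iff [simp]: "pack w = [] \<longleftrightarrow> w = []"
  by (simp add: pack_def)

lemma packed_Nil [simp]: "packed []"
  by (simp add: packed_def)

lemma rank_strict_mono:
  fixes S :: "nat set"
  assumes "finite S"
  shows "strict_mono_on S (\<lambda>a. card {b \<in> S. b \<le> a})"
proof (rule strict_mono_onI)
  fix r s assume "r \<in> S" "s \<in> S" "r < s"
  then have "s \<in> {b \<in> S. b \<le> s} - {b \<in> S. b \<le> r}" "{b \<in> S. b \<le> r} \<subseteq> {b \<in> S. b \<le> s}" by auto
  then have "{b \<in> S. b \<le> r} \<subset> {b \<in> S. b \<le> s}" by blast
  then show "card {b \<in> S. b \<le> r} < card {b \<in> S. b \<le> s}" using assms by (intro psubset_card_mono) auto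
qed

lemma pack_map:
  assumes "strict_mono_on (set w) h"
  shows "pack (map h w) = pack w"
  unfolding pack_def map_map o_def
proof (rule map_cong[OF refl])
  fix a assume a: "a \<in> set w"
  have "{b \<in> set (map h w). b \<le> h a} = h ` {b \<in> set w. b \<le> a}"
    using a assms by (auto simp: strict_mono_on_leD strict_mono_on_less_eq)
  moreover have "inj_on h {b \<in> set w. b \<le> a}"
    using strict_mono_on_imp_inj_on[OF assms] by (rule inj_on_subset) auto
  ultimately show "card {b \<in> set (map h w). b \<le> h a} = card {b \<in> set w. b \<le> a}"
    by (simp add: card_image)
qed

lemma pack_id: "packed w \<Longrightarrow> pack w = w"
  unfolding pack_def
proof (rule map_idI)
  fix a assume "packed w" "a \<in> set w"
  then have "{b \<in> set w. b \<le> a} = {1..a}" by (auto simp: packed_def)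
  then show "card {b \<in> set w. b \<le> a} = a" by simp
qed

lemma set_pack: "set (pack w) = {1..card (set w)}"
proof (rule card_subset_eq)
  show "set (pack w) \<subseteq> {1..card (set w)}"
  proof
    fix x assume "x \<in> set (pack w)"
    then obtain a where a: "a \<in> set w" "x = card {b \<in> set w. b \<le> a}" by (auto simp: pack_def)
    then have "a \<in> {b \<in> set w. b \<le> a}" by simp
    then have "x > 0" unfolding a(2) by (subst card_gt_0_iff) auto
    moreover have "x \<le> card (set w)" unfolding a(2) by (rule card_mono) auto
    ultimately show "x \<in> {1..card (set w)}" by simp
  qed
  have "set (pack w) = (\<lambda>a. card {b \<in> set w. b \<le> a}) ` set w" by (simp add: pack_def)
  then show "card (set (pack w)) = card {1..card (set w)}"
    using card_image[OF strict_mono_on_imp_inj_on[OF rank_strict_mono[of "set w"]]] by simp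
qed simp

lemma wmax_pack: "wmax (pack w) = card (set w)"
proof (cases "w = []")
  case False
  then have "card (set w) \<ge> 1" by (simp add: Suc_le_eq card_gt_0_iff)
  then show ?thesis by (intro wmax_eqI) (auto simp: set_pack)
qed simp

lemma packed_pack [simp]: "packed (pack w)"
  by (simp add: packed_def set_pack wmax_pack)

text \<open>The products of packed words can be computed on any representatives in which the letters
  of \<open>u\<close> lie under those of \<open>v\<close>. This keeps nested shifts out of the
  identities between three words.\<close>

definition below :: "word \<Rightarrow> word \<Rightarrow> bool" where
  "below u v \<longleftrightarrow> (\<forall>a\<in>set u. \<forall>b\<in>set v. a < b)"

lemma below_disjoint: "below u v \<Longrightarrow> set u \<inter> set v = {}"
  by (auto simp: below_def)

lemma below_shift: "packed v \<Longrightarrow> below u (shift (wmax u) v)"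
  unfolding below_def shift_def packed_def by (auto dest!: wmax_ge)

lemma pack_shift: "packed v \<Longrightarrow> pack (shift k v) = v"
  unfolding shift_def by (subst pack_map) (auto intro: strict_mono_onI simp: pack_id)

text \<open>The witness is the rank in the joint alphabet. On \<open>u\<close> it is the rank in
  \<open>u\<close>; on \<open>v\<close> it is the rank in \<open>v\<close> raised by the number of
  distinct letters of \<open>u\<close>, which is the shift in the definition of the
  products.\<close>

lemma below_relabel:
  assumes "below u v"
  obtains h where "strict_mono_on (set u \<union> set v) h" "map h u = pack u"
    "map h v = shift (wmax (pack u)) (pack v)"
    "\<And>w. set w = set u \<union> set v \<Longrightarrow> pack w = map h w"
proof
  let ?S = "set u \<union> set v" and ?h = "\<lambda>a. card {b \<in> set u \<union> set v. b \<le> a}"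
  show "strict_mono_on ?S ?h" by (rule rank_strict_mono) simp
  show "map ?h u = pack u" unfolding pack_def
  proof (rule map_cong[OF refl])
    fix a assume "a \<in> set u"
    then have "{b \<in> ?S. b \<le> a} = {b \<in> set u. b \<le> a}" using assms by (fastforce simp: below_def)
    then show "?h a = card {b \<in> set u. b \<le> a}" by simp
  qed
  show "map ?h v = shift (wmax (pack u)) (pack v)"
    unfolding shift_def pack_def[of v] map_map o_def wmax_pack
  proof (rule map_cong[OF refl])
    fix a assume "a \<in> set v"
    then have "{b \<in> ?S. b \<le> a} = {b \<in> set v. b \<le> a} \<union> set u" using assms by (fastforce simp: below_def)
    moreover have "{b \<in> set v. b \<le> a} \<inter> set u = {}" using assms by (fastforce simp: below_def)
    ultimately show "?h a = card {b \<in> set v. b \<le> a} + card (set u)" by (simp add: card_Un_disjoint)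
  qed
  show "pack w = map ?h w" if "set w = ?S" for w by (simp add: pack_def that)
qed

section \<open>Half-products with unit\<close>

text \<open>The half-products extended to the empty word by \<open>x \<lhd> 1 = x\<close>, \<open>1 \<lhd> x = 0\<close>, \<open>1 \<rhd> x = x\<close>, \<open>x \<rhd> 1 = 0\<close>
  (and \<open>1 \<lhd> 1 = 1 \<rhd> 1 = 0\<close>), so that no case distinction on empty factors is needed.\<close>

definition umul_word :: "word \<Rightarrow> word \<Rightarrow> 'k::field wqsym" where
  "umul_word u v = (\<Sum>w\<in>shuffles u (shift (wmax u) v). R w)"

definition uprec_word :: "word \<Rightarrow> word \<Rightarrow> 'k::field wqsym" where
  "uprec_word u v = (if u = [] then 0
     else \<Sum>w\<in>shuffles (butlast u) (shift (wmax u) v). R (w @ [last u]))"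

definition usucc_word :: "word \<Rightarrow> word \<Rightarrow> 'k::field wqsym" where
  "usucc_word u v = (if v = [] then 0
     else \<Sum>w\<in>shuffles u (butlast (shift (wmax u) v)). R (w @ [last (shift (wmax u) v)]))"

definition umul :: "'k::field wqsym \<Rightarrow> 'k wqsym \<Rightarrow> 'k wqsym" (infixl \<open>\<odot>\<close> 70) where
  "umul = bilinear_ext umul_word"

definition uprec :: "'k::field wqsym \<Rightarrow> 'k wqsym \<Rightarrow> 'k wqsym" (infixl \<open>\<lhd>\<close> 70) where
  "uprec = bilinear_ext uprec_word"

definition usucc :: "'k::field wqsym \<Rightarrow> 'k wqsym \<Rightarrow> 'k wqsym" (infixl \<open>\<rhd>\<close> 70) where
  "usucc = bilinear_ext usucc_word"

named_theorems lin_intros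

declare lin_id [lin_intros] lin_zero [lin_intros] lin_plus [lin_intros] lin_linear_ext [lin_intros]

lemma lin_ops [lin_intros]:
  assumes "lin F"
  shows "lin (\<lambda>x. F x \<odot> y)" "lin (\<lambda>x. y \<odot> F x)" "lin (\<lambda>x. F x \<lhd> y)" "lin (\<lambda>x. y \<lhd> F x)"
    "lin (\<lambda>x. F x \<rhd> y)" "lin (\<lambda>x. y \<rhd> F x)"
  using assms by (simp_all add: umul_def uprec_def usucc_def lin_def
      lin_add[OF lin_bilinear_ext_left] lin_add[OF lin_bilinear_ext_right]
      lin_scale[OF lin_bilinear_ext_left] lin_scale[OF lin_bilinear_ext_right])

lemma lin_tens [lin_intros]:
  assumes "lin F"
  shows "lin (\<lambda>x. tens (F x) y)" "lin (\<lambda>x. tens y (F x))"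
  using assms by (simp_all add: tens_def lin_def
      lin_add[OF lin_bilinear_ext_left] lin_add[OF lin_bilinear_ext_right]
      lin_scale[OF lin_bilinear_ext_left] lin_scale[OF lin_bilinear_ext_right])

lemma lin_linear_ext_comp [lin_intros]: "lin F \<Longrightarrow> lin (\<lambda>x. linear_ext f (F x))"
  by (rule lin_comp[OF lin_linear_ext])

lemmas op_lin = lin_ops(1,3,5)[OF lin_id] lin_ops(2,4,6)[OF lin_id] lin_tens[OF lin_id]
lemmas op_sum = op_lin[THEN lin_sum]
lemmas op_scale = op_lin[THEN lin_scale]
lemmas op_0 = op_lin[THEN lin_0]

lemma ops_R:
  "R u \<odot> R v = umul_word u v" "R u \<lhd> R v = uprec_word u v" "R u \<rhd> R v = usucc_word u v"
  by (simp_all add: umul_def uprec_def usucc_def R_def)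

lemma shift_simps [simp]: "shift 0 w = w" "shift k [] = []"
  by (simp_all add: shift_def)

lemma unit_words:
  "R [] \<odot> R v = R v" "R u \<odot> R [] = R u" "R [] \<lhd> R v = 0" "R u \<rhd> R [] = 0"
  "u \<noteq> [] \<Longrightarrow> R u \<lhd> R [] = R u" "v \<noteq> [] \<Longrightarrow> R [] \<rhd> R v = R v"
  by (simp_all add: ops_R umul_word_def uprec_word_def usucc_word_def)

text \<open>Transport along the relabelling of \<open>below_relabel\<close>, which is injective on
  the shuffles, so no multiplicity arises. The half-products below follow the same pattern with one
  letter held at the end.\<close>

lemma umul_word_pack:
  assumes "below u v"
  shows "umul_word (pack u) (pack v) = (\<Sum>w\<in>shuffles u v. R (pack w))"
proof -
  obtain h where h: "strict_mono_on (set u \<union> set v) h" "map h u = pack u"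
    "map h v = shift (wmax (pack u)) (pack v)"
    "\<And>w. set w = set u \<union> set v \<Longrightarrow> pack w = map h w"
    using below_relabel[OF assms] by blast
  have h3: "shift (wmax (map h u)) (pack v) = map h v" by (simp add: h)
  have "inj_on (map h) (shuffles u v)"
    by (rule inj_on_mapI, rule inj_on_subset[OF strict_mono_on_imp_inj_on[OF h(1)]])
       (auto dest: set_shuffles)
  then have "umul_word (pack u) (pack v) = (\<Sum>w\<in>shuffles u v. R (map h w))"
    unfolding umul_word_def h(2)[symmetric] h3 shuffles_map by (simp add: sum.reindex)
  also have "\<dots> = (\<Sum>w\<in>shuffles u v. R (pack w))"
    by (rule sum.cong) (auto simp: h(4) set_shuffles)
  finally show ?thesis .
qed

lemma set_snoc_butlast: "u \<noteq> [] \<Longrightarrow> set u = insert (last u) (set (butlast u))"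
  by (metis append_butlast_last_id list.simps(15) rotate1.simps(2) set_rotate1)

lemma uprec_word_pack:
  assumes "below u v" "u \<noteq> []"
  shows "uprec_word (pack u) (pack v) = (\<Sum>w\<in>shuffles (butlast u) v. R (pack (w @ [last u])))"
proof -
  obtain h where h: "strict_mono_on (set u \<union> set v) h" "map h u = pack u"
    "map h v = shift (wmax (pack u)) (pack v)"
    "\<And>w. set w = set u \<union> set v \<Longrightarrow> pack w = map h w"
    using below_relabel[OF assms(1)] by blast
  have h3: "shift (wmax (map h u)) (pack v) = map h v" by (simp add: h)
  note su = set_snoc_butlast[OF assms(2)]
  have "inj_on (map h) (shuffles (butlast u) v)"
    by (rule inj_on_mapI, rule inj_on_subset[OF strict_mono_on_imp_inj_on[OF h(1)]])
       (auto dest: set_shuffles simp: su)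
  then have "uprec_word (pack u) (pack v) = (\<Sum>w\<in>shuffles (butlast u) v. R (map h (w @ [last u])))"
    unfolding uprec_word_def h(2)[symmetric] h3 using assms(2)
    by (simp add: shuffles_map sum.reindex last_map map_butlast[symmetric])
  also have "\<dots> = (\<Sum>w\<in>shuffles (butlast u) v. R (pack (w @ [last u])))"
    by (rule sum.cong[OF refl], subst h(4)) (auto simp: set_shuffles su)
  finally show ?thesis .
qed

lemma usucc_word_pack:
  assumes "below u v" "v \<noteq> []"
  shows "usucc_word (pack u) (pack v) = (\<Sum>w\<in>shuffles u (butlast v). R (pack (w @ [last v])))"
proof -
  obtain h where h: "strict_mono_on (set u \<union> set v) h" "map h u = pack u"
    "map h v = shift (wmax (pack u)) (pack v)"
    "\<And>w. set w = set u \<union> set v \<Longrightarrow> pack w = map h w"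
    using below_relabel[OF assms(1)] by blast
  have h3: "shift (wmax (map h u)) (pack v) = map h v" by (simp add: h)
  note sv = set_snoc_butlast[OF assms(2)]
  have "inj_on (map h) (shuffles u (butlast v))"
    by (rule inj_on_mapI, rule inj_on_subset[OF strict_mono_on_imp_inj_on[OF h(1)]])
       (auto dest: set_shuffles simp: sv)
  then have "usucc_word (pack u) (pack v) = (\<Sum>w\<in>shuffles u (butlast v). R (map h (w @ [last v])))"
    unfolding usucc_word_def h(2)[symmetric] h3 using assms(2)
    by (simp add: shuffles_map sum.reindex last_map map_butlast[symmetric])
  also have "\<dots> = (\<Sum>w\<in>shuffles u (butlast v). R (pack (w @ [last v])))"
    by (rule sum.cong[OF refl], subst h(4)) (auto simp: set_shuffles sv)
  finally show ?thesis .
qed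

section \<open>The dendriform identities on packed words, computed in stacked alphabets\<close>

lemma packed_below2:
  assumes "packed u" "packed v"
  obtains v' where "below u v'" "pack u = u" "pack v' = v"
  using below_shift[OF assms(2)] pack_shift[OF assms(2)] pack_id[OF assms(1)] by blast

lemma packed_below3:
  assumes "packed u" "packed v" "packed x"
  obtains v' x' where "below u v'" "below u x'" "below v' x'" "pack u = u" "pack v' = v" "pack x' = x"
proof -
  obtain v' where v': "below u v'" "pack u = u" "pack v' = v"
    using packed_below2[OF assms(1,2)] by blast
  \<comment> \<open>Shifting \<open>x\<close> by the maximum of the concatenation places it above
    \<open>u\<close> and \<open>v'\<close> at once.\<close>
  have "below (u @ v') (shift (wmax (u @ v')) x)" by (rule below_shift[OF assms(3)])
  then show ?thesis by (intro that[OF v'(1) _ _ v'(2,3) pack_shift[OF assms(3)]]) (auto simp: below_def)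
qed

lemma below_snoc:
  "below (w @ [a]) x \<longleftrightarrow> below w x \<and> (\<forall>b\<in>set x. a < b)"
  "below x (w @ [a]) \<longleftrightarrow> below x w \<and> (\<forall>b\<in>set x. b < a)"
  by (auto simp: below_def)

lemma below_butlast:
  "below u x \<Longrightarrow> below (butlast u) x" "below x u \<Longrightarrow> below x (butlast u)"
  by (auto simp: below_def dest: in_set_butlastD)

lemma belowD: "below u v \<Longrightarrow> a \<in> set u \<Longrightarrow> b \<in> set v \<Longrightarrow> a < b"
  by (simp add: below_def)

lemma below_shuffle_left: "below u x \<Longrightarrow> below v x \<Longrightarrow> w \<in> shuffles u v \<Longrightarrow> below w x"
  by (auto simp: below_def dest!: set_shuffles)

lemma below_shuffle_right: "below x u \<Longrightarrow> below x v \<Longrightarrow> w \<in> shuffles u v \<Longrightarrow> below x w"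
  by (auto simp: below_def dest!: set_shuffles)

text \<open>In both expressions the last letter of \<open>u\<close> is held at the end, and what
  remains is associativity of shuffling \<open>butlast u\<close>, \<open>v'\<close> and
  \<open>x'\<close>. The next two identities hold in the same way, with the last letter of the
  second and of the third word held.\<close>

lemma uprec_uprec_words:
  assumes "packed u" "packed v" "packed x"
  shows "(R u \<lhd> R v) \<lhd> R x = R u \<lhd> (R v \<odot> R x)"
proof (cases "u = []")
  case True
  then show ?thesis unfolding ops_R(1) umul_word_def by (simp add: ops_R uprec_word_def op_0 op_sum)
next
  case False
  obtain v' x' where b: "below u v'" "below u x'" "below v' x'" and p: "pack u = u" "pack v' = v" "pack x' = x"
    using packed_below3[OF assms] by blast
  let ?u = "butlast u" and ?a = "last u"
  have l: "?a \<in> set u" using False by simp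
  have "(R u \<lhd> R v) \<lhd> R x = (\<Sum>w\<in>shuffles ?u v'. uprec_word (pack (w @ [?a])) (pack x'))"
    by (simp add: ops_R op_sum uprec_word_pack[OF b(1) False, unfolded p] p)
  also have "\<dots> = (\<Sum>w\<in>shuffles ?u v'. \<Sum>z\<in>shuffles w x'. R (pack (z @ [?a])))"
  proof (rule sum.cong[OF refl])
    fix w assume w: "w \<in> shuffles ?u v'"
    have "below (w @ [?a]) x'"
      using below_shuffle_left[OF below_butlast(1)[OF b(2)] b(3) w] b(2) l
      by (auto simp: below_snoc belowD)
    then show "uprec_word (pack (w @ [?a])) (pack x') = (\<Sum>z\<in>shuffles w x'. R (pack (z @ [?a])))"
      by (subst uprec_word_pack) auto
  qed
  also have "\<dots> = (\<Sum>w\<in>shuffles v' x'. \<Sum>z\<in>shuffles ?u w. R (pack (z @ [?a])))"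
    by (rule sum_shuffles_assoc) (use b in \<open>auto intro!: below_disjoint below_butlast\<close>)
  also have "\<dots> = (\<Sum>w\<in>shuffles v' x'. uprec_word (pack u) (pack w))"
    by (intro sum.cong[OF refl] uprec_word_pack[symmetric] below_shuffle_right[OF b(1,2)] False)
  also have "\<dots> = R u \<lhd> (R v \<odot> R x)"
    by (simp add: ops_R op_sum umul_word_pack[OF b(3), unfolded p] p)
  finally show ?thesis .
qed

lemma usucc_uprec_words:
  assumes "packed u" "packed v" "packed x"
  shows "(R u \<rhd> R v) \<lhd> R x = R u \<rhd> (R v \<lhd> R x)"
proof (cases "v = []")
  case True
  then show ?thesis by (simp add: ops_R uprec_word_def usucc_word_def op_0)
next
  case False
  obtain v' x' where b: "below u v'" "below u x'" "below v' x'" and p: "pack u = u" "pack v' = v" "pack x' = x"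
    using packed_below3[OF assms] by blast
  from False p have ne: "v' \<noteq> []" by auto
  let ?v = "butlast v'" and ?a = "last v'"
  have l: "?a \<in> set v'" using ne by simp
  have "(R u \<rhd> R v) \<lhd> R x = (\<Sum>w\<in>shuffles u ?v. uprec_word (pack (w @ [?a])) (pack x'))"
    by (simp add: ops_R op_sum usucc_word_pack[OF b(1) ne, unfolded p] p)
  also have "\<dots> = (\<Sum>w\<in>shuffles u ?v. \<Sum>z\<in>shuffles w x'. R (pack (z @ [?a])))"
  proof (rule sum.cong[OF refl])
    fix w assume w: "w \<in> shuffles u ?v"
    have "below (w @ [?a]) x'"
      using below_shuffle_left[OF b(2) below_butlast(1)[OF b(3)] w] b(3) l
      by (auto simp: below_snoc belowD)
    then show "uprec_word (pack (w @ [?a])) (pack x') = (\<Sum>z\<in>shuffles w x'. R (pack (z @ [?a])))"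
      by (subst uprec_word_pack) auto
  qed
  also have "\<dots> = (\<Sum>w\<in>shuffles ?v x'. \<Sum>z\<in>shuffles u w. R (pack (z @ [?a])))"
    by (rule sum_shuffles_assoc) (use b in \<open>auto intro!: below_disjoint below_butlast\<close>)
  also have "\<dots> = (\<Sum>w\<in>shuffles ?v x'. usucc_word (pack u) (pack (w @ [?a])))"
  proof (rule sum.cong[OF refl])
    fix w assume w: "w \<in> shuffles ?v x'"
    have "below u (w @ [?a])"
      using below_shuffle_right[OF below_butlast(2)[OF b(1)] b(2) w] b(1) l
      by (auto simp: below_snoc belowD)
    then show "(\<Sum>z\<in>shuffles u w. R (pack (z @ [?a]))) = usucc_word (pack u) (pack (w @ [?a]))"
      by (subst usucc_word_pack) auto
  qed
  also have "\<dots> = R u \<rhd> (R v \<lhd> R x)"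
    by (simp add: ops_R op_sum uprec_word_pack[OF b(3) ne, unfolded p] p)
  finally show ?thesis .
qed

lemma umul_usucc_words:
  assumes "packed u" "packed v" "packed x"
  shows "(R u \<odot> R v) \<rhd> R x = R u \<rhd> (R v \<rhd> R x)"
proof (cases "x = []")
  case True
  then show ?thesis unfolding ops_R(1) umul_word_def by (simp add: ops_R usucc_word_def op_0 op_sum)
next
  case False
  obtain v' x' where b: "below u v'" "below u x'" "below v' x'" and p: "pack u = u" "pack v' = v" "pack x' = x"
    using packed_below3[OF assms] by blast
  from False p have ne: "x' \<noteq> []" by auto
  let ?x = "butlast x'" and ?a = "last x'"
  have l: "?a \<in> set x'" using ne by simp
  have "(R u \<odot> R v) \<rhd> R x = (\<Sum>w\<in>shuffles u v'. usucc_word (pack w) (pack x'))"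
    by (simp add: ops_R op_sum umul_word_pack[OF b(1), unfolded p] p)
  also have "\<dots> = (\<Sum>w\<in>shuffles u v'. \<Sum>z\<in>shuffles w ?x. R (pack (z @ [?a])))"
    by (intro sum.cong[OF refl] usucc_word_pack below_shuffle_left[OF b(2,3)] ne)
  also have "\<dots> = (\<Sum>w\<in>shuffles v' ?x. \<Sum>z\<in>shuffles u w. R (pack (z @ [?a])))"
    by (rule sum_shuffles_assoc) (use b in \<open>auto intro!: below_disjoint below_butlast\<close>)
  also have "\<dots> = (\<Sum>w\<in>shuffles v' ?x. usucc_word (pack u) (pack (w @ [?a])))"
  proof (rule sum.cong[OF refl])
    fix w assume w: "w \<in> shuffles v' ?x"
    have "below u (w @ [?a])"
      using below_shuffle_right[OF b(1) below_butlast(2)[OF b(2)] w] b(2) l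
      by (auto simp: below_snoc belowD)
    then show "(\<Sum>z\<in>shuffles u w. R (pack (z @ [?a]))) = usucc_word (pack u) (pack (w @ [?a]))"
      by (subst usucc_word_pack) auto
  qed
  also have "\<dots> = R u \<rhd> (R v \<rhd> R x)"
    by (simp add: ops_R op_sum usucc_word_pack[OF b(3) ne, unfolded p] p)
  finally show ?thesis .
qed

text \<open>Mirror image of the recursion of \<open>shuffles\<close>: that recursion looks at first
  letters, the half-products look at last ones.\<close>

lemma shuffles_snoc_split:
  assumes "u \<noteq> []" "v \<noteq> []"
  shows "shuffles u v = (\<lambda>w. w @ [last u]) ` shuffles (butlast u) v \<union> (\<lambda>w. w @ [last v]) ` shuffles u (butlast v)"
  using assms
proof (induction u v rule: shuffles.induct)
  case (3 x xs y ys)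
  show ?case
    by (cases "xs = []"; cases "ys = []") (use 3 in \<open>auto simp: image_Un image_image\<close>)
qed auto

text \<open>The pair of empty words has to be excluded: its product is \<open>R []\<close>, while
  both of its half-products are 0.\<close>

lemma uprec_usucc_words:
  assumes "packed u" "packed v" "u \<noteq> [] \<or> v \<noteq> []"
  shows "R u \<odot> R v = R u \<lhd> R v + R u \<rhd> R v"
proof -
  obtain v' where b: "below u v'" and p: "pack u = u" "pack v' = v"
    using packed_below2[OF assms(1,2)] by blast
  consider "u = []" "v' \<noteq> []" | "u \<noteq> []" "v' = []" | "u \<noteq> []" "v' \<noteq> []" using assms(3) p by auto
  then show ?thesis
  proof cases
    case 1
    then show ?thesis using assms p by (simp add: unit_words ops_R(2) uprec_word_def op_0)
  next
    case 2
    then show ?thesis using assms p by (auto simp: unit_words ops_R(3) usucc_word_def op_0)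
  next
    case 3
    have "last u < last v'" using 3 by (intro belowD[OF b]) auto
    then have "(\<lambda>w. w @ [last u]) ` shuffles (butlast u) v' \<inter> (\<lambda>w. w @ [last v']) ` shuffles u (butlast v') = {}"
      by auto
    then have "R u \<odot> R v = (\<Sum>w\<in>(\<lambda>w. w @ [last u]) ` shuffles (butlast u) v'. R (pack w))
        + (\<Sum>w\<in>(\<lambda>w. w @ [last v']) ` shuffles u (butlast v'). R (pack w))"
      by (simp add: ops_R umul_word_pack[OF b, unfolded p] shuffles_snoc_split[OF 3] sum.union_disjoint)
    also have "\<dots> = R u \<lhd> R v + R u \<rhd> R v"
      by (simp add: ops_R sum.reindex inj_on_def uprec_word_pack[OF b 3(1), unfolded p]
          usucc_word_pack[OF b 3(2), unfolded p])
    finally show ?thesis .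
  qed
qed

lemma uprec_word_prec_word:
  assumes "packed u" "packed v" "u \<noteq> []" "v \<noteq> []"
  shows "prec_word u v = uprec_word u v"
proof -
  let ?v = "shift (wmax u) v"
  have v: "?v \<noteq> []" using assms by (simp add: shift_def)
  \<comment> \<open>The two last letters differ, so the last letter of a shuffle tells from which
    word it comes.\<close>
  have "last u < last ?v" using belowD[OF below_shift[OF assms(2)], of "last u" u "last ?v"] assms(3) v by simp
  then have "{w. w \<in> shuffles u ?v \<and> last w = last u} = (\<lambda>w. w @ [last u]) ` shuffles (butlast u) ?v"
    unfolding shuffles_snoc_split[OF assms(3) v] by auto
  then show ?thesis using assms by (simp add: prec_word_def uprec_word_def sum.reindex inj_on_def)
qed

lemma usucc_word_succ_word:
  assumes "packed u" "packed v" "u \<noteq> []" "v \<noteq> []"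
  shows "succ_word u v = usucc_word u v"
proof -
  let ?v = "shift (wmax u) v"
  have v: "?v \<noteq> []" using assms by (simp add: shift_def)
  have "last u < last ?v" using belowD[OF below_shift[OF assms(2)], of "last u" u "last ?v"] assms(3) v by simp
  then have "{w. w \<in> shuffles u ?v \<and> last w = last ?v} = (\<lambda>w. w @ [last ?v]) ` shuffles u (butlast ?v)"
    unfolding shuffles_snoc_split[OF assms(3) v] by auto
  then show ?thesis using assms by (simp add: succ_word_def usucc_word_def sum.reindex inj_on_def)
qed

section \<open>The coproducts\<close>

text \<open>\<open>cop False\<close> is the coproduct with unit; \<open>cop True\<close> keeps only the cuts leaving the maximal letter
  to the right, so it is \<open>Delta_succ\<close> together with the trivial cut \<open>1 \<otimes> x\<close>.\<close>

definition cop_word :: "bool \<Rightarrow> word \<Rightarrow> (word \<times> word \<Rightarrow>\<^sub>0 'k::field)" where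
  "cop_word b w = (\<Sum>i\<le>length w.
     if set (take i w) \<inter> set (drop i w) = {} \<and> (b \<longrightarrow> wmax w \<notin> set (take i w))
     then R_tensor (pack (take i w)) (pack (drop i w)) else 0)"

definition cop :: "bool \<Rightarrow> 'k::field wqsym \<Rightarrow> (word \<times> word \<Rightarrow>\<^sub>0 'k)" where
  "cop b = linear_ext (cop_word b)"

text \<open>The operation in the bidendriform compatibility: the full product on left factors and
  the operation \<open>f\<close>, later a half-product, on right factors.\<close>

definition tprod :: "(word \<Rightarrow> word \<Rightarrow> 'k::field wqsym) \<Rightarrow>
    (word \<times> word \<Rightarrow>\<^sub>0 'k) \<Rightarrow> (word \<times> word \<Rightarrow>\<^sub>0 'k) \<Rightarrow> (word \<times> word \<Rightarrow>\<^sub>0 'k)" where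
  "tprod f = bilinear_ext (\<lambda>p q. tens (umul_word (fst p) (fst q)) (f (snd p) (snd q)))"

lemma lin_cop [lin_intros]: "lin F \<Longrightarrow> lin (\<lambda>x. cop b (F x))"
  unfolding cop_def by (rule lin_linear_ext_comp)

lemma cop_R [simp]: "cop b (R w) = cop_word b w"
  by (simp add: cop_def)

lemma lin_tprod [lin_intros]:
  assumes "lin F"
  shows "lin (\<lambda>x. tprod f (F x) y)" "lin (\<lambda>x. tprod f y (F x))"
  using assms by (simp_all add: tprod_def lin_def
      lin_add[OF lin_bilinear_ext_left] lin_add[OF lin_bilinear_ext_right]
      lin_scale[OF lin_bilinear_ext_left] lin_scale[OF lin_bilinear_ext_right])

lemmas tprod_lin = lin_tprod[OF lin_id]
lemmas tprod_0 = tprod_lin[THEN lin_0]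
lemmas cop_lin = lin_cop[OF lin_id]

lemma tprod_R_tensor [simp]:
  "tprod f (R_tensor u v) (R_tensor u' v') = tens (umul_word u u') (f v v')"
  by (simp add: tprod_def R_tensor_def)

lemma tprod_tens:
  fixes f :: "word \<Rightarrow> word \<Rightarrow> 'k::field wqsym"
  shows "tprod f (tens a b) (tens c d) = tens (a \<odot> c) (bilinear_ext f b d)"
proof -
  have lins: "lin (\<lambda>x. tens y (bilinear_ext f (F x) z))" "lin (\<lambda>x. tens y (bilinear_ext f z (F x)))"
    if "lin F" for y z and F :: "'k wqsym \<Rightarrow> 'k wqsym"
    by (rule lin_tens, rule lin_comp[OF _ that], simp)+
  show ?thesis
    apply (rule lin_eqI[where x = a and W = UNIV], (intro lin_intros; fail)+, simp)
    apply (rule lin_eqI[where x = b and W = UNIV], (intro lin_intros; fail), (intro lins lin_id; fail), simp)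
    apply (rule lin_eqI[where x = c and W = UNIV], (intro lin_intros; fail)+, simp)
    apply (rule lin_eqI[where x = d and W = UNIV], (intro lin_intros; fail), (intro lins lin_id; fail), simp)
    apply (simp add: tprod_def umul_def)
    done
qed

text \<open>Disjointness of the two sides, the side of the maximum and the packed factors depend
  only on the relative order of the letters. So coproducts too may be computed on representatives
  that are not packed.\<close>

lemma cop_word_map:
  assumes h: "strict_mono_on (set w) h"
  shows "cop_word b (map h w) = cop_word b w"
proof (cases "w = []")
  case False
  have inj: "inj_on h (set w)" using strict_mono_on_imp_inj_on[OF h] .
  have m: "wmax (map h w) = h (wmax w)"
    by (rule wmax_eqI) (use wmax_in[OF False] wmax_ge[of _ w] h in \<open>auto simp: strict_mono_on_less_eq\<close>)
  show ?thesis unfolding cop_word_def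
  proof (rule sum.cong)
    fix i assume "i \<in> {..length w}"
    have st: "set (take i w) \<subseteq> set w" "set (drop i w) \<subseteq> set w" by (auto dest: in_set_takeD in_set_dropD)
    have "set (take i (map h w)) \<inter> set (drop i (map h w)) = h ` (set (take i w) \<inter> set (drop i w))"
      using inj_on_image_Int[OF inj st] by (simp add: take_map drop_map)
    moreover have "wmax (map h w) \<in> set (take i (map h w)) \<longleftrightarrow> wmax w \<in> set (take i w)"
      unfolding m using inj_on_image_mem_iff[OF inj wmax_in[OF False] st(1)] by (simp add: take_map)
    moreover have "pack (take i (map h w)) = pack (take i w)" "pack (drop i (map h w)) = pack (drop i w)"
      unfolding take_map drop_map by (intro pack_map monotone_on_subset[OF h] st)+
    ultimately show "(if set (take i (map h w)) \<inter> set (drop i (map h w)) = {} \<and> (b \<longrightarrow> wmax (map h w) \<notin> set (take i (map h w)))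
        then R_tensor (pack (take i (map h w))) (pack (drop i (map h w))) else 0) =
      (if set (take i w) \<inter> set (drop i w) = {} \<and> (b \<longrightarrow> wmax w \<notin> set (take i w))
        then R_tensor (pack (take i w)) (pack (drop i w)) else 0)" by auto
  qed simp
qed simp

lemma cop_word_pack [simp]: "cop_word b (pack w) = cop_word b w"
  unfolding pack_def by (rule cop_word_map, rule rank_strict_mono) simp

lemma tprod_cop_word:
  "tprod f (cop_word False u) (cop_word b v) = (\<Sum>j\<le>length u. \<Sum>k\<le>length v.
    if set (take j u) \<inter> set (drop j u) = {} \<and> set (take k v) \<inter> set (drop k v) = {} \<and> (b \<longrightarrow> wmax v \<notin> set (take k v))
    then tens (umul_word (pack (take j u)) (pack (take k v))) (f (pack (drop j u)) (pack (drop k v))) else 0)"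
  unfolding cop_word_def
  by (subst lin_sum[OF tprod_lin(1)], rule sum.cong[OF refl], subst lin_sum[OF tprod_lin(2)], rule sum.cong[OF refl])
     (auto simp: tprod_0)

lemma wmax_cong: "set u = set v \<Longrightarrow> wmax u = wmax v"
  by (simp add: wmax_def)

text \<open>Every cut except the last leaves the final letter \<open>a\<close> in the right factor,
  which is why a half-product acts on right factors. The last cut is split off; for \<open>b\<close>
  it disappears, since it leaves the maximum on the left.\<close>

lemma sum_cop_word_snoc:
  assumes "set u \<inter> set v = {}"
  shows "(\<Sum>w\<in>shuffles u v. cop_word b (w @ [a]) :: word \<times> word \<Rightarrow>\<^sub>0 'k::field) =
    (\<Sum>j\<le>length u. \<Sum>k\<le>length v. \<Sum>x\<in>shuffles (take j u) (take k v). \<Sum>y\<in>shuffles (drop j u) (drop k v).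
       if set x \<inter> set (y @ [a]) = {} \<and> (b \<longrightarrow> wmax (u @ v @ [a]) \<notin> set x)
       then R_tensor (pack x) (pack (y @ [a])) else 0)
    + (if b then 0 else \<Sum>w\<in>shuffles u v. R_tensor (pack (w @ [a])) [])"
proof -
  let ?G = "\<lambda>x y. if set x \<inter> set (y @ [a]) = {} \<and> (b \<longrightarrow> wmax (u @ v @ [a]) \<notin> set x)
       then R_tensor (pack x) (pack (y @ [a])) else 0 :: word \<times> word \<Rightarrow>\<^sub>0 'k"
  have "cop_word b (w @ [a]) = (\<Sum>i\<le>length w. ?G (take i w) (drop i w)) + (if b then 0 else R_tensor (pack (w @ [a])) [])"
    if w: "w \<in> shuffles u v" for w
  proof -
    have m: "wmax (w @ [a]) = wmax (u @ v @ [a])" by (rule wmax_cong) (use set_shuffles[OF w] in auto)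
    have "wmax (w @ [a]) \<in> set (w @ [a])" by (rule wmax_in) simp
    then have m': "wmax (u @ v @ [a]) \<in> set (w @ [a])" unfolding m .
    have len: "length (w @ [a]) = Suc (length w)" by simp
    show ?thesis unfolding cop_word_def m len sum.atMost_Suc
      by (rule arg_cong2[where f = "(+)"], rule sum.cong) (use m' in auto)
  qed
  then show ?thesis using sum_cut_shuffles[OF assms, of ?G] by (cases b) (simp_all add: sum.distrib)
qed

lemma sum_tens: "(\<Sum>x\<in>A. \<Sum>y\<in>B. R_tensor (f x) (g y)) = tens (\<Sum>x\<in>A. R (f x)) (\<Sum>y\<in>B. R (g y))"
  by (simp add: op_sum tens_R) (rule sum.swap)

lemma sum_tens_if:
  "(\<Sum>x\<in>A. \<Sum>y\<in>B. if C then R_tensor (f x) (g y) else 0) =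
    (if C then tens (\<Sum>x\<in>A. R (f x)) (\<Sum>y\<in>B. R (g y)) else 0)"
  by (cases C) (simp_all add: sum_tens)

text \<open>One computation for both half-products: \<open>a\<close> is the last letter of
  \<open>u\<close> for \<lhd> and that of \<open>v\<close> for \<rhd>. As the alphabets are
  disjoint, a cut of a shuffle is admissible exactly when both induced cuts are; as \<open>u\<close>
  lies below \<open>v\<close>, the side of the maximum is decided by the cut of \<open>v\<close>,
  provided that \<open>v\<close> is not empty.\<close>

lemma sum_cop_word_split:
  assumes bl: "below u v" and split: "u = u' @ [a] \<and> v = v' \<or> u = u' \<and> v = v' @ [a]"
    and b: "b \<Longrightarrow> v \<noteq> []"
  shows "(\<Sum>w\<in>shuffles u' v'. cop_word b (w @ [a])) =
    (\<Sum>j\<le>length u'. \<Sum>k\<le>length v'.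
      if set (take j u) \<inter> set (drop j u) = {} \<and> set (take k v) \<inter> set (drop k v) = {} \<and> (b \<longrightarrow> wmax v \<notin> set (take k v))
      then tens (umul_word (pack (take j u)) (pack (take k v))) (\<Sum>y\<in>shuffles (drop j u') (drop k v'). R (pack (y @ [a]))) else 0)
    + (if b then 0 else tens (\<Sum>w\<in>shuffles u' v'. R (pack (w @ [a]))) (R []))"
proof -
  have dj: "set u \<inter> set v = {}" using below_disjoint[OF bl] .
  have uv: "set (u' @ v' @ [a]) = set u \<union> set v" using split by auto
  have m: "wmax (u' @ v' @ [a]) = wmax v" "wmax v \<in> set v" if b
  proof -
    note ne = wmax_in[OF b[OF that]]
    show "wmax (u' @ v' @ [a]) = wmax v"
      by (rule wmax_eqI) (use ne wmax_ge[of _ v] belowD[OF bl _ ne] in \<open>auto simp: uv less_imp_le simp del: set_append\<close>)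
    show "wmax v \<in> set v" by (rule ne)
  qed
  have C: "set x \<inter> set (y @ [a]) = {} \<and> (b \<longrightarrow> wmax (u' @ v' @ [a]) \<notin> set x) \<longleftrightarrow>
      set (take j u) \<inter> set (drop j u) = {} \<and> set (take k v) \<inter> set (drop k v) = {} \<and> (b \<longrightarrow> wmax v \<notin> set (take k v))"
    if j: "j \<le> length u'" and k: "k \<le> length v'"
      and x: "x \<in> shuffles (take j u') (take k v')" and y: "y \<in> shuffles (drop j u') (drop k v')" for j k x y
  proof -
    have "take j u' = take j u" "take k v' = take k v"
      "insert a (set (drop j u') \<union> set (drop k v')) = set (drop j u) \<union> set (drop k v)"
      using split j k by auto
    then have sx: "set x = set (take j u) \<union> set (take k v)" and sy: "set (y @ [a]) = set (drop j u) \<union> set (drop k v)"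
      by (simp_all add: set_shuffles[OF x] set_shuffles[OF y])
    have sub: "set (take j u) \<subseteq> set u" "set (drop j u) \<subseteq> set u" "set (take k v) \<subseteq> set v" "set (drop k v) \<subseteq> set v"
      by (auto dest: in_set_takeD in_set_dropD)
    then have "set x \<inter> set (y @ [a]) = {} \<longleftrightarrow> set (take j u) \<inter> set (drop j u) = {} \<and> set (take k v) \<inter> set (drop k v) = {}"
      unfolding sx sy using dj by blast
    moreover have "wmax v \<notin> set x \<longleftrightarrow> wmax v \<notin> set (take k v)" if b
      unfolding sx using m(2)[OF that] sub dj by blast
    ultimately show ?thesis using m(1) by auto
  qed
  have sums: "(\<Sum>x\<in>shuffles (take j u') (take k v'). R (pack x)) = umul_word (pack (take j u)) (pack (take k v))"
    if "j \<le> length u'" "k \<le> length v'" for j k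
  proof -
    have "below (take j u) (take k v)" using bl by (auto simp: below_def dest: in_set_takeD)
    moreover have "take j u' = take j u" "take k v' = take k v" using split that by auto
    ultimately show ?thesis by (simp add: umul_word_pack)
  qed
  have "set u' \<inter> set v' = {}" using dj split by auto
  let ?C = "\<lambda>j k. set (take j u) \<inter> set (drop j u) = {} \<and> set (take k v) \<inter> set (drop k v) = {} \<and> (b \<longrightarrow> wmax v \<notin> set (take k v))"
  have jk: "(\<Sum>x\<in>shuffles (take j u') (take k v'). \<Sum>y\<in>shuffles (drop j u') (drop k v').
       if set x \<inter> set (y @ [a]) = {} \<and> (b \<longrightarrow> wmax (u' @ v' @ [a]) \<notin> set x)
       then R_tensor (pack x) (pack (y @ [a])) else 0)
     = (if ?C j k then tens (umul_word (pack (take j u)) (pack (take k v)))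
         (\<Sum>y\<in>shuffles (drop j u') (drop k v'). R (pack (y @ [a]))) else 0)"
    if "j \<le> length u'" "k \<le> length v'" for j k
    unfolding sums[OF that, symmetric] sum_tens_if[symmetric]
    by (intro sum.cong refl if_cong C that)
  show ?thesis
    unfolding sum_cop_word_snoc[OF \<open>set u' \<inter> set v' = {}\<close>]
    by (rule arg_cong2[where f = "(+)"], intro sum.cong refl, rule jk) (simp_all add: op_sum tens_R)
qed

lemma cop_uprec_words:
  assumes "packed u" "packed v" "b \<longrightarrow> v \<noteq> []"
  shows "cop b (R u \<lhd> R v) = tprod uprec_word (cop_word False u) (cop_word b v)
    + (if b then 0 else tens (R u \<lhd> R v) (R []))"
proof (cases "u = []")
  case True
  then show ?thesis unfolding tprod_cop_word
    by (auto simp: unit_words lin_0[OF cop_lin] op_0 uprec_word_def intro!: sum.neutral)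
next
  case False
  obtain v' where bl: "below u v'" and p: "pack u = u" "pack v' = v"
    using packed_below2[OF assms(1,2)] by blast
  let ?u = "butlast u" and ?a = "last u"
  have P: "R u \<lhd> R v = (\<Sum>w\<in>shuffles ?u v'. R (pack (w @ [?a])))"
    by (simp add: ops_R uprec_word_pack[OF bl False, unfolded p])
  have D: "(\<Sum>y\<in>shuffles (drop j ?u) (drop k v'). R (pack (y @ [?a]))) = uprec_word (pack (drop j u)) (pack (drop k v'))"
    if "j < length u" for j k
  proof -
    have "below (drop j u) (drop k v')" using bl by (auto simp: below_def dest: in_set_dropD)
    then show ?thesis using that by (simp add: uprec_word_pack butlast_drop)
  qed
  have "cop b (R u \<lhd> R v) = (\<Sum>w\<in>shuffles ?u v'. cop_word b (w @ [?a]))"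
    unfolding P by (simp add: lin_sum[OF cop_lin])
  also have "\<dots> = tprod uprec_word (cop_word False u) (cop_word b v') + (if b then 0 else tens (R u \<lhd> R v) (R []))"
    unfolding tprod_cop_word P
  proof (subst sum_cop_word_split[OF bl], goal_cases)
    case 3
    show ?case
    proof (rule arg_cong2[where f = "(+)"], rule sum.mono_neutral_cong_left, goal_cases)
      \<comment> \<open>The cut of \<open>u\<close> at its end is absent from the sum over
        \<open>butlast u\<close>; its term vanishes because \<open>1 \<lhd> x = 0\<close>.\<close>
      case 3
      show ?case by (auto simp: uprec_word_def op_0 intro!: sum.neutral)
    next
      case (4 j)
      then have "j < length u" using False by (cases u rule: rev_cases) auto
      then show ?case by (intro sum.cong refl) (auto simp: D)
    qed auto
  qed (use False assms(3) p in auto)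
  finally show ?thesis by (simp flip: p(2))
qed

lemma cop_usucc_words:
  assumes "packed u" "packed v" "v \<noteq> []"
  shows "cop b (R u \<rhd> R v) = tprod usucc_word (cop_word False u) (cop_word b v)
    + (if b then 0 else tens (R u \<rhd> R v) (R []))"
proof -
  obtain v' where bl: "below u v'" and p: "pack u = u" "pack v' = v"
    using packed_below2[OF assms(1,2)] by blast
  have ne: "v' \<noteq> []" using assms p by auto
  let ?v = "butlast v'" and ?a = "last v'"
  have P: "R u \<rhd> R v = (\<Sum>w\<in>shuffles u ?v. R (pack (w @ [?a])))"
    by (simp add: ops_R usucc_word_pack[OF bl ne, unfolded p])
  have D: "(\<Sum>y\<in>shuffles (drop j u) (drop k ?v). R (pack (y @ [?a]))) = usucc_word (pack (drop j u)) (pack (drop k v'))"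
    if "k < length v'" for j k
  proof -
    have "below (drop j u) (drop k v')" using bl by (auto simp: below_def dest: in_set_dropD)
    then show ?thesis using that by (simp add: usucc_word_pack butlast_drop)
  qed
  have "cop b (R u \<rhd> R v) = (\<Sum>w\<in>shuffles u ?v. cop_word b (w @ [?a]))"
    unfolding P by (simp add: lin_sum[OF cop_lin])
  also have "\<dots> = tprod usucc_word (cop_word False u) (cop_word b v') + (if b then 0 else tens (R u \<rhd> R v) (R []))"
    unfolding tprod_cop_word P
  proof (subst sum_cop_word_split[OF bl], goal_cases)
    case 3
    show ?case
    proof (rule arg_cong2[where f = "(+)"], rule sum.cong[OF refl], rule sum.mono_neutral_cong_left, goal_cases)
      \<comment> \<open>The cut of \<open>v'\<close> at its end is absent from the sum over
        \<open>butlast v'\<close>; its term vanishes because \<open>x \<rhd> 1 = 0\<close>.\<close>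
      case (3 j)
      show ?case by (auto simp: usucc_word_def op_0)
    next
      case (4 j k)
      then have "k < length v'" using ne by (cases v' rule: rev_cases) auto
      then show ?case by (auto simp: D)
    qed auto
  qed (use ne in auto)
  finally show ?thesis by (simp flip: p(2))
qed

section \<open>The bidendriform structure on packed words\<close>

text \<open>The type admits arbitrary words, while the identities on words are available only for
  packed ones; \<open>pkd\<close> and \<open>pos\<close> carry this restriction through the linear
  extensions.\<close>

definition pkd :: "'k::field wqsym \<Rightarrow> bool" where
  "pkd x \<longleftrightarrow> Poly_Mapping.keys x \<subseteq> {w. packed w}"

definition pos :: "'k::field wqsym \<Rightarrow> bool" where
  "pos x \<longleftrightarrow> Poly_Mapping.keys x \<subseteq> {w. packed w \<and> w \<noteq> []}"

lemma pos_pkd: "pos x \<Longrightarrow> pkd x"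
  by (auto simp: pos_def pkd_def)

lemma single_R: "Poly_Mapping.single u 1 = R u"
  by (simp add: R_def)

lemma R_neq_0 [simp]: "(R w :: 'k::field wqsym) \<noteq> 0"
  by (metis keys_R keys_zero insert_not_empty)

lemma WQSym_iff: "x \<in> WQSym n \<longleftrightarrow> Poly_Mapping.keys x \<subseteq> PW n"
proof
  assume "x \<in> WQSym n"
  then show "Poly_Mapping.keys x \<subseteq> PW n" unfolding WQSym_def
  proof (induction rule: free_vs.span_induct_alt)
    case (step c x y)
    have "Poly_Mapping.keys (scale c x) \<subseteq> PW n" using step(1) keys_scale[of c x] by auto
    then show ?case using Poly_Mapping.keys_add[of "scale c x" y] step(2) by blast
  qed simp
next
  assume "Poly_Mapping.keys x \<subseteq> PW n"
  then show "x \<in> WQSym n" unfolding WQSym_def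
    by (induction x rule: keys_induct)
       (auto simp: single_R intro: free_vs.span_base free_vs.span_add free_vs.span_scale free_vs.span_zero)
qed

lemma subspace_WQSym: "free_vs.subspace (WQSym n)"
  by (simp add: WQSym_def)

lemma WQSym_0 [simp]: "0 \<in> WQSym n"
  and WQSym_add: "x \<in> WQSym n \<Longrightarrow> y \<in> WQSym n \<Longrightarrow> x + y \<in> WQSym n"
  and WQSym_scale: "x \<in> WQSym n \<Longrightarrow> scale c x \<in> WQSym n"
  and WQSym_sum: "(\<And>s. s \<in> S \<Longrightarrow> g s \<in> WQSym n) \<Longrightarrow> sum g S \<in> WQSym n"
  by (simp_all add: subspace_WQSym free_vs.subspace_0 free_vs.subspace_add free_vs.subspace_scale free_vs.subspace_sum)

lemma R_in_WQSym [simp]: "R w \<in> WQSym n \<longleftrightarrow> packed w \<and> length w = n"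
  by (auto simp: WQSym_iff PW_def)

lemma WQSym_pkd: "x \<in> WQSym n \<Longrightarrow> pkd x"
  by (auto simp: WQSym_iff pkd_def PW_def)

lemma WQSym_pos: "x \<in> WQSym n \<Longrightarrow> n > 0 \<Longrightarrow> pos x"
  by (auto simp: WQSym_iff pos_def PW_def)

lemma pkd_R [simp]: "pkd (R w) \<longleftrightarrow> packed w"
  by (simp add: pkd_def)

lemma pkd_eqI:
  assumes "lin F" "lin G" "pkd x" "\<And>u. packed u \<Longrightarrow> F (R u) = G (R u)"
  shows "F x = G x"
  using lin_eqI[OF assms(1,2) assms(3)[unfolded pkd_def]] assms(4) by (simp add: single_R)

lemma pos_eqI:
  assumes "lin F" "lin G" "pos x" "\<And>u. packed u \<Longrightarrow> u \<noteq> [] \<Longrightarrow> F (R u) = G (R u)"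
  shows "F x = G x"
  using lin_eqI[OF assms(1,2) assms(3)[unfolded pos_def]] assms(4) by (simp add: single_R)

lemma uprec_uprec:
  assumes "pkd x" "pkd y" "pkd z"
  shows "(x \<lhd> y) \<lhd> z = x \<lhd> (y \<odot> z)"
  apply (rule pkd_eqI[OF _ _ assms(1)], (intro lin_intros; fail)+)
  apply (rule pkd_eqI[OF _ _ assms(2)], (intro lin_intros; fail)+)
  apply (rule pkd_eqI[OF _ _ assms(3)], (intro lin_intros; fail)+)
  by (rule uprec_uprec_words)

lemma usucc_uprec:
  assumes "pkd x" "pkd y" "pkd z"
  shows "(x \<rhd> y) \<lhd> z = x \<rhd> (y \<lhd> z)"
  apply (rule pkd_eqI[OF _ _ assms(1)], (intro lin_intros; fail)+)
  apply (rule pkd_eqI[OF _ _ assms(2)], (intro lin_intros; fail)+)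
  apply (rule pkd_eqI[OF _ _ assms(3)], (intro lin_intros; fail)+)
  by (rule usucc_uprec_words)

lemma umul_usucc:
  assumes "pkd x" "pkd y" "pkd z"
  shows "(x \<odot> y) \<rhd> z = x \<rhd> (y \<rhd> z)"
  apply (rule pkd_eqI[OF _ _ assms(1)], (intro lin_intros; fail)+)
  apply (rule pkd_eqI[OF _ _ assms(2)], (intro lin_intros; fail)+)
  apply (rule pkd_eqI[OF _ _ assms(3)], (intro lin_intros; fail)+)
  by (rule umul_usucc_words)

lemma umul_split:
  assumes "pkd x" "pkd y" "pos x \<or> pos y"
  shows "x \<odot> y = x \<lhd> y + x \<rhd> y"
  using assms(3)
proof
  assume p: "pos x"
  show ?thesis
    apply (rule pos_eqI[OF _ _ p], (intro lin_intros; fail)+)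
    apply (rule pkd_eqI[OF _ _ assms(2)], (intro lin_intros; fail)+)
    by (simp add: uprec_usucc_words)
next
  assume p: "pos y"
  show ?thesis
    apply (rule pos_eqI[OF _ _ p], (intro lin_intros; fail)+)
    apply (rule pkd_eqI[OF _ _ assms(1)], (intro lin_intros; fail)+)
    by (simp add: uprec_usucc_words)
qed

lemma umul_unit [simp]: "R [] \<odot> x = x" "x \<odot> R [] = x"
  and uprec_unit_left [simp]: "R [] \<lhd> x = 0"
  and usucc_unit_right [simp]: "x \<rhd> R [] = 0"
  by (rule lin_eqI[of _ _ x UNIV], (intro lin_intros; fail)+, simp, simp add: single_R unit_words)+

lemma uprec_unit [simp]:
  assumes "pos x"
  shows "x \<lhd> R [] = x" "R [] \<rhd> x = x"
  by (rule pos_eqI[OF _ _ assms], (intro lin_intros; fail)+, simp add: unit_words)+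

lemma prec_uprec: "pos x \<Longrightarrow> pos y \<Longrightarrow> x \<lless> y = x \<lhd> y"
  unfolding pos_def prec_def uprec_def
  by (erule bilin_eqI[rotated 4], assumption) (simp_all add: uprec_word_prec_word)

lemma succ_usucc: "pos x \<Longrightarrow> pos y \<Longrightarrow> x \<ggreater> y = x \<rhd> y"
  unfolding pos_def succ_def usucc_def
  by (erule bilin_eqI[rotated 4], assumption) (simp_all add: usucc_word_succ_word)

section \<open>Degrees and supports of products\<close>

lemma keys_ops_words:
  assumes "packed u" "packed v"
  shows "Poly_Mapping.keys (umul_word u v) \<subseteq> PW (length u + length v)"
    "Poly_Mapping.keys (uprec_word u v) \<subseteq> PW (length u + length v)"
    "Poly_Mapping.keys (usucc_word u v) \<subseteq> PW (length u + length v)"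
proof -
  obtain v' where b: "below u v'" and p: "pack u = u" "pack v' = v"
    using packed_below2[OF assms] by blast
  have l: "length v = length v'" using p by (metis length_pack)
  show "Poly_Mapping.keys (umul_word u v) \<subseteq> PW (length u + length v)"
    unfolding umul_word_pack[OF b, unfolded p]
    by (rule keys_sum_subset) (auto simp: PW_def length_shuffles l)
  show "Poly_Mapping.keys (uprec_word u v) \<subseteq> PW (length u + length v)"
  proof (cases "u = []")
    case False
    then have "length u > 0" by simp
    then show ?thesis unfolding uprec_word_pack[OF b False, unfolded p]
      by (intro keys_sum_subset) (auto simp: PW_def length_shuffles l)
  qed (simp add: uprec_word_def)
  show "Poly_Mapping.keys (usucc_word u v) \<subseteq> PW (length u + length v)"
  proof (cases "v' = []")
    case False
    then have "length v' > 0" by simp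
    then show ?thesis unfolding usucc_word_pack[OF b False, unfolded p]
      by (intro keys_sum_subset) (auto simp: PW_def length_shuffles l)
  qed (use p in \<open>simp add: usucc_word_def\<close>)
qed

lemma ops_WQSym:
  assumes "x \<in> WQSym m" "y \<in> WQSym n"
  shows "x \<odot> y \<in> WQSym (m + n)" "x \<lhd> y \<in> WQSym (m + n)" "x \<rhd> y \<in> WQSym (m + n)"
  unfolding WQSym_iff umul_def uprec_def usucc_def
  by (rule keys_bilinear_ext_subset[OF assms[unfolded WQSym_iff]]; use keys_ops_words in \<open>fastforce simp: PW_def\<close>)+

lemma pkd_ops:
  assumes "pkd x" "pkd y"
  shows "pkd (x \<odot> y)" "pkd (x \<lhd> y)" "pkd (x \<rhd> y)"
  unfolding pkd_def umul_def uprec_def usucc_def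
  by (rule keys_bilinear_ext_subset[OF assms[unfolded pkd_def]]; use keys_ops_words in \<open>fastforce simp: PW_def\<close>)+

lemma pos_ops:
  assumes "pkd x" "pkd y"
  shows "pos x \<Longrightarrow> pos (x \<lhd> y)" "pos y \<Longrightarrow> pos (x \<rhd> y)"
proof -
  show "pos (x \<lhd> y)" if "pos x"
    unfolding pos_def uprec_def
    by (rule keys_bilinear_ext_subset[OF that[unfolded pos_def] assms(2)[unfolded pkd_def]])
       (use keys_ops_words(2) in \<open>fastforce simp: PW_def\<close>)
  show "pos (x \<rhd> y)" if "pos y"
    unfolding pos_def usucc_def
    by (rule keys_bilinear_ext_subset[OF assms(1)[unfolded pkd_def] that[unfolded pos_def]])
       (use keys_ops_words(3) in \<open>fastforce simp: PW_def\<close>)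
qed

lemma cop_uprec:
  assumes "pkd x" "pkd y" "b \<Longrightarrow> pos y"
  shows "cop b (x \<lhd> y) = tprod uprec_word (cop False x) (cop b y) + (if b then 0 else tens (x \<lhd> y) (R []))"
proof (cases b)
  case True
  then have p: "pos y" using assms by simp
  have "cop True (x \<lhd> y) = tprod uprec_word (cop False x) (cop True y)"
    apply (rule pos_eqI[OF _ _ p], (intro lin_intros; fail)+)
    apply (rule pkd_eqI[OF _ _ assms(1)], (intro lin_intros; fail)+)
    by (simp add: cop_uprec_words)
  then show ?thesis using True by simp
next
  case False
  have "cop False (x \<lhd> y) = tprod uprec_word (cop False x) (cop False y) + tens (x \<lhd> y) (R [])"
    apply (rule pkd_eqI[OF _ _ assms(1)], (intro lin_intros; fail)+)
    apply (rule pkd_eqI[OF _ _ assms(2)], (intro lin_intros; fail)+)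
    by (simp add: cop_uprec_words)
  then show ?thesis using False by simp
qed

lemma cop_usucc:
  assumes "pkd x" "pos y"
  shows "cop b (x \<rhd> y) = tprod usucc_word (cop False x) (cop b y) + (if b then 0 else tens (x \<rhd> y) (R []))"
proof -
  have "cop False (x \<rhd> y) = tprod usucc_word (cop False x) (cop False y) + tens (x \<rhd> y) (R [])"
    apply (rule pos_eqI[OF _ _ assms(2)], (intro lin_intros; fail)+)
    apply (rule pkd_eqI[OF _ _ assms(1)], (intro lin_intros; fail)+)
    by (simp add: cop_usucc_words)
  moreover have "cop True (x \<rhd> y) = tprod usucc_word (cop False x) (cop True y)"
    apply (rule pos_eqI[OF _ _ assms(2)], (intro lin_intros; fail)+)
    apply (rule pkd_eqI[OF _ _ assms(1)], (intro lin_intros; fail)+)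
    by (simp add: cop_usucc_words)
  ultimately show ?thesis by (cases b) auto
qed

section \<open>Comparison with the coproducts that lack the trivial cuts\<close>

lemma lin_Delta [lin_intros]: "lin F \<Longrightarrow> lin (\<lambda>x. Delta_prec (F x))" "lin F \<Longrightarrow> lin (\<lambda>x. Delta_succ (F x))"
  unfolding Delta_prec_def Delta_succ_def by (intro lin_intros; assumption)+

lemma Delta_succ_R:
  "Delta_succ (R w) = (\<Sum>i = 1..<length w. if set (take i w) \<inter> set (drop i w) = {} \<and> wmax w \<notin> set (take i w)
    then R_tensor (pack (take i w)) (pack (drop i w)) else 0)"
  unfolding Delta_succ_def linear_ext_R by (rule sum.mono_neutral_cong_left) auto

lemma Delta_prec_R:
  "Delta_prec (R w) = (\<Sum>i = 1..<length w. if set (take i w) \<inter> set (drop i w) = {} \<and> wmax w \<in> set (take i w)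
    then R_tensor (pack (take i w)) (pack (drop i w)) else 0)"
  unfolding Delta_prec_def linear_ext_R by (rule sum.mono_neutral_cong_left) auto

lemma sum_atMost_ends: "(n::nat) > 0 \<Longrightarrow> (\<Sum>i\<le>n. f i) = f 0 + (\<Sum>i = 1..<n. f i) + (f n :: 'a::comm_monoid_add)"
proof -
  assume "n > 0"
  then have "{..n} = insert 0 (insert n {1..<n})" by auto
  then show ?thesis using \<open>n > 0\<close> by (simp add: ac_simps)
qed

lemma cop_Delta:
  fixes x :: "'k::field wqsym"
  assumes "pos x"
  shows "cop True x = tens (R []) x + Delta_succ x"
    "cop False x = tens (R []) x + (Delta_prec x + Delta_succ x) + tens x (R [])"
proof -
  show "cop True x = tens (R []) x + Delta_succ x"
  proof (rule pos_eqI[OF _ _ assms], (intro lin_intros; fail)+)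
    fix u assume u: "packed u" "u \<noteq> []"
    then show "cop True (R u :: 'k wqsym) = tens (R []) (R u) + Delta_succ (R u)"
      using wmax_in[OF u(2)]
      by (simp add: cop_word_def sum_atMost_ends Delta_succ_R tens_R pack_id)
  qed
  show "cop False x = tens (R []) x + (Delta_prec x + Delta_succ x) + tens x (R [])"
  proof (rule pos_eqI[OF _ _ assms], (intro lin_intros; fail)+)
    fix u assume u: "packed u" "u \<noteq> []"
    have "Delta_prec (R u :: 'k wqsym) + Delta_succ (R u) = (\<Sum>i = 1..<length u. if set (take i u) \<inter> set (drop i u) = {}
        then R_tensor (pack (take i u)) (pack (drop i u)) else 0)"
      unfolding Delta_succ_R Delta_prec_R sum.distrib[symmetric] by (rule sum.cong) auto
    then show "cop False (R u :: 'k wqsym) = tens (R []) (R u) + (Delta_prec (R u) + Delta_succ (R u)) + tens (R u) (R [])"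
      using u by (simp add: cop_word_def sum_atMost_ends tens_R pack_id)
  qed
qed

definition prim :: "'k::field wqsym \<Rightarrow> bool" where
  "prim x \<longleftrightarrow> pos x \<and> cop False x = tens (R []) x + tens x (R [])"

lemma prim_pos: "prim x \<Longrightarrow> pos x" and prim_pkd: "prim x \<Longrightarrow> pkd x"
  and prim_cop: "prim x \<Longrightarrow> cop False x = tens (R []) x + tens x (R [])"
  by (auto simp: prim_def pos_pkd)

lemma prim_iff: "pos x \<Longrightarrow> prim x \<longleftrightarrow> Delta_prec x + Delta_succ x = 0"
  unfolding prim_def cop_Delta(2) by simp

lemma cop_word_Nil [simp]: "cop_word False [] = tens (R []) (R [])"
  by (simp add: cop_word_def tens_R)

section \<open>Combs and braces\<close>

text \<open>Empty combs are the unit, and \<open>p \<lhd> R [] = p\<close> for \<open>pos p\<close>.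
  So the factors that the bracket omits at its two ends become unit factors.\<close>

primrec lcomb :: "'k::field wqsym list \<Rightarrow> 'k wqsym" where
  "lcomb [] = R []"
| "lcomb (p # ps) = p \<lhd> lcomb ps"

definition rcomb :: "'k::field wqsym list \<Rightarrow> 'k wqsym" where
  "rcomb ps = foldl (\<rhd>) (R []) ps"

lemma rcomb_simps [simp]: "rcomb [] = R []" "rcomb (ps @ [p]) = rcomb ps \<rhd> p"
  by (simp_all add: rcomb_def)

lemma pkd_lcomb: "\<forall>p\<in>set ps. pos p \<Longrightarrow> pkd (lcomb ps)"
  by (induction ps) (auto intro!: pkd_ops simp: pos_pkd)

lemma pkd_rcomb: "\<forall>p\<in>set ps. pos p \<Longrightarrow> pkd (rcomb ps)"
  by (induction ps rule: rev_induct) (auto intro!: pkd_ops simp: pos_pkd)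

lemma pos_lcomb: "\<forall>p\<in>set ps. pos p \<Longrightarrow> ps \<noteq> [] \<Longrightarrow> pos (lcomb ps)"
  by (cases ps) (auto intro!: pos_ops pos_pkd pkd_lcomb)

lemma pos_rcomb: "\<forall>p\<in>set ps. pos p \<Longrightarrow> ps \<noteq> [] \<Longrightarrow> pos (rcomb ps)"
  by (cases ps rule: rev_cases) (auto intro!: pos_ops pos_pkd pkd_rcomb)

lemma prec_comb_lcomb:
  assumes "\<forall>p\<in>set ps. pos p" "ps \<noteq> []"
  shows "prec_comb ps = lcomb ps"
proof -
  have "foldr (\<lless>) qs q = lcomb (qs @ [q])" if "\<forall>p\<in>set qs. pos p" "pos q" for qs and q :: "'a wqsym"
    using that(1)
  proof (induction qs)
    case (Cons p qs)
    then have "pos (lcomb (qs @ [q]))" using that(2) by (intro pos_lcomb) auto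
    then show ?case using Cons by (simp add: prec_uprec)
  qed (use that(2) in simp)
  from this[of "butlast ps" "last ps"] show ?thesis
    using assms by (simp add: prec_comb_def in_set_butlastD)
qed

lemma succ_comb_rcomb:
  assumes "\<forall>p\<in>set ps. pos p" "ps \<noteq> []"
  shows "succ_comb ps = rcomb ps"
proof -
  have "foldl (\<ggreater>) q qs = foldl (\<rhd>) q qs" if "\<forall>p\<in>set qs. pos p" "pos q" for qs and q :: "'a wqsym"
    using that
  proof (induction qs arbitrary: q)
    case (Cons p qs)
    then have "pos (q \<rhd> p)" by (intro pos_ops pos_pkd) auto
    then show ?case using Cons by (simp add: succ_usucc)
  qed simp
  from this[of "tl ps" "hd ps"] show ?thesis
    using assms by (cases ps) (auto simp: succ_comb_def rcomb_def)
qed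

text \<open>Units absorb the two exceptional summands. The regrouping by \<open>usucc_uprec\<close>
  puts \<open>q\<close> at the head of a left half-product, the shape on which
  \<open>cop_uprec\<close> and then \<open>cop_usucc\<close> can be applied.\<close>

lemma brace_eq:
  assumes "\<forall>p\<in>set ps. pos p" "pos q"
  shows "brace ps q = (\<Sum>i\<le>length ps. scale ((-1) ^ (length ps - i))
    (lcomb (take i ps) \<rhd> (q \<lhd> rcomb (drop i ps))))"
  unfolding brace_def atLeast0AtMost
proof (rule sum.cong[OF refl])
  fix i assume "i \<in> {..length ps}"
  then have i: "i \<le> length ps" by simp
  have p1: "\<forall>p\<in>set (take i ps). pos p" and p2: "\<forall>p\<in>set (drop i ps). pos p"
    using assms(1) by (auto dest: in_set_takeD in_set_dropD)
  have L: "(if i = 0 then q else prec_comb (take i ps) \<ggreater> q) = lcomb (take i ps) \<rhd> q"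
  proof (cases "i = 0")
    case False
    then have "take i ps \<noteq> []" using i by auto
    then show ?thesis using prec_comb_lcomb[OF p1] succ_usucc[OF pos_lcomb[OF p1] assms(2)] False by simp
  qed (use assms(2) in simp)
  have "pos (lcomb (take i ps) \<rhd> q)" using pkd_lcomb[OF p1] assms(2) by (simp add: pos_ops pos_pkd)
  then have "(let left = if i = 0 then q else prec_comb (take i ps) \<ggreater> q
      in if i = length ps then left else left \<lless> succ_comb (drop i ps)) = (lcomb (take i ps) \<rhd> q) \<lhd> rcomb (drop i ps)"
    unfolding L Let_def using i succ_comb_rcomb[OF p2] prec_uprec[OF _ pos_rcomb[OF p2]] by auto
  also have "\<dots> = lcomb (take i ps) \<rhd> (q \<lhd> rcomb (drop i ps))"
    by (rule usucc_uprec[OF pkd_lcomb[OF p1] pos_pkd[OF assms(2)] pkd_rcomb[OF p2]])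
  finally show "scale ((-1) ^ (length ps - i)) (let left = if i = 0 then q else prec_comb (take i ps) \<ggreater> q
      in if i = length ps then left else left \<lless> succ_comb (drop i ps))
    = scale ((-1) ^ (length ps - i)) (lcomb (take i ps) \<rhd> (q \<lhd> rcomb (drop i ps)))" by simp
qed

lemma forest_prod_lcomb: "\<forall>p\<in>set ps. pos p \<Longrightarrow> forest_prod ps = lcomb (rev ps)"
  by (simp add: forest_prod_def prec_comb_lcomb)

lemmas bilinear_ext_ops = uprec_def[symmetric] usucc_def[symmetric]

text \<open>A primitive \<open>p\<close> contributes only its part \<open>R [] \<otimes> p\<close>:
  the part \<open>p \<otimes> R []\<close> would produce \<open>R [] \<lhd> y = 0\<close> on the
  right. So \<open>p\<close> stays on the right until the whole comb moves to the left in the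
  trivial cut.\<close>

lemma cop_lcomb:
  assumes "\<forall>p\<in>set ps. prim p"
  shows "cop False (lcomb ps) = (\<Sum>j\<le>length ps. tens (lcomb (drop j ps)) (lcomb (take j ps)))"
  using assms
proof (induction ps)
  case (Cons p ps)
  then have p: "prim p" and ps: "\<forall>p\<in>set ps. pos p" by (auto simp: prim_pos)
  have "cop False (lcomb (p # ps)) = tprod uprec_word (tens (R []) p + tens p (R [])) (cop False (lcomb ps))
      + tens (lcomb (p # ps)) (R [])"
    using p pkd_lcomb[OF ps] by (simp add: cop_uprec prim_pkd prim_cop)
  also have "tprod uprec_word (tens (R []) p + tens p (R [])) (cop False (lcomb ps))
      = (\<Sum>j\<le>length ps. tens (lcomb (drop j ps)) (p \<lhd> lcomb (take j ps)))"
    using Cons by (simp add: lin_add[OF tprod_lin(1)] lin_sum[OF tprod_lin(2)] tprod_tens bilinear_ext_ops op_0)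
  finally show ?case
    by (simp add: sum.atMost_Suc_shift del: sum.atMost_Suc)
qed simp

text \<open>Mirror image of \<open>cop_lcomb\<close>: now the last entry is the one that stays on
  the right, because \<open>x \<rhd> R [] = 0\<close>.\<close>

lemma cop_rcomb:
  assumes "\<forall>p\<in>set ps. prim p"
  shows "cop False (rcomb ps) = (\<Sum>k\<le>length ps. tens (rcomb (take k ps)) (rcomb (drop k ps)))"
  using assms
proof (induction ps rule: rev_induct)
  case (snoc p ps)
  then have p: "prim p" and ps: "\<forall>p\<in>set ps. pos p" by (auto simp: prim_pos)
  have "cop False (rcomb (ps @ [p])) = tprod usucc_word (cop False (rcomb ps)) (tens (R []) p + tens p (R []))
      + tens (rcomb (ps @ [p])) (R [])"
    using p pkd_rcomb[OF ps] by (simp add: cop_usucc prim_pos prim_cop)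
  also have "tprod usucc_word (cop False (rcomb ps)) (tens (R []) p + tens p (R []))
      = (\<Sum>k\<le>length ps. tens (rcomb (take k ps)) (rcomb (drop k ps) \<rhd> p))"
    using snoc by (simp add: lin_add[OF tprod_lin(2)] lin_sum[OF tprod_lin(1)] tprod_tens bilinear_ext_ops op_0)
  finally show ?case by simp
qed simp

text \<open>Left and right combs are inverse to each other up to signs. Splitting \<odot> into its
  halves, the \<lhd> part is minus the first entry times the same sum for the tail, and the \<rhd>
  part is the same sum for the rest times the last entry. By induction both vanish, except for a
  one-element list, where they cancel.\<close>

lemma comb_antipode:
  assumes "\<forall>p\<in>set ps. pos p"
  shows "(\<Sum>i\<le>length ps. scale ((-1) ^ i) (lcomb (take i ps) \<odot> rcomb (drop i ps))) = (if ps = [] then R [] else 0)"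
  using assms
proof (induction "length ps" arbitrary: ps rule: less_induct)
  case less
  show ?case
  proof (cases "ps = []")
    case False
    then obtain p qs where pq: "ps = p # qs" by (cases ps) auto
    from False obtain r rs where rr: "ps = rs @ [r]" by (cases ps rule: rev_cases) auto
    have len: "length ps = Suc (length qs)" "length ps = Suc (length rs)"
      by (simp add: pq, simp add: rr)
    have posd: "\<forall>p\<in>set (drop i ps). pos p" "\<forall>p\<in>set (take i ps). pos p" for i
      using less.prems by (auto dest: in_set_takeD in_set_dropD)
    have "lcomb (take i ps) \<odot> rcomb (drop i ps) = lcomb (take i ps) \<lhd> rcomb (drop i ps) + lcomb (take i ps) \<rhd> rcomb (drop i ps)"
      if "i \<le> length ps" for i
    proof (rule umul_split[OF pkd_lcomb[OF posd(2)] pkd_rcomb[OF posd(1)]])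
      have "take i ps \<noteq> [] \<or> drop i ps \<noteq> []" using False by auto
      then show "pos (lcomb (take i ps)) \<or> pos (rcomb (drop i ps))"
        using pos_lcomb[OF posd(2)] pos_rcomb[OF posd(1)] by blast
    qed
    then have "(\<Sum>i\<le>length ps. scale ((-1) ^ i) (lcomb (take i ps) \<odot> rcomb (drop i ps)))
      = (\<Sum>i\<le>length ps. scale ((-1) ^ i) (lcomb (take i ps) \<lhd> rcomb (drop i ps)))
      + (\<Sum>i\<le>length ps. scale ((-1) ^ i) (lcomb (take i ps) \<rhd> rcomb (drop i ps)))"
      by (simp add: free_vs.scale_right_distrib sum.distrib)
    also have "(\<Sum>i\<le>length ps. scale ((-1) ^ i) (lcomb (take i ps) \<lhd> rcomb (drop i ps)))
      = - (p \<lhd> (\<Sum>i\<le>length qs. scale ((-1) ^ i) (lcomb (take i qs) \<odot> rcomb (drop i qs))))"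
    proof -
      have posq: "pos p" "\<forall>p\<in>set (drop i qs). pos p" "\<forall>p\<in>set (take i qs). pos p" for i
        using less.prems pq by (auto dest: in_set_takeD in_set_dropD)
      have "(\<Sum>i\<le>length ps. scale ((-1) ^ i) (lcomb (take i ps) \<lhd> rcomb (drop i ps)))
        = (\<Sum>i\<le>length qs. scale (- ((-1) ^ i)) ((p \<lhd> lcomb (take i qs)) \<lhd> rcomb (drop i qs)))"
        unfolding len(1) sum.atMost_Suc_shift by (simp add: pq)
      also have "\<dots> = - (p \<lhd> (\<Sum>i\<le>length qs. scale ((-1) ^ i) (lcomb (take i qs) \<odot> rcomb (drop i qs))))"
        by (simp add: op_sum op_scale sum_negf
            uprec_uprec[OF pos_pkd[OF posq(1)] pkd_lcomb[OF posq(3)] pkd_rcomb[OF posq(2)]])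
      finally show ?thesis .
    qed
    also have "(\<Sum>i\<le>length ps. scale ((-1) ^ i) (lcomb (take i ps) \<rhd> rcomb (drop i ps)))
      = (\<Sum>i\<le>length rs. scale ((-1) ^ i) (lcomb (take i rs) \<odot> rcomb (drop i rs))) \<rhd> r"
    proof -
      have posr: "pos r" "\<forall>p\<in>set (drop i rs). pos p" "\<forall>p\<in>set (take i rs). pos p" for i
        using less.prems rr by (auto dest: in_set_takeD in_set_dropD)
      have "(\<Sum>i\<le>length ps. scale ((-1) ^ i) (lcomb (take i ps) \<rhd> rcomb (drop i ps)))
        = (\<Sum>i\<le>length rs. scale ((-1) ^ i) (lcomb (take i rs) \<rhd> (rcomb (drop i rs) \<rhd> r)))"
        unfolding len(2) sum.atMost_Suc by (simp add: rr)
      also have "\<dots> = (\<Sum>i\<le>length rs. scale ((-1) ^ i) (lcomb (take i rs) \<odot> rcomb (drop i rs))) \<rhd> r"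
        by (simp add: op_sum op_scale
            umul_usucc[OF pkd_lcomb[OF posr(3)] pkd_rcomb[OF posr(2)] pos_pkd[OF posr(1)]])
      finally show ?thesis .
    qed
    also have "(\<Sum>i\<le>length qs. scale ((-1) ^ i) (lcomb (take i qs) \<odot> rcomb (drop i qs))) = (if qs = [] then R [] else 0)"
      by (rule less.hyps) (use less.prems pq in auto)
    also have "(\<Sum>i\<le>length rs. scale ((-1) ^ i) (lcomb (take i rs) \<odot> rcomb (drop i rs))) = (if rs = [] then R [] else 0)"
      by (rule less.hyps) (use less.prems rr in auto)
    finally show ?thesis using less.prems pq rr by (cases "qs = []") (auto simp: op_0)
  qed simp
qed

text \<open>Outside the trivial cut the pivot \<open>q\<close> stays in the right factor, since
  moving it to the left would leave the unit in front of \<lhd>. Only the two outer factors are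
  cut.\<close>

lemma cop_usucc_uprec_prim:
  assumes "pkd a" "pkd b" "prim q"
    and a: "cop False a = (\<Sum>j\<in>J. tens (a1 j) (a2 j))"
    and b: "cop False b = (\<Sum>k\<in>K. tens (b1 k) (b2 k))"
  shows "cop False (a \<rhd> (q \<lhd> b)) = (\<Sum>j\<in>J. \<Sum>k\<in>K. tens (a1 j \<odot> b1 k) (a2 j \<rhd> (q \<lhd> b2 k)))
    + tens (a \<rhd> (q \<lhd> b)) (R [])"
proof -
  have "cop False (q \<lhd> b) = (\<Sum>k\<in>K. tens (b1 k) (q \<lhd> b2 k)) + tens (q \<lhd> b) (R [])"
    using assms by (simp add: cop_uprec prim_pkd prim_cop lin_add[OF tprod_lin(1)] lin_sum[OF tprod_lin(2)]
        tprod_tens bilinear_ext_ops op_0)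
  moreover have "pos (q \<lhd> b)" using assms by (intro pos_ops) (auto simp: prim_pkd prim_pos)
  ultimately show ?thesis using assms
    by (simp add: cop_usucc lin_add[OF tprod_lin(2)])
       (simp add: lin_sum[OF tprod_lin(1)] lin_sum[OF tprod_lin(2)] tprod_tens bilinear_ext_ops op_0, rule sum.swap)
qed

text \<open>In the coproduct of the summand with index \<open>i\<close>, the first \<open>j\<close>
  entries and the entries after the \<open>l\<close>-th stay with \<open>q\<close>, and the entries
  between them go to the left factor as a left comb times a right comb. For fixed \<open>j\<close>
  and \<open>l\<close> the signed sum over \<open>i\<close> is the one in
  \<open>comb_antipode\<close>, so only \<open>j = l\<close> survives.\<close>

lemma prim_brace:
  fixes q :: "'k::field wqsym"
  assumes ps: "\<forall>p\<in>set ps. prim p" and q: "prim q"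
  shows "prim (brace ps q)"
proof -
  let ?m = "length ps"
  have pos: "\<forall>p\<in>set ps. pos p" using ps prim_pos by blast
  have td: "\<forall>p\<in>set (take i ps). prim p" "\<forall>p\<in>set (drop i ps). prim p"
    "\<forall>p\<in>set (take i ps). pos p" "\<forall>p\<in>set (drop i ps). pos p" for i
    using ps pos by (auto dest: in_set_takeD in_set_dropD)
  \<comment> \<open>\<open>T j l\<close> is the right tensor factor; with \<open>j = l\<close> it is
    a summand of the bracket itself.\<close>
  define T where "T j l = lcomb (take j ps) \<rhd> (q \<lhd> rcomb (drop l ps))" for j l
  define X where "X = (\<lambda>(j,i,l). scale ((-1) ^ (?m - i))
      (tens (lcomb (drop j (take i ps)) \<odot> rcomb (take (l - i) (drop i ps))) (T j l)))"
  have br: "brace ps q = (\<Sum>i\<le>?m. scale ((-1) ^ (?m - i)) (T i i))"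
    unfolding T_def by (rule brace_eq[OF pos prim_pos[OF q]])
  have posT: "pos (T i i)" for i unfolding T_def
    by (intro pos_ops pkd_ops pkd_lcomb pkd_rcomb td prim_pkd[OF q] prim_pos[OF q])
  have copT: "scale ((-1) ^ (?m - i)) (cop False (T i i)) = (\<Sum>j\<le>i. \<Sum>l = i..?m. X (j,i,l)) + scale ((-1) ^ (?m - i)) (tens (T i i) (R []))"
    if i: "i \<le> ?m" for i
  proof -
    have "cop False (T i i) = (\<Sum>j\<le>i. \<Sum>k\<le>?m - i.
        tens (lcomb (drop j (take i ps)) \<odot> rcomb (take k (drop i ps)))
          (lcomb (take j (take i ps)) \<rhd> (q \<lhd> rcomb (drop k (drop i ps))))) + tens (T i i) (R [])"
      unfolding T_def using i
      by (intro cop_usucc_uprec_prim[OF pkd_lcomb[OF td(3)] pkd_rcomb[OF td(4)] q])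
         (simp_all add: cop_lcomb[OF td(1)] cop_rcomb[OF td(2)] min_def)
    also have "(\<Sum>j\<le>i. \<Sum>k\<le>?m - i.
        tens (lcomb (drop j (take i ps)) \<odot> rcomb (take k (drop i ps)))
          (lcomb (take j (take i ps)) \<rhd> (q \<lhd> rcomb (drop k (drop i ps)))))
      = (\<Sum>j\<le>i. \<Sum>l = i..?m.
        tens (lcomb (drop j (take i ps)) \<odot> rcomb (take (l - i) (drop i ps))) (T j l))"
    proof (rule sum.cong[OF refl], rule sum.reindex_bij_witness[where i = "\<lambda>l. l - i" and j = "\<lambda>k. k + i"], goal_cases)
      case (5 j k)
      then show ?case by (simp add: T_def min_def)
    qed (use i in auto)
    finally show ?thesis by (simp add: X_def free_vs.scale_right_distrib free_vs.scale_sum_right)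
  qed
  have XS: "(\<Sum>i = j..l. X (j,i,l)) = (if l = j then scale ((-1) ^ (?m - j)) (tens (R []) (T j j)) else 0)"
    if jl: "j \<le> l" "l \<le> ?m" for j l
  proof -
    let ?mid = "drop j (take l ps)"
    have len: "length ?mid = l - j" using jl by simp
    have mid: "\<forall>p\<in>set ?mid. pos p" using pos by (auto dest: in_set_takeD in_set_dropD)
    have ne: "?mid = [] \<longleftrightarrow> l = j" using jl by auto
    have "(\<Sum>i = j..l. X (j,i,l)) = (\<Sum>i\<le>l - j. scale ((-1) ^ (?m - j)) (tens (scale ((-1) ^ i) (lcomb (take i ?mid) \<odot> rcomb (drop i ?mid))) (T j l)))"
    proof (rule sum.reindex_bij_witness[where i = "\<lambda>k. k + j" and j = "\<lambda>i. i - j"], goal_cases)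
      case (5 i)
      then have i: "j \<le> i" "i \<le> l" by auto
      \<comment> \<open>Splitting the exponent turns the sign of the bracket into a sign independent
        of \<open>i\<close> times \<open>(-1) ^ (i - j)\<close>, the sign in
        \<open>comb_antipode\<close>.\<close>
      have "?m - j = (?m - i) + (i - j)" using i jl by simp
      then have "(-1 :: 'k) ^ (?m - j) * (-1) ^ (i - j) = (-1) ^ (?m - i)"
        by (simp add: power_add mult.assoc flip: power_mult_distrib)
      moreover have "take (i - j) ?mid = drop j (take i ps)" using i by (simp add: take_drop)
      moreover have "drop (i - j) ?mid = take (l - i) (drop i ps)" using i by (simp add: take_drop)
      ultimately show ?case by (simp add: X_def op_scale)
    qed (use jl in auto)
    also have "\<dots> = scale ((-1) ^ (?m - j)) (tens (\<Sum>i\<le>length ?mid. scale ((-1) ^ i) (lcomb (take i ?mid) \<odot> rcomb (drop i ?mid))) (T j l))"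
      by (simp only: op_sum free_vs.scale_sum_right len)
    also have "\<dots> = (if l = j then scale ((-1) ^ (?m - j)) (tens (R []) (T j j)) else 0)"
      unfolding comb_antipode[OF mid] ne by (auto simp: op_0)
    finally show ?thesis .
  qed
  have "cop False (brace ps q) = (\<Sum>i\<le>?m. scale ((-1) ^ (?m - i)) (cop False (T i i)))"
    unfolding br by (simp add: lin_sum[OF cop_lin] lin_scale[OF cop_lin])
  also have "\<dots> = (\<Sum>i\<le>?m. \<Sum>j\<le>i. \<Sum>l = i..?m. X (j,i,l)) + tens (brace ps q) (R [])"
    using copT unfolding br by (simp add: sum.distrib op_sum op_scale)
  \<comment> \<open>The triples are those with \<open>j \<le> i \<le> l\<close>; putting
    \<open>i\<close> innermost makes \<open>XS\<close> applicable.\<close>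
  also have "(\<Sum>i\<le>?m. \<Sum>j\<le>i. \<Sum>l = i..?m. X (j,i,l)) = (\<Sum>j\<le>?m. \<Sum>l = j..?m. \<Sum>i = j..l. X (j,i,l))"
    by (simp add: sum.Sigma)
       (rule sum.reindex_bij_witness[where i = "\<lambda>(j,l,i). (i,j,l)" and j = "\<lambda>(i,j,l). (j,l,i)"], auto)
  also have "\<dots> = (\<Sum>j\<le>?m. \<Sum>l = j..?m. if l = j then scale ((-1) ^ (?m - j)) (tens (R []) (T j j)) else 0)"
    by (intro sum.cong refl) (use XS in auto)
  also have "\<dots> = tens (R []) (brace ps q)"
    unfolding br by (simp add: op_sum op_scale)
  finally have c: "cop False (brace ps q) = tens (R []) (brace ps q) + tens (brace ps q) (R [])" .
  have "Poly_Mapping.keys (brace ps q) \<subseteq> {w. packed w \<and> w \<noteq> []}"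
    unfolding br by (intro keys_sum_subset order_trans[OF keys_scale] posT[unfolded pos_def])
  with c show ?thesis unfolding prim_def pos_def by simp
qed

section \<open>Insertion of a letter\<close>

text \<open>Frees \<open>phi\<close> from the letter \<open>wmax w + 1\<close>: before packing, a
  factor of \<open>phi I w\<close> is again an insertion, but of the maximum of the whole
  word.\<close>

definition insert_letter :: "nat \<Rightarrow> nat set \<Rightarrow> word \<Rightarrow> word" where
  "insert_letter M I w = map (\<lambda>j. if j \<in> I then M else w ! card ({1..<j} - I)) [1..<length w + card I + 1]"

lemma phi_insert_letter: "phi I w = insert_letter (wmax w + 1) I w"
  by (simp add: phi_def insert_letter_def)

lemma length_insert_letter [simp]: "length (insert_letter M I w) = length w + card I"
  by (simp add: insert_letter_def del: upt_Suc)

lemma insert_letter_Nil [simp]: "insert_letter M {} [] = []"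
  by (simp add: insert_letter_def)

lemma insert_letter_snoc:
  assumes "I \<subseteq> {1..length w + card I}"
  shows "insert_letter M I (w @ [a]) = insert_letter M I w @ [a]"
proof -
  let ?N = "length w + card I"
  have fin: "finite I" using assms finite_subset by blast
  have idx: "card ({1..<j} - I) < length w" if "j \<le> ?N" "j \<notin> I" "1 \<le> j" for j
  proof -
    have "{1..<j} - I \<subset> {1..?N} - I" using that by auto
    then have "card ({1..<j} - I) < card ({1..?N} - I)" by (rule psubset_card_mono[rotated]) simp
    also have "\<dots> = length w" using assms fin by (simp add: card_Diff_subset)
    finally show ?thesis .
  qed
  have "{1..<?N + 1} - I = {1..?N} - I" by auto
  then have "card ({1..<?N + 1} - I) = length w" using assms fin by (simp add: card_Diff_subset)
  moreover have "?N + 1 \<notin> I" using assms by auto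
  ultimately show ?thesis using idx by (auto simp: insert_letter_def nth_append)
qed

lemma insert_letter_insert:
  assumes "I \<subseteq> {1..length w + card I}"
  shows "insert_letter M (insert (length w + card I + 1) I) w = insert_letter M I w @ [M]"
proof -
  let ?N = "length w + card I"
  have fin: "finite I" using assms finite_subset by blast
  have ni: "?N + 1 \<notin> I" using assms by auto
  then have c: "card (insert (?N + 1) I) = card I + 1" using fin by simp
  have "{1..<j} - insert (?N + 1) I = {1..<j} - I" if "j \<le> ?N" for j using that by auto
  then show ?thesis unfolding insert_letter_def c using ni by auto
qed

text \<open>Reads the result from the right: its last position either belongs to \<open>I\<close> or
  carries the last letter of \<open>w\<close>. This replaces the index arithmetic of the definition
  in the lemmas that follow.\<close>

lemma insert_letter_induct [consumes 1, case_names Nil insert snoc]: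
  assumes "I \<subseteq> {1..length w + card I}"
    and "P {} []"
    and "\<And>I w. I \<subseteq> {1..length w + card I} \<Longrightarrow> P I w \<Longrightarrow> P (insert (length w + card I + 1) I) w"
    and "\<And>I w a. I \<subseteq> {1..length w + card I} \<Longrightarrow> P I w \<Longrightarrow> P I (w @ [a])"
  shows "P I w"
  using assms(1)
proof (induction "length w + card I" arbitrary: I w)
  case 0
  then show ?case using assms(2) by simp
next
  case (Suc n)
  have fin: "finite I" using Suc.prems finite_subset by blast
  show ?case
  proof (cases "Suc n \<in> I")
    case True
    let ?J = "I - {Suc n}"
    have c: "card I = Suc (card ?J)" using True fin by (metis card_Suc_Diff1)
    then have n: "n = length w + card ?J" using Suc.hyps(2) by simp
    have "?J \<subseteq> {1..length w + card ?J}" using Suc.prems unfolding Suc.hyps(2)[symmetric] n[symmetric] by auto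
    moreover from this have "P ?J w" using Suc.hyps(1)[OF n] by simp
    ultimately have "P (insert (length w + card ?J + 1) ?J) w" by (rule assms(3))
    moreover have "insert (length w + card ?J + 1) ?J = I" using True n by auto
    ultimately show ?thesis by simp
  next
    case False
    then have J: "I \<subseteq> {1..n}" using Suc.prems unfolding Suc.hyps(2)[symmetric] by (force simp: subset_iff le_Suc_eq)
    then have "card I \<le> n" using card_mono[of "{1..n}" I] by simp
    then have "length w > 0" using Suc.hyps(2) by linarith
    then obtain w' a where w: "w = w' @ [a]" by (cases w rule: rev_cases) auto
    have n: "n = length w' + card I" using Suc.hyps(2) w by simp
    have "P I w'" using Suc.hyps(1)[OF n] J n by simp
    then show ?thesis unfolding w using J n by (intro assms(4)) auto
  qed
qed

lemma insert_letter_append: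
  "I \<subseteq> {1..length u + card I} \<Longrightarrow> insert_letter M I (u @ v) = insert_letter M I u @ v"
proof (induction v rule: rev_induct)
  case (snoc a v)
  then have "I \<subseteq> {1..length (u @ v) + card I}" by fastforce
  then show ?case using snoc insert_letter_snoc[of I "u @ v" M a] by simp
qed simp

lemma insert_letter_shift:
  assumes "J \<subseteq> {1..length v + card J}"
  shows "insert_letter M ((+) (length u) ` J) (u @ v) = u @ insert_letter M J v"
  using assms
proof (induction J v rule: insert_letter_induct)
  case Nil
  then show ?case using insert_letter_append[of "{}" "[]" M u] by simp
next
  case (insert I w)
  have c: "card ((+) (length u) ` I) = card I" by (simp add: card_image)
  have "(+) (length u) ` I \<subseteq> {1..length (u @ w) + card ((+) (length u) ` I)}" using insert(1) unfolding c by auto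
  from insert_letter_insert[OF this, of M] show ?case
    using insert insert_letter_insert[OF insert(1), of M] by (simp add: c add.assoc)
next
  case (snoc I w a)
  have c: "card ((+) (length u) ` I) = card I" by (simp add: card_image)
  have "(+) (length u) ` I \<subseteq> {1..length (u @ w) + card ((+) (length u) ` I)}" using snoc(1) unfolding c by auto
  from insert_letter_snoc[OF this, of M a] show ?case
    using snoc insert_letter_snoc[OF snoc(1), of M] by (simp add: c)
qed

lemma set_insert_letter:
  assumes "I \<subseteq> {1..length w + card I}"
  shows "set (insert_letter M I w) = set w \<union> (if I = {} then {} else {M})"
  using assms
  by (induction I w rule: insert_letter_induct) (auto simp: insert_letter_insert insert_letter_snoc simp del: One_nat_def)

lemma filter_insert_letter:
  assumes "I \<subseteq> {1..length w + card I}" "M \<notin> set w"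
  shows "filter (\<lambda>a. a \<noteq> M) (insert_letter M I w) = w"
  using assms
  by (induction I w rule: insert_letter_induct) (auto simp: insert_letter_insert[simplified] insert_letter_snoc)

text \<open>Together with the filter that removes \<open>M\<close> this inverts
  \<open>insert_letter\<close>; positions count from 1, as in \<open>phi\<close>.\<close>

definition positions :: "nat \<Rightarrow> word \<Rightarrow> nat set" where
  "positions M w = {j. 1 \<le> j \<and> j \<le> length w \<and> w ! (j - 1) = M}"

lemma positions_simps [simp]:
  "positions M [] = {}"
  "positions M (w @ [a]) = (if a = M then insert (length w + 1) (positions M w) else positions M w)"
  by (auto simp: positions_def nth_append)

lemma positions_subset: "positions M w \<subseteq> {1..length w}" "finite (positions M w)"
  by (auto simp: positions_def)

lemma positions_insert_letter:
  assumes "I \<subseteq> {1..length w + card I}" "M \<notin> set w"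
  shows "positions M (insert_letter M I w) = I"
  using assms
  by (induction I w rule: insert_letter_induct) (auto simp: insert_letter_insert[simplified] insert_letter_snoc)

lemma length_filter_positions: "length (filter (\<lambda>a. a \<noteq> M) w) + card (positions M w) = length w"
proof (induction w rule: rev_induct)
  case (snoc a w)
  have "Suc (length w) \<notin> positions M w" using positions_subset[of M w] by auto
  then show ?case using snoc positions_subset(2)[of M w] by simp
qed simp

lemma insert_letter_positions: "insert_letter M (positions M w) (filter (\<lambda>a. a \<noteq> M) w) = w"
proof (induction w rule: rev_induct)
  case (snoc a w)
  let ?f = "filter (\<lambda>a. a \<noteq> M) w"
  have "positions M w \<subseteq> {1..length ?f + card (positions M w)}"
    unfolding length_filter_positions by (rule positions_subset)
  from insert_letter_insert[OF this, of M] insert_letter_snoc[OF this, of M a] show ?case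
    using snoc by (simp add: length_filter_positions)
qed simp

lemma map_insert_letter:
  assumes "I \<subseteq> {1..length w + card I}"
  shows "map h (insert_letter M I w) = insert_letter (h M) I (map h w)"
  using assms
proof (induction I w rule: insert_letter_induct)
  case (insert I w)
  then show ?case using insert_letter_insert[of I w M] insert_letter_insert[of I "map h w" "h M"] by simp
next
  case (snoc I w a)
  then show ?case using insert_letter_snoc[of I w M a] insert_letter_snoc[of I "map h w" "h M" "h a"] by simp
qed simp

text \<open>\<open>M\<close> lies above \<open>w\<close>, so packing sends it to one more than the
  largest packed letter, which is the letter that \<open>phi\<close> inserts.\<close>

lemma pack_insert_letter:
  assumes "I \<subseteq> {1..length w + card I}" "I \<noteq> {}" "\<And>a. a \<in> set w \<Longrightarrow> a < M"
  shows "pack (insert_letter M I w) = phi I (pack w)"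
proof -
  have "below w [M]" using assms(3) by (simp add: below_def)
  then obtain h where h: "map h w = pack w" "map h [M] = shift (wmax (pack w)) (pack [M])"
    "\<And>z. set z = set w \<union> set [M] \<Longrightarrow> pack z = map h z"
    using below_relabel by metis
  have "{b. b = M \<and> b \<le> M} = {M}" by auto
  then have "h M = wmax (pack w) + 1" using h(2) by (simp add: pack_def shift_def)
  moreover have "pack (insert_letter M I w) = insert_letter (h M) I (map h w)"
    using h(3) set_insert_letter[OF assms(1), of M] assms(2) map_insert_letter[OF assms(1)] by simp
  ultimately show ?thesis by (simp add: phi_insert_letter h(1))
qed

lemma phi_packed:
  assumes "packed w" "I \<subseteq> {1..length w + card I}" "I \<noteq> {}"
  shows "phi I w \<in> PW (length w + card I)" "wmax (phi I w) = wmax w + 1"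
    "positions (wmax w + 1) (phi I w) = I" "filter (\<lambda>a. a \<noteq> wmax w + 1) (phi I w) = w"
proof -
  have "phi I w = pack (insert_letter (wmax w + 1) I w)"
    using pack_insert_letter[OF assms(2,3), of "wmax w + 1"] wmax_ge[of _ w] pack_id[OF assms(1)]
    by (simp add: less_Suc_eq_le)
  then show "phi I w \<in> PW (length w + card I)" by (simp add: PW_def)
  have ni: "wmax w + 1 \<notin> set w" using wmax_ge[of "wmax w + 1" w] by auto
  show "positions (wmax w + 1) (phi I w) = I" "filter (\<lambda>a. a \<noteq> wmax w + 1) (phi I w) = w"
    unfolding phi_insert_letter
    by (rule positions_insert_letter[OF assms(2) ni], rule filter_insert_letter[OF assms(2) ni])
  show "wmax (phi I w) = wmax w + 1"
    by (rule wmax_eqI) (use assms(3) in \<open>auto simp: phi_insert_letter set_insert_letter[OF assms(2)] le_SucI wmax_ge split: if_splits\<close>)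
qed

section \<open>Total primitivity of insertions\<close>

lemma lin_Phi [lin_intros]: "lin F \<Longrightarrow> lin (\<lambda>x. Phi I (F x))"
  unfolding Phi_def by (rule lin_linear_ext_comp)

lemma Phi_R: "Phi I (R w) = (if Max I \<le> length w + card I then R (phi I w) else 0)"
  by (simp add: Phi_def)

lemma positions_range:
  fixes I :: "nat set"
  assumes "finite I" "0 \<notin> I" "I \<noteq> {}"
  shows "I \<subseteq> {1..N} \<longleftrightarrow> Max I \<le> N"
proof -
  have "1 \<le> i" if "i \<in> I" for i using assms(2) that by (metis Suc_leI One_nat_def gr0I)
  then show ?thesis using assms by auto
qed

lemma Phi_WQSym:
  assumes "x \<in> WQSym n" "finite I" "0 \<notin> I" "I \<noteq> {}"
  shows "Phi I x \<in> WQSym (n + card I)"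
  unfolding WQSym_iff
proof (rule keys_lin_subset[OF lin_Phi[OF lin_id] assms(1)[unfolded WQSym_iff]])
  fix u assume "u \<in> PW n"
  then show "Poly_Mapping.keys (Phi I (Poly_Mapping.single u 1)) \<subseteq> PW (n + card I)"
    using phi_packed(1)[of u I] assms positions_range[OF assms(2-4)] by (auto simp: single_R Phi_R PW_def)
qed

text \<open>A cut that leaves the maximum on the right falls before the first inserted position, so
  it cuts \<open>w\<close> at the same place. The insertion passes to the right factor, with its
  positions lowered by the length of the left one.\<close>

lemma Delta_succ_phi:
  assumes w: "packed w" and I: "I \<subseteq> {1..length w + card I}" "I \<noteq> {}"
  shows "Delta_succ (R (phi I w)) = linear_ext (\<lambda>(u, v). if u \<noteq> [] \<and> length u < Min I
     then R_tensor u (phi ((\<lambda>j. j - length u) ` I) v) else 0) (cop_word False w)"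
proof -
  let ?M = "wmax w + 1" and ?z = "phi I w"
  have fin: "finite I" using I finite_subset by blast
  have lt: "\<And>a. a \<in> set w \<Longrightarrow> a < ?M" using wmax_ge[of _ w] by (simp add: less_Suc_eq_le)
  have lenz: "length ?z = length w + card I" by (simp add: phi_insert_letter)
  have MinI: "Min I \<in> I" "\<And>i. i \<in> I \<Longrightarrow> Min I \<le> i" using fin I by auto
  \<comment> \<open>All \<open>card I\<close> inserted positions lie from \<open>Min I\<close> on,
    so at most \<open>length w\<close> positions come before.\<close>
  have "I \<subseteq> {Min I..length w + card I}" using I MinI by fastforce
  then have "card I \<le> length w + card I + 1 - Min I"
    using card_mono[of "{Min I..length w + card I}" I] by simp
  moreover have "Min I \<le> length w + card I" using MinI I by auto
  ultimately have Minle: "Min I \<le> length w + 1" by simp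
  have Mpos: "Min I \<ge> 1" using MinI I by auto
  have cut: "take i ?z = take i w \<and> drop i ?z = insert_letter ?M ((\<lambda>j. j - i) ` I) (drop i w)
      \<and> ((\<lambda>j. j - i) ` I) \<subseteq> {1..length (drop i w) + card ((\<lambda>j. j - i) ` I)}" if i: "i < Min I" for i
  proof -
    let ?J = "(\<lambda>j. j - i) ` I"
    have il: "i \<le> length w" using i Minle by simp
    have "inj_on (\<lambda>j. j - i) I"
    proof (rule inj_onI)
      fix x y assume "x \<in> I" "y \<in> I" "x - i = y - i"
      then show "x = y" using MinI(2)[of x] MinI(2)[of y] i by linarith
    qed
    then have c: "card ?J = card I" by (rule card_image)
    have J: "?J \<subseteq> {1..length (drop i w) + card ?J}"
    proof
      fix y assume "y \<in> ?J"
      then obtain j where j: "j \<in> I" "y = j - i" by blast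
      have "j \<le> length w + card I" using j I by auto
      then show "y \<in> {1..length (drop i w) + card ?J}" using MinI(2)[OF j(1)] i j il c by auto
    qed
    have "(+) (length (take i w)) ` ?J = I"
    proof -
      have "i + (j - i) = j" if "j \<in> I" for j using MinI(2)[OF that] i by simp
      then show ?thesis using il by (force simp: image_image min_def)
    qed
    then have "?z = take i w @ insert_letter ?M ?J (drop i w)"
      using insert_letter_shift[OF J, of ?M "take i w"] by (simp add: phi_insert_letter)
    then show ?thesis using J il by (simp add: min_def)
  qed
  have ge: "?M \<in> set (take i ?z)" if "Min I \<le> i" "i \<le> length ?z" for i
  proof -
    have "?z ! (Min I - 1) = ?M" using phi_packed(3)[OF w I] MinI(1) by (auto simp: positions_def)
    moreover have "Min I - 1 < length (take i ?z)" "take i ?z ! (Min I - 1) = ?z ! (Min I - 1)"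
      using that Mpos by auto
    ultimately show ?thesis by (metis nth_mem)
  qed
  have "Delta_succ (R ?z) = (\<Sum>i = 1..<length ?z. if set (take i ?z) \<inter> set (drop i ?z) = {} \<and> ?M \<notin> set (take i ?z)
    then R_tensor (pack (take i ?z)) (pack (drop i ?z)) else 0)"
    unfolding Delta_succ_R phi_packed(2)[OF w I] ..
  also have "\<dots> = (\<Sum>i = 1..<Min I. if set (take i ?z) \<inter> set (drop i ?z) = {} \<and> ?M \<notin> set (take i ?z)
    then R_tensor (pack (take i ?z)) (pack (drop i ?z)) else 0)"
  proof (rule sum.mono_neutral_right)
    show "{1..<Min I} \<subseteq> {1..<length ?z}" using \<open>Min I \<le> length w + card I\<close> lenz by auto
  qed (use ge in auto)
  also have "\<dots> = (\<Sum>i = 1..<Min I. if set (take i w) \<inter> set (drop i w) = {}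
    then R_tensor (pack (take i w)) (phi ((\<lambda>j. j - i) ` I) (pack (drop i w))) else 0)"
  proof (rule sum.cong[OF refl])
    fix i assume "i \<in> {1..<Min I}"
    then have i: "i < Min I" by simp
    have ni: "?M \<notin> set (take i w)" using lt in_set_takeD by fastforce
    have ne: "(\<lambda>j. j - i) ` I \<noteq> {}" using I by simp
    have "set (drop i ?z) = insert ?M (set (drop i w))"
      using cut[OF i] set_insert_letter[of "(\<lambda>j. j - i) ` I" "drop i w" ?M] ne by auto
    moreover have "pack (drop i ?z) = phi ((\<lambda>j. j - i) ` I) (pack (drop i w))"
      using cut[OF i] pack_insert_letter[of "(\<lambda>j. j - i) ` I" "drop i w" ?M] ne lt in_set_dropD by metis
    ultimately show "(if set (take i ?z) \<inter> set (drop i ?z) = {} \<and> ?M \<notin> set (take i ?z)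
        then R_tensor (pack (take i ?z)) (pack (drop i ?z)) else 0)
      = (if set (take i w) \<inter> set (drop i w) = {}
        then R_tensor (pack (take i w)) (phi ((\<lambda>j. j - i) ` I) (pack (drop i w))) else 0)"
      using cut[OF i] ni by auto
  qed
  also have "\<dots> = (\<Sum>i\<le>length w. if 1 \<le> i \<and> i < Min I \<and> set (take i w) \<inter> set (drop i w) = {}
    then R_tensor (pack (take i w)) (phi ((\<lambda>j. j - i) ` I) (pack (drop i w))) else 0)"
    by (rule sum.mono_neutral_cong_left) (use Minle in auto)
  also have "\<dots> = linear_ext (\<lambda>(u, v). if u \<noteq> [] \<and> length u < Min I
     then R_tensor u (phi ((\<lambda>j. j - length u) ` I) v) else 0) (cop_word False w)"
    unfolding cop_word_def lin_sum[OF lin_linear_ext]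
    by (rule sum.cong[OF refl]) (auto simp: lin_0[OF lin_linear_ext] min_def Suc_le_eq)
  finally show ?thesis .
qed

text \<open>Here the maximum is on the left and, by disjointness, not on the right, so the cut falls
  no earlier than position \<open>Max I\<close>. The insertion stays entirely in the left factor,
  and the right factor is a suffix of \<open>w\<close>.\<close>

lemma Delta_prec_phi:
  assumes w: "packed w" and I: "I \<subseteq> {1..length w + card I}" "I \<noteq> {}"
  shows "Delta_prec (R (phi I w)) = linear_ext (\<lambda>(u, v). if v \<noteq> [] \<and> Max I \<le> length u + card I
     then R_tensor (phi I u) v else 0) (cop_word False w)"
proof -
  let ?M = "wmax w + 1" and ?z = "phi I w"
  have fin: "finite I" using I finite_subset by blast
  have lt: "\<And>a. a \<in> set w \<Longrightarrow> a < ?M" using wmax_ge[of _ w] by (simp add: less_Suc_eq_le)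
  have lenz: "length ?z = length w + card I" by (simp add: phi_insert_letter)
  have MaxI: "Max I \<in> I" "\<And>i. i \<in> I \<Longrightarrow> i \<le> Max I" using fin I by auto
  have "I \<subseteq> {1..Max I}" using I MaxI by fastforce
  then have cM: "card I \<le> Max I" using card_mono[of "{1..Max I}" I] by simp
  have Mpos: "Max I \<ge> 1" "Max I \<le> length ?z" using MaxI I lenz by auto
  have cut: "take (k + card I) ?z = insert_letter ?M I (take k w) \<and> drop (k + card I) ?z = drop k w
      \<and> I \<subseteq> {1..length (take k w) + card I}" if k: "Max I \<le> k + card I" "k \<le> length w" for k
  proof -
    have J: "I \<subseteq> {1..length (take k w) + card I}" using I k MaxI(2) by fastforce
    then have "?z = insert_letter ?M I (take k w) @ drop k w"
      using insert_letter_append[OF J, of ?M "drop k w"] by (simp add: phi_insert_letter)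
    then show ?thesis using J k by (simp add: min_def)
  qed
  have ge: "?M \<in> set (drop i ?z)" if "i < Max I" for i
  proof -
    have "?z ! (Max I - 1) = ?M" using phi_packed(3)[OF w I] MaxI(1) by (auto simp: positions_def)
    moreover have "drop i ?z ! (Max I - 1 - i) = ?z ! (Max I - 1)" "Max I - 1 - i < length (drop i ?z)"
      using that Mpos by auto
    ultimately show ?thesis by (metis nth_mem)
  qed
  have "Delta_prec (R ?z) = (\<Sum>i = 1..<length ?z. if set (take i ?z) \<inter> set (drop i ?z) = {} \<and> ?M \<in> set (take i ?z)
    then R_tensor (pack (take i ?z)) (pack (drop i ?z)) else 0)"
    unfolding Delta_prec_R phi_packed(2)[OF w I] ..
  also have "\<dots> = (\<Sum>i = Max I..<length ?z. if set (take i ?z) \<inter> set (drop i ?z) = {} \<and> ?M \<in> set (take i ?z)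
    then R_tensor (pack (take i ?z)) (pack (drop i ?z)) else 0)"
  proof (rule sum.mono_neutral_right)
    show "\<forall>i\<in>{1..<length ?z} - {Max I..<length ?z}. (if set (take i ?z) \<inter> set (drop i ?z) = {} \<and> ?M \<in> set (take i ?z)
      then R_tensor (pack (take i ?z)) (pack (drop i ?z)) else 0) = 0"
      using ge by auto
  qed (use Mpos in auto)
  \<comment> \<open>The prefix contains all inserted letters, so a cut of the longer word at
    \<open>i\<close> is a cut of \<open>w\<close> at \<open>i - card I\<close>.\<close>
  also have "\<dots> = (\<Sum>k = Max I - card I..<length w. if set (take k w) \<inter> set (drop k w) = {}
    then R_tensor (phi I (pack (take k w))) (pack (drop k w)) else 0)"
  proof (rule sum.reindex_bij_witness[where i = "\<lambda>k. k + card I" and j = "\<lambda>i. i - card I"], goal_cases)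
    case (5 i)
    define k where "k = i - card I"
    have ik: "i = k + card I" using 5 cM by (simp add: k_def)
    have k: "Max I \<le> k + card I" "k \<le> length w" using 5 ik lenz by auto
    have ni: "?M \<notin> set (drop k w)" using lt in_set_dropD by fastforce
    have "set (take i ?z) = insert ?M (set (take k w))"
      using cut[OF k] set_insert_letter[of I "take k w" ?M] I by (simp add: ik)
    moreover have "pack (take i ?z) = phi I (pack (take k w))"
      using cut[OF k] pack_insert_letter[of I "take k w" ?M] I lt in_set_takeD ik by metis
    moreover have "drop i ?z = drop k w" using cut[OF k] ik by simp
    ultimately show ?case using ni by (simp add: k_def[symmetric])
  qed (use cM lenz Mpos in auto)
  also have "\<dots> = (\<Sum>k\<le>length w. if k < length w \<and> Max I \<le> k + card I \<and> set (take k w) \<inter> set (drop k w) = {}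
    then R_tensor (phi I (pack (take k w))) (pack (drop k w)) else 0)"
    by (rule sum.mono_neutral_cong_left) auto
  also have "\<dots> = linear_ext (\<lambda>(u, v). if v \<noteq> [] \<and> Max I \<le> length u + card I
     then R_tensor (phi I u) v else 0) (cop_word False w)"
    unfolding cop_word_def lin_sum[OF lin_linear_ext]
    by (rule sum.cong[OF refl]) (auto simp: lin_0[OF lin_linear_ext] min_def)
  finally show ?thesis .
qed

lemma linear_ext_zero: "(\<And>u. u \<in> Poly_Mapping.keys x \<Longrightarrow> f u = 0) \<Longrightarrow> linear_ext f x = 0"
  by (simp add: linear_ext_def)

text \<open>\<open>m j\<close> and \<open>m' j\<close> are the degrees of the tensor factors. A term
  survives in \<open>Delta_succ\<close> only if \<open>m j\<close> is positive and less than
  \<open>Min I\<close>, and in \<open>Delta_prec\<close> only if \<open>m' j\<close> is positive and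
  \<open>Max I \<le> m j + card I\<close>; the hypotheses on degrees exclude both.\<close>

lemma Phi_totally_primitive:
  assumes x: "x \<in> WQSym n" and I: "I \<subseteq> {1..n + card I}" "I \<noteq> {}"
    and c: "cop False x = (\<Sum>j\<in>J. tens (a j) (b j))"
    and ab: "\<And>j. j \<in> J \<Longrightarrow> a j \<in> WQSym (m j)" "\<And>j. j \<in> J \<Longrightarrow> b j \<in> WQSym (m' j)"
    and m: "\<And>j. j \<in> J \<Longrightarrow> m j = 0 \<or> Min I \<le> m j"
    and m': "\<And>j. j \<in> J \<Longrightarrow> m' j = 0 \<or> m j + card I < Max I"
  shows "Delta_succ (Phi I x) = 0" "Delta_prec (Phi I x) = 0"
proof -
  have fin: "finite I" using I finite_subset by blast
  have Phi_phi: "Phi I (R w) = R (phi I w)" if "w \<in> PW n" for w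
    using that I fin by (auto simp: Phi_R PW_def subset_iff)
  have keys: "Poly_Mapping.keys (tens (a j) (b j)) \<subseteq> PW (m j) \<times> PW (m' j)" if "j \<in> J" for j
    using ab[OF that] by (intro keys_tens) (auto simp: WQSym_iff)
  have "Delta_succ (Phi I x) = linear_ext (\<lambda>(u, v). if u \<noteq> [] \<and> length u < Min I
     then R_tensor u (phi ((\<lambda>j. j - length u) ` I) v) else 0) (cop False x)"
    by (rule lin_eqI[OF _ _ x[unfolded WQSym_iff]], (intro lin_intros; fail)+)
       (use I in \<open>simp add: single_R Phi_phi Delta_succ_phi PW_def\<close>)
  also have "\<dots> = 0"
    unfolding c lin_sum[OF lin_linear_ext]
  proof (intro sum.neutral ballI linear_ext_zero)
    fix j p assume j: "j \<in> J" and p: "p \<in> Poly_Mapping.keys (tens (a j) (b j))"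
    then have "length (fst p) = m j" using keys[OF j] by (auto simp: PW_def)
    then show "(case p of (u, v) \<Rightarrow> if u \<noteq> [] \<and> length u < Min I
        then R_tensor u (phi ((\<lambda>j. j - length u) ` I) v) else 0) = 0"
      using m[OF j] by (cases p) auto
  qed
  finally show "Delta_succ (Phi I x) = 0" .
  have "Delta_prec (Phi I x) = linear_ext (\<lambda>(u, v). if v \<noteq> [] \<and> Max I \<le> length u + card I
     then R_tensor (phi I u) v else 0) (cop False x)"
    by (rule lin_eqI[OF _ _ x[unfolded WQSym_iff]], (intro lin_intros; fail)+)
       (use I in \<open>simp add: single_R Phi_phi Delta_prec_phi PW_def\<close>)
  also have "\<dots> = 0"
    unfolding c lin_sum[OF lin_linear_ext]
  proof (intro sum.neutral ballI linear_ext_zero)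
    fix j p assume j: "j \<in> J" and p: "p \<in> Poly_Mapping.keys (tens (a j) (b j))"
    then have "length (fst p) = m j" "length (snd p) = m' j" using keys[OF j] by (auto simp: PW_def)
    then show "(case p of (u, v) \<Rightarrow> if v \<noteq> [] \<and> Max I \<le> length u + card I
        then R_tensor (phi I u) v else 0) = 0"
      using m'[OF j] by (cases p) auto
  qed
  finally show "Delta_prec (Phi I x) = 0" .
qed

section \<open>Elements indexed by trees and forests\<close>

lemma forest_weight_simps [simp]:
  "forest_weight [] = 0" "forest_weight (t # f) = weight t + forest_weight f"
  "forest_weight (f @ g) = forest_weight f + forest_weight g" "forest_weight (rev f) = forest_weight f"
  by (simp_all add: forest_weight_def rev_map[symmetric])

lemma weight_Node: "weight (Node I l r) = card I + forest_weight l + forest_weight r"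
  by (simp add: forest_weight_def)

declare weight.simps [simp del] P_tree.simps [simp del]
declare weight_Node [simp]

lemma weight_pos: "red_packed t \<Longrightarrow> weight t > 0"
  by (cases t) (auto simp: card_gt_0_iff)

lemma red_packed_forest_simps [simp]:
  "red_packed_forest []" "red_packed_forest (t # f) \<longleftrightarrow> red_packed t \<and> red_packed_forest f"
  "red_packed_forest (f @ g) \<longleftrightarrow> red_packed_forest f \<and> red_packed_forest g"
  "red_packed_forest (rev f) \<longleftrightarrow> red_packed_forest f"
  by (auto simp: red_packed_forest_def)

lemma red_packed_forest_take_drop:
  "red_packed_forest f \<Longrightarrow> red_packed_forest (take j f)" "red_packed_forest f \<Longrightarrow> red_packed_forest (drop j f)"
  by (auto simp: red_packed_forest_def dest: in_set_takeD in_set_dropD)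

lemma forest_weight_pos: "red_packed_forest f \<Longrightarrow> f \<noteq> [] \<Longrightarrow> forest_weight f > 0"
  by (cases f) (auto simp: weight_pos)

lemma forest_weight_0_iff: "red_packed_forest f \<Longrightarrow> forest_weight f = 0 \<longleftrightarrow> f = []"
  using forest_weight_pos[of f] by (cases "f = []") auto

lemma red_packed_Node:
  "red_packed (Node I l r) \<longleftrightarrow> red_packed (Node I [] r) \<and> red_packed_forest l"
  by (auto simp: red_packed_forest_def)

lemma red_packed_right: "red_packed (Node I l r) \<Longrightarrow> red_packed_forest r"
  by (simp add: red_packed_forest_def)

lemma red_packed_range:
  assumes "red_packed (Node I l r)"
  shows "I \<subseteq> {1..forest_weight r + card I}" "I \<noteq> {}" "finite I" "0 \<notin> I"
proof -
  show fin: "I \<noteq> {}" "finite I" "0 \<notin> I" using assms by auto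
  show "I \<subseteq> {1..forest_weight r + card I}"
  proof (cases "r = []")
    case False
    then have "1 \<le> int (card I) + int (forest_weight r) + 1 - int (Max I)" using assms by simp
    then have "Max I \<le> forest_weight r + card I" by linarith
    then show ?thesis using positions_range[OF fin(2,3,1)] by simp
  qed (use assms in auto)
qed

text \<open>The invariant carried by the induction in \<open>P_tree_good\<close>. The
  \<open>itself\<close> argument names the field, which the forest does not determine.\<close>

definition good :: "'k::field itself \<Rightarrow> nat set biplane list \<Rightarrow> bool" where
  "good _ f \<longleftrightarrow> (\<forall>t\<in>set f. (P_tree t :: 'k wqsym) \<in> WQSym (weight t) \<and> prim (P_tree t :: 'k wqsym))"

context
  fixes f :: "nat set biplane list" and K :: "'k::field itself"
  assumes good: "good K f"
begin

lemma good_take_drop: "good K (take j f)" "good K (drop j f)"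
  using good by (auto simp: good_def dest: in_set_takeD in_set_dropD)

lemma good_prim: "\<forall>p\<in>set (map P_tree f). prim (p :: 'k wqsym)" "\<forall>p\<in>set (map P_tree f). pos (p :: 'k wqsym)"
  using good by (auto simp: good_def prim_pos)

end

lemma good_rev: "good K (rev f) \<longleftrightarrow> good K f"
  by (simp add: good_def)

lemma comb_WQSym:
  assumes "good TYPE('k::field) f"
  shows "(lcomb (map P_tree f) :: 'k wqsym) \<in> WQSym (forest_weight f)"
    "(rcomb (map P_tree f) :: 'k wqsym) \<in> WQSym (forest_weight f)"
proof -
  show "(lcomb (map P_tree f) :: 'k wqsym) \<in> WQSym (forest_weight f)"
    using assms by (induction f) (auto simp: good_def intro!: ops_WQSym)
  show "(rcomb (map P_tree f) :: 'k wqsym) \<in> WQSym (forest_weight f)"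
    using assms by (induction f rule: rev_induct) (auto simp: good_def intro!: ops_WQSym)
qed

lemma P_forest_lcomb:
  assumes "good TYPE('k::field) f"
  shows "(P_forest f :: 'k wqsym) = lcomb (map P_tree (rev f))"
  using good_prim(2)[OF assms] by (simp add: P_forest_def forest_prod_lcomb rev_map)

lemma P_forest_WQSym:
  assumes "good TYPE('k::field) f"
  shows "(P_forest f :: 'k wqsym) \<in> WQSym (forest_weight f)"
  using comb_WQSym(1)[of "rev f"] assms unfolding P_forest_lcomb[OF assms] by (simp add: good_rev)

lemma cop_P_forest:
  assumes "good TYPE('k::field) f"
  shows "cop False (P_forest f :: 'k wqsym) = (\<Sum>j\<le>length f. tens (P_forest (take j f)) (P_forest (drop j f)))"
proof -
  have "cop False (P_forest f :: 'k wqsym) = (\<Sum>j\<le>length f.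
      tens (lcomb (drop j (map P_tree (rev f)))) (lcomb (take j (map P_tree (rev f)))))"
    unfolding P_forest_lcomb[OF assms]
    by (subst cop_lcomb) (use good_prim(1)[OF assms] in auto)
  also have "\<dots> = (\<Sum>j\<le>length f. tens (P_forest (take j f)) (P_forest (drop j f)))"
  proof (rule sum.reindex_bij_witness[where i = "\<lambda>j. length f - j" and j = "\<lambda>j. length f - j"], goal_cases)
    case (5 j)
    then show ?case
      by (simp add: P_forest_lcomb[OF good_take_drop(1)[OF assms]] P_forest_lcomb[OF good_take_drop(2)[OF assms]]
          take_map drop_map rev_take rev_drop)
  qed auto
  finally show ?thesis .
qed

lemma brace_WQSym:
  assumes "good TYPE('k::field) f" "(q :: 'k wqsym) \<in> WQSym d" "d > 0"
  shows "brace (map P_tree f) q \<in> WQSym (forest_weight f + d)"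
  unfolding brace_eq[OF good_prim(2)[OF assms(1)] WQSym_pos[OF assms(2,3)]]
proof (intro WQSym_sum WQSym_scale)
  fix i
  have "forest_weight f = forest_weight (take i f) + forest_weight (drop i f)"
    by (metis append_take_drop_id forest_weight_simps(3))
  then show "lcomb (take i (map P_tree f)) \<rhd> (q \<lhd> rcomb (drop i (map P_tree f))) \<in> WQSym (forest_weight f + d)"
    using ops_WQSym(3)[OF comb_WQSym(1)[OF good_take_drop(1)[OF assms(1), of i]]
        ops_WQSym(2)[OF assms(2) comb_WQSym(2)[OF good_take_drop(2)[OF assms(1), of i]]]]
    by (simp add: take_map drop_map add_ac)
qed

lemma P_tree_Node:
  assumes "(Phi I (P_forest r) :: 'k::field wqsym) \<in> WQSym d" "d > 0"
  shows "(P_tree (Node I l r) :: 'k wqsym) = brace (map P_tree l) (Phi I (P_forest r))"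
  using brace_eq[of "[]" "Phi I (P_forest r) :: 'k wqsym"] WQSym_pos[OF assms] by (simp add: P_forest_def Let_def P_tree.simps)

text \<open>The bounds in \<open>red_packed\<close> supply the degree conditions of
  \<open>Phi_totally_primitive\<close>: a nonempty prefix of \<open>r\<close> weighs at least as
  much as \<open>hd r\<close>, and a nonempty suffix at least as much as
  \<open>last r\<close>.\<close>

lemma Phi_P_forest:
  assumes "good TYPE('k::field) r" "red_packed (Node I l r)"
  shows "(Phi I (P_forest r) :: 'k wqsym) \<in> WQSym (card I + forest_weight r)"
    "Delta_succ (Phi I (P_forest r) :: 'k wqsym) = 0" "Delta_prec (Phi I (P_forest r) :: 'k wqsym) = 0"
    "prim (Phi I (P_forest r) :: 'k wqsym)"
proof -
  note I = red_packed_range[OF assms(2)]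
  have r: "red_packed_forest r" using red_packed_right[OF assms(2)] .
  show W: "(Phi I (P_forest r) :: 'k wqsym) \<in> WQSym (card I + forest_weight r)"
    using Phi_WQSym[OF P_forest_WQSym[OF assms(1)] I(3,4,2)] by (simp add: add.commute)
  have td: "forest_weight r = forest_weight (take j r) + forest_weight (drop j r)" for j
    by (metis append_take_drop_id forest_weight_simps(3))
  have 1: "forest_weight (take j r) = 0 \<or> Min I \<le> forest_weight (take j r)" for j
  proof (cases "take j r = []")
    case False
    then have "weight (hd r) \<le> forest_weight (take j r)" by (cases r; cases j) auto
    moreover have "Min I \<le> weight (hd r)" using assms(2) False by auto
    ultimately show ?thesis by simp
  qed (auto simp only: forest_weight_simps(1))
  \<comment> \<open>The upper bound in \<open>red_packed\<close>, solved for \<open>Max I\<close>: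
    the weight in front of the last tree plus \<open>card I\<close> is less than
    \<open>Max I\<close>.\<close>
  have 2: "forest_weight (drop j r) = 0 \<or> forest_weight (take j r) + card I < Max I" for j
  proof (cases "drop j r = []")
    case False
    then have ne: "r \<noteq> []" by auto
    have "drop j r = butlast (drop j r) @ [last r]" using False by (metis append_butlast_last_id last_drop drop_eq_Nil not_le)
    then have "weight (last r) \<le> forest_weight (drop j r)" by (metis forest_weight_simps(1,2,3) le_add2 add_0_right)
    moreover have "int (card I) + int (forest_weight r) + 1 - int (Max I) \<le> int (weight (last r))"
      using assms(2) ne by auto
    ultimately show ?thesis using td[of j] by linarith
  qed simp
  show z: "Delta_succ (Phi I (P_forest r) :: 'k wqsym) = 0" "Delta_prec (Phi I (P_forest r) :: 'k wqsym) = 0"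
    by (rule Phi_totally_primitive[OF P_forest_WQSym[OF assms(1)] I(1,2) cop_P_forest[OF assms(1)],
        where m = "\<lambda>j. forest_weight (take j r)" and m' = "\<lambda>j. forest_weight (drop j r)"];
        (rule P_forest_WQSym good_take_drop assms(1) 1 2)+)+
  have "card I + forest_weight r > 0" using I by (simp add: card_gt_0_iff)
  then show "prim (Phi I (P_forest r) :: 'k wqsym)" using prim_iff[OF WQSym_pos[OF W]] z by simp
qed

lemma P_tree_good:
  "red_packed t \<Longrightarrow> good TYPE('k::field) [t]"
proof (induction t)
  case (Node I l r)
  have l: "good TYPE('k) l" and r: "good TYPE('k) r" using Node by (auto simp: good_def)
  have d: "card I + forest_weight r > 0" using red_packed_range[OF Node.prems] by (simp add: card_gt_0_iff)
  note q = Phi_P_forest[OF r Node.prems]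
  show ?case
    using brace_WQSym[OF l q(1) d] prim_brace[OF good_prim(1)[OF l] q(4)]
    by (simp add: good_def P_tree_Node[OF q(1) d] add_ac)
qed

lemma red_packed_good: "red_packed_forest f \<Longrightarrow> good TYPE('k::field) f"
  using P_tree_good by (auto simp: good_def red_packed_forest_def)

declare red_packed.simps [simp del]

section \<open>Contraction against coordinates\<close>

definition rp_forests :: "nat \<Rightarrow> nat set biplane list set" where
  "rp_forests k = {f. red_packed_forest f \<and> forest_weight f = k}"

lemma P_forest_Nil [simp]: "P_forest [] = R []"
  by (simp add: P_forest_def forest_prod_def)

lemma P_forest_in:
  "f \<in> rp_forests k \<Longrightarrow> P_forest f \<in> WQSym k"
  using P_forest_WQSym[OF red_packed_good] by (auto simp: rp_forests_def)

lemma P_forest_snoc: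
  assumes "red_packed_forest g" "red_packed t"
  shows "(P_forest (g @ [t]) :: 'k::field wqsym) = P_tree t \<lhd> P_forest g"
proof -
  have "good TYPE('k) (g @ [t])" "good TYPE('k) g" using assms by (auto intro!: red_packed_good)
  then show ?thesis by (simp add: P_forest_lcomb)
qed

lemma P_tree_in:
  assumes "red_packed t"
  shows "(P_tree t :: 'k::field wqsym) \<in> WQSym (weight t)" "prim (P_tree t :: 'k wqsym)"
  using P_tree_good[OF assms, where 'k = 'k] by (auto simp: good_def)

lemma P_forest_single: "red_packed t \<Longrightarrow> P_forest [t] = P_tree t"
  using P_forest_snoc[of "[]" t] by (simp add: prim_pos[OF P_tree_in(2)])

text \<open>The map \<open>id \<otimes> L\<close> on the part of right degree \<open>k\<close>; the
  coefficient of the empty word reads back the scalar that \<open>L\<close> encodes. The cut-off is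
  there because a coordinate is prescribed in a single degree only.\<close>

definition contract :: "('k::field wqsym \<Rightarrow> 'k wqsym) \<Rightarrow> nat \<Rightarrow> (word \<times> word \<Rightarrow>\<^sub>0 'k) \<Rightarrow> 'k wqsym" where
  "contract L k = linear_ext (\<lambda>(u, v). if length v = k then scale (Poly_Mapping.lookup (L (R v)) []) (R u) else 0)"

lemma lin_contract [lin_intros]: "lin F \<Longrightarrow> lin (\<lambda>x. contract L k (F x))"
  unfolding contract_def by (rule lin_linear_ext_comp)

lemma contract_tens:
  assumes "lin L" "y \<in> WQSym m"
  shows "contract L k (tens x y) = (if m = k then scale (Poly_Mapping.lookup (L y) []) x else 0)"
proof -
  have l: "lin (\<lambda>y. if m = k then scale (Poly_Mapping.lookup (L y) []) x else 0)" for x :: "'a wqsym"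
    using assms(1) by (auto simp: lin_def lookup_add free_vs.scale_left_distrib)
  have l': "lin (\<lambda>x. if m = k then scale (Poly_Mapping.lookup (L y) []) x else 0)" for y
    by (auto simp: lin_def free_vs.scale_right_distrib mult.commute)
  show ?thesis
    apply (rule lin_eqI[OF _ l', of _ x UNIV], (intro lin_intros; fail), simp)
    apply (rule lin_eqI[OF _ l assms(2)[unfolded WQSym_iff]], (intro lin_intros; fail))
    by (simp add: contract_def PW_def single_R[symmetric])
qed

lemma lin_span_0:
  assumes "lin F" "x \<in> free_vs.span (b ` S)" "\<And>s. s \<in> S \<Longrightarrow> F (b s) = 0"
  shows "F x = 0"
  using assms(2)
  by (induction rule: free_vs.span_induct_alt)
     (use assms(1,3) in \<open>auto simp: lin_0 lin_add lin_scale\<close>)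

text \<open>\<open>coordinate L s\<close>: up to the identification of scalars with multiples of \<open>R []\<close>, \<open>L\<close> is the coordinate
  along the single-tree forest \<open>[s]\<close> in the family of forests of the same weight.\<close>

definition coordinate :: "('k::field wqsym \<Rightarrow> 'k wqsym) \<Rightarrow> nat set biplane \<Rightarrow> bool" where
  "coordinate L s \<longleftrightarrow> red_packed s \<and> lin L \<and>
     (\<forall>g\<in>rp_forests (weight s). L (P_forest g) = (if g = [s] then R [] else 0))"

lemma coordinateD:
  assumes "coordinate L s"
  shows "red_packed s" "lin L" "red_packed_forest g \<Longrightarrow> forest_weight g = weight s \<Longrightarrow> L (P_forest g) = (if g = [s] then R [] else 0)"
  using assms by (auto simp: coordinate_def rp_forests_def)

lemma coordinate_exists:
  assumes "red_packed s" "indep_family (P_forest :: _ \<Rightarrow> 'k::field wqsym) (rp_forests (weight s))"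
  obtains L :: "'k::field wqsym \<Rightarrow> 'k wqsym" where "coordinate L s"
proof -
  have "[s] \<in> rp_forests (weight s)" using assms by (simp add: rp_forests_def)
  from coordinate_functional[OF assms(2) this] show ?thesis
    using that assms(1) unfolding coordinate_def by metis
qed

text \<open>Every summand but the last has a nonempty right comb, so by \<open>usucc_uprec\<close>
  it is a \<lhd>-product of factors of positive degree. A map that vanishes on these sees only the
  summand with the whole of \<open>f\<close> to the left of \<open>q\<close>.\<close>

lemma lin_brace_top:
  fixes L :: "'k::field wqsym \<Rightarrow> ('b \<Rightarrow>\<^sub>0 'k)"
  assumes L: "lin L" and f: "red_packed_forest f" and q: "q \<in> WQSym d" "d > 0"
    and van: "\<And>x y i j. x \<in> WQSym i \<Longrightarrow> y \<in> WQSym j \<Longrightarrow> 0 < i \<Longrightarrow> 0 < j \<Longrightarrow> i + j = forest_weight f + d \<Longrightarrow> L (x \<lhd> y) = 0"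
  shows "L (brace (map P_tree f) q) = L (lcomb (map P_tree f) \<rhd> q)"
proof -
  have good: "good TYPE('k) f" by (rule red_packed_good[OF f])
  let ?T = "\<lambda>i. lcomb (take i (map P_tree f)) \<rhd> (q \<lhd> rcomb (drop i (map P_tree f)))"
  have 0: "L (?T i) = 0" if i: "i < length f" for i
  proof -
    let ?l = "lcomb (map P_tree (take i f)) :: 'k wqsym" and ?r = "rcomb (map P_tree (drop i f)) :: 'k wqsym"
    have l: "?l \<in> WQSym (forest_weight (take i f))" and r: "?r \<in> WQSym (forest_weight (drop i f))"
      using comb_WQSym good_take_drop[OF good] by blast+
    have "?T i = (?l \<rhd> q) \<lhd> ?r"
      using usucc_uprec[OF WQSym_pkd[OF l] WQSym_pkd[OF q(1)] WQSym_pkd[OF r]] by (simp add: take_map drop_map)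
    moreover have "forest_weight (take i f) + forest_weight (drop i f) = forest_weight f"
      by (metis append_take_drop_id forest_weight_simps(3))
    moreover have "forest_weight (drop i f) > 0"
      by (rule forest_weight_pos) (use f i in \<open>auto intro: red_packed_forest_take_drop\<close>)
    ultimately show ?thesis
      using van[OF ops_WQSym(3)[OF l q(1)] r] q(2) by (simp add: add_ac)
  qed
  have "L (brace (map P_tree f) q) = (\<Sum>i<Suc (length f). scale ((-1) ^ (length f - i)) (L (?T i)))"
    unfolding brace_eq[OF good_prim(2)[OF good] WQSym_pos[OF q]] lessThan_Suc_atMost
    by (simp add: lin_sum[OF L] lin_scale[OF L])
  also have "\<dots> = L (lcomb (map P_tree f) \<rhd> q)"
    using 0 WQSym_pos[OF q] by simp
  finally show ?thesis .
qed

context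
  fixes L :: "'k::field wqsym \<Rightarrow> 'k wqsym" and s :: "nat set biplane"
  assumes coord: "coordinate L s"
    and spanning: "\<And>k. k < weight s \<Longrightarrow> (WQSym k :: 'k wqsym set) \<subseteq> free_vs.span (P_forest ` rp_forests k)"
begin

lemma linL: "lin L"
  using coordinateD(2)[OF coord] .

lemma lin_L_comp: "lin F \<Longrightarrow> lin (\<lambda>x. L (F x))"
  by (rule lin_comp[OF linL])

text \<open>Expand \<open>a\<close> over forests and split off the last tree \<open>t\<close>: then
  \<open>a \<lhd> b\<close> becomes \<open>P_tree t\<close> \<lhd> a product of smaller degree.
  Expanding this product as well yields elements of forests that end in \<open>t\<close> and have at
  least two trees, and none of these is \<open>[s]\<close>.\<close>

lemma coordinate_uprec:
  assumes a: "a \<in> WQSym i" and b: "b \<in> WQSym j" and ij: "0 < i" "0 < j" "i + j = weight s"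
  shows "L (a \<lhd> b) = 0"
proof (rule lin_span_0[of _ a P_forest "rp_forests i"])
  show "lin (\<lambda>a. L (a \<lhd> b))" by (intro lin_L_comp lin_intros)
  show "a \<in> free_vs.span (P_forest ` rp_forests i)" using spanning[of i] a ij by auto
  fix f assume f: "f \<in> rp_forests i"
  then obtain g t where gt: "f = g @ [t]" using ij(1) by (cases f rule: rev_cases) (auto simp: rp_forests_def)
  have rp: "red_packed_forest g" "red_packed t" "forest_weight g + weight t = i" using f gt by (auto simp: rp_forests_def)
  have g: "(P_forest g :: 'k wqsym) \<in> WQSym (forest_weight g)" using P_forest_in rp by (auto simp: rp_forests_def)
  have *: "P_forest f \<lhd> b = P_tree t \<lhd> (P_forest g \<odot> b)"
    unfolding gt P_forest_snoc[OF rp(1,2)]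
    by (rule uprec_uprec[OF WQSym_pkd[OF P_tree_in(1)[OF rp(2)]] WQSym_pkd[OF g] WQSym_pkd[OF b]])
  \<comment> \<open>Dropping \<open>t\<close> lowers the degree, so the spanning hypothesis also
    covers the product.\<close>
  have lt: "forest_weight g + j < weight s" using rp weight_pos[OF rp(2)] ij by simp
  have "L (P_tree t \<lhd> (P_forest g \<odot> b)) = 0"
  proof (rule lin_span_0[of "\<lambda>y. L (P_tree t \<lhd> y)" "P_forest g \<odot> b" P_forest "rp_forests (forest_weight g + j)"])
    show "lin (\<lambda>y. L (P_tree t \<lhd> y))" by (intro lin_L_comp lin_intros)
    show "P_forest g \<odot> b \<in> free_vs.span (P_forest ` rp_forests (forest_weight g + j))"
      using spanning[OF lt] ops_WQSym(1)[OF g b] by blast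
    fix h assume h: "h \<in> rp_forests (forest_weight g + j)"
    then have "h \<noteq> []" using ij by (auto simp: rp_forests_def)
    have "L (P_forest (h @ [t])) = 0"
      by (subst coordinateD(3)[OF coord]) (use h \<open>h \<noteq> []\<close> rp ij in \<open>auto simp: rp_forests_def\<close>)
    then show "L (P_tree t \<lhd> P_forest h) = 0"
      using h rp(2) by (simp add: rp_forests_def P_forest_snoc)
  qed
  then show "L (P_forest f \<lhd> b) = 0" unfolding * .
qed

text \<open>Expand \<open>b\<close> over forests. Two or more trees give a \<lhd>-product, already
  killed. For a single tree only the top summand of its bracket counts; it regroups to
  \<open>(a \<odot> lcomb (map P_tree l)) \<rhd> ?q\<close>, and expanding the first factor over
  forests \<open>h\<close> gives top summands of trees with the nonempty left forest
  \<open>rev h\<close>, hence different from \<open>s\<close>.\<close>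

lemma coordinate_usucc:
  assumes left: "left_forest s = []"
    and a: "a \<in> WQSym i" and b: "b \<in> WQSym j" and ij: "0 < i" "0 < j" "i + j = weight s"
  shows "L (a \<rhd> b) = 0"
proof (rule lin_span_0[of _ b P_forest "rp_forests j"])
  show "lin (\<lambda>b. L (a \<rhd> b))" by (intro lin_L_comp lin_intros)
  show "b \<in> free_vs.span (P_forest ` rp_forests j)" using spanning[of j] b ij by auto
  fix f assume f: "f \<in> rp_forests j"
  \<comment> \<open>\<open>usucc_uprec\<close> moves the bracket and makes this a
    \<lhd>-product.\<close>
  have split: "L (a \<rhd> (x \<lhd> y)) = 0" if "x \<in> WQSym m" "y \<in> WQSym l" "0 < m" "0 < l" "m + l = j" for x y m l
    using coordinate_uprec[OF ops_WQSym(3)[OF a that(1)] that(2)] that ij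
      usucc_uprec[OF WQSym_pkd[OF a] WQSym_pkd[OF that(1)] WQSym_pkd[OF that(2)]] by simp
  from f obtain g t where gt: "f = g @ [t]" using ij(2) by (cases f rule: rev_cases) (auto simp: rp_forests_def)
  have rp: "red_packed_forest g" "red_packed t" "forest_weight g + weight t = j" using f gt by (auto simp: rp_forests_def)
  show "L (a \<rhd> P_forest f) = 0"
  proof (cases "g = []")
    case False
    have g: "(P_forest g :: 'k wqsym) \<in> WQSym (forest_weight g)" using P_forest_in rp by (auto simp: rp_forests_def)
    show ?thesis unfolding gt P_forest_snoc[OF rp(1,2)]
      by (rule split[OF P_tree_in(1)[OF rp(2)] g])
         (use rp weight_pos forest_weight_pos False in auto)
  next
    case True
    obtain I l r where t: "t = Node I l r" by (cases t)
    have rpN: "red_packed (Node I l r)" using rp(2) unfolding t .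
    then have l: "red_packed_forest l" and I0: "red_packed (Node I [] r)" using red_packed_Node by blast+
    let ?q = "Phi I (P_forest r) :: 'k wqsym" and ?d = "card I + forest_weight r"
    have q: "?q \<in> WQSym ?d" by (rule Phi_P_forest(1)[OF red_packed_good[OF red_packed_right[OF rpN]] rpN])
    have d: "?d > 0" using red_packed_range[OF rpN] by (simp add: card_gt_0_iff)
    have wj: "forest_weight l + ?d = j" using rp(3) True t by simp
    have lc: "(lcomb (map P_tree l) :: 'k wqsym) \<in> WQSym (forest_weight l)" by (rule comb_WQSym(1)[OF red_packed_good[OF l]])
    have "L (a \<rhd> P_forest f) = L (a \<rhd> brace (map P_tree l) ?q)"
      by (simp add: gt True t P_forest_single[OF rpN] P_tree_Node[OF q d, of l])
    also have "\<dots> = L (a \<rhd> (lcomb (map P_tree l) \<rhd> ?q))"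
      by (rule lin_brace_top[OF lin_L_comp[OF lin_ops(6)[OF lin_id]] l q d]) (rule split, auto simp: wj)
    also have "\<dots> = L ((a \<odot> lcomb (map P_tree l)) \<rhd> ?q)"
      using umul_usucc[OF WQSym_pkd[OF a] WQSym_pkd[OF lc] WQSym_pkd[OF q]] by simp
    also have "\<dots> = 0"
    proof (rule lin_span_0[of "\<lambda>y. L (y \<rhd> ?q)" "a \<odot> lcomb (map P_tree l)" P_forest "rp_forests (i + forest_weight l)"])
      show "lin (\<lambda>y. L (y \<rhd> ?q))" by (intro lin_L_comp lin_intros)
      have "i + forest_weight l < weight s" using wj d ij by linarith
      then show "a \<odot> lcomb (map P_tree l) \<in> free_vs.span (P_forest ` rp_forests (i + forest_weight l))"
        using spanning ops_WQSym(1)[OF a lc] by blast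
      fix h assume h: "h \<in> rp_forests (i + forest_weight l)"
      then have hne: "h \<noteq> []" and rph: "red_packed_forest (rev h)" and wh: "forest_weight (rev h) + ?d = weight s"
        using ij wj by (auto simp: rp_forests_def)
      have rpt: "red_packed (Node I (rev h) r)" using red_packed_Node[of I "rev h" r] I0 rph by blast
      \<comment> \<open>\<open>P_forest\<close> combs from the last tree on, a bracket combs its
        left forest from the first tree on; hence the reversal.\<close>
      have "(P_forest h :: 'k wqsym) = lcomb (map P_tree (rev h))"
        by (rule P_forest_lcomb[OF red_packed_good]) (use rph in simp)
      then have "L (P_forest h \<rhd> ?q) = L (brace (map P_tree (rev h)) ?q)"
        using lin_brace_top[OF linL rph q d coordinate_uprec] wh by simp
      also have "\<dots> = L (P_forest [Node I (rev h) r])"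
        by (simp add: P_tree_Node[OF q d, of "rev h"] P_forest_single[OF rpt])
      also have "\<dots> = 0"
        by (subst coordinateD(3)[OF coord]) (use rpt wh left hne in auto)
      finally show "L (P_forest h \<rhd> ?q) = 0" .
    qed
    finally show ?thesis .
  qed
qed

end

section \<open>Contracting the coproducts of forests and trees\<close>

lemma keys_cop:
  assumes "pkd x"
  shows "Poly_Mapping.keys (cop b x) \<subseteq> {w. packed w} \<times> {w. packed w}"
proof (rule keys_lin_subset[OF lin_cop[OF lin_id] assms[unfolded pkd_def]])
  fix u :: word
  show "Poly_Mapping.keys (cop b (Poly_Mapping.single u 1)) \<subseteq> {w. packed w} \<times> {w. packed w}"
    unfolding single_R cop_R cop_word_def by (rule keys_sum_subset) (auto simp: R_tensor_def)
qed

text \<open>The right factor holds the maximal letter, so it is never empty. This provides the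
  positive degree that \<open>coordinate_uprec\<close> asks of its second factor.\<close>

lemma keys_cop_True:
  assumes "pos x"
  shows "Poly_Mapping.keys (cop True x) \<subseteq> {w. packed w} \<times> {w. packed w \<and> w \<noteq> []}"
proof (rule keys_lin_subset[OF lin_cop[OF lin_id] assms[unfolded pos_def]])
  fix u :: word
  assume "u \<in> {w. packed w \<and> w \<noteq> []}"
  then show "Poly_Mapping.keys (cop True (Poly_Mapping.single u 1)) \<subseteq> {w. packed w} \<times> {w. packed w \<and> w \<noteq> []}"
    unfolding single_R cop_R cop_word_def
    by (intro keys_sum_subset) (auto simp: R_tensor_def wmax_in le_Suc_eq)
qed

context
  fixes L :: "'k::field wqsym \<Rightarrow> 'k wqsym" and s :: "nat set biplane"
  assumes coord: "coordinate L s"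
begin

lemma linL': "lin L"
  using coordinateD(2)[OF coord] .

lemma weight_s: "weight s > 0"
  using weight_pos coordinateD(1)[OF coord] .

lemma coordinate_P_forest:
  assumes "red_packed_forest g"
  shows "contract L (weight s) (tens x (P_forest g)) = (if g = [s] then x else 0)"
  using contract_tens[OF linL' P_forest_in[of g "forest_weight g"], of "weight s" x] coordinateD(3)[OF coord assms] assms
  by (auto simp: rp_forests_def R_def)

lemma contract_cop_P_forest:
  assumes "red_packed_forest f"
  shows "contract L (weight s) (cop False (P_forest f)) = (\<Sum>j\<le>length f. if drop j f = [s] then P_forest (take j f) else 0)"
  unfolding cop_P_forest[OF red_packed_good[OF assms]] lin_sum[OF lin_contract[OF lin_id]]
  by (rule sum.cong[OF refl]) (simp add: coordinate_P_forest red_packed_forest_take_drop[OF assms])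

lemma contract_cop_snoc:
  assumes "red_packed_forest (g @ [s])"
  shows "contract L (weight s) (cop False (P_forest (g @ [s]))) = P_forest g"
proof -
  have "(if drop j (g @ [s]) = [s] then P_forest (take j (g @ [s])) else 0)
      = (if j = length g then P_forest g else (0 :: 'k wqsym))" if "j \<le> length (g @ [s])" for j
  proof (cases "j = length g")
    case False
    then have "length (drop j (g @ [s])) \<noteq> 1" using that by auto
    then have "drop j (g @ [s]) \<noteq> [s]" by (metis One_nat_def length_Cons list.size(3))
    then show ?thesis using False by simp
  qed simp
  then show ?thesis unfolding contract_cop_P_forest[OF assms] by simp
qed

lemma contract_cop_other:
  assumes "red_packed_forest f" "\<And>g. f \<noteq> g @ [s]"
  shows "contract L (weight s) (cop False (P_forest f)) = 0"
proof -
  have "drop j f \<noteq> [s]" for j using assms(2) by (metis append_take_drop_id)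
  then show ?thesis unfolding contract_cop_P_forest[OF assms(1)] by simp
qed

lemma contract_unit_left: "x \<in> WQSym n \<Longrightarrow> weight s \<noteq> n \<Longrightarrow> contract L (weight s) (tens y x) = 0"
  using contract_tens[OF linL', of x n] by simp

lemma contract_unit_right: "contract L (weight s) (tens x (R [])) = 0"
  using contract_unit_left[of "R []" 0] weight_s by simp

context
  assumes spanning: "\<And>k. k < weight s \<Longrightarrow> (WQSym k :: 'k wqsym set) \<subseteq> free_vs.span (P_forest ` rp_forests k)"
    and left: "left_forest s = []"
begin

text \<open>On words the right factor is \<open>R v \<lhd> R v'\<close>. It is 0 for empty
  \<open>v\<close>, invisible to the contraction in the wrong degree, and killed by \<open>L\<close>
  otherwise.\<close>

lemma contract_tprod_uprec:
  assumes "Poly_Mapping.keys X \<subseteq> {w. packed w} \<times> {w. packed w}"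
    and "Poly_Mapping.keys Y \<subseteq> {w. packed w} \<times> {w. packed w \<and> w \<noteq> []}"
  shows "contract L (weight s) (tprod uprec_word X Y) = 0"
proof (rule lin_zeroI[OF _ assms(1)], (intro lin_intros; fail), rule lin_zeroI[OF _ assms(2)], (intro lin_intros; fail))
  fix p q assume p: "p \<in> {w. packed w} \<times> {w. packed w}" and q: "q \<in> {w. packed w} \<times> {w. packed w \<and> w \<noteq> []}"
  obtain u v u' v' where pq: "p = (u, v)" "q = (u', v')" by (cases p; cases q)
  have vv: "R v \<in> WQSym (length v)" "R v' \<in> WQSym (length v')" "v' \<noteq> []" using p q pq by auto
  have "contract L (weight s) (tens (umul_word u u') (R v \<lhd> R v')) = 0"
  proof (cases "v \<noteq> [] \<and> length v + length v' = weight s")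
    case True
    then have "L (R v \<lhd> R v') = 0"
      by (intro coordinate_uprec[OF coord spanning vv(1,2)]) (use vv in auto)
    then show ?thesis using contract_tens[OF linL' ops_WQSym(2)[OF vv(1,2)]] by simp
  next
    case False
    then show ?thesis
      using contract_tens[OF linL' ops_WQSym(2)[OF vv(1,2)]]
      by (cases "v = []") (auto simp: op_0 lin_0[OF lin_contract[OF lin_id]])
  qed
  then show "contract L (weight s) (tprod uprec_word (Poly_Mapping.single p 1) (Poly_Mapping.single q 1)) = 0"
    by (simp add: tprod_def pq ops_R(2))
qed

lemma contract_cop_True_uprec:
  assumes "pkd x" "pos y"
  shows "contract L (weight s) (cop True (x \<lhd> y)) = 0"
  using contract_tprod_uprec[OF keys_cop[OF assms(1)] keys_cop_True[OF assms(2)]]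
  by (simp add: cop_uprec assms pos_pkd)

text \<open>The summands of the bracket that are \<lhd>-products are annihilated, which leaves
  \<open>lcomb (map P_tree l) \<rhd> ?q\<close>. Since \<open>cop True\<close> of \<open>?q\<close>
  is \<open>R [] \<otimes> ?q\<close>, only the comb of \<open>l\<close> is cut. If part of
  \<open>l\<close> stays on the right, the right factor is a \<rhd>-product and \<open>L\<close>
  kills it; so all of \<open>l\<close> has to go to the left.\<close>

lemma contract_cop_True_Node:
  assumes t: "red_packed (Node I l r)" and w: "weight s < weight (Node I l r)"
  shows "contract L (weight s) (cop True (P_tree (Node I l r))) =
    (if s = Node I [] r then P_forest (rev l) else 0)"
proof -
  let ?q = "Phi I (P_forest r) :: 'k wqsym" and ?d = "card I + forest_weight r"
  have l: "red_packed_forest l" and I0: "red_packed (Node I [] r)" using t red_packed_Node by blast+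
  have good: "good TYPE('k) l" by (rule red_packed_good[OF l])
  note q = Phi_P_forest[OF red_packed_good[OF red_packed_right[OF t]] t, where 'k = 'k]
  have d: "?d > 0" using red_packed_range[OF t] by (simp add: card_gt_0_iff)
  note pq = WQSym_pos[OF q(1) d]
  have Pt: "(P_tree (Node I l r) :: 'k wqsym) = brace (map P_tree l) ?q" by (rule P_tree_Node[OF q(1) d])
  \<comment> \<open>As the element of a single-tree forest, \<open>?q\<close> has a prescribed value
    under \<open>L\<close>.\<close>
  have Pq: "?q = P_forest [Node I [] r]"
    using brace_eq[of "[]" ?q] pq unfolding P_forest_single[OF I0] P_tree_Node[OF q(1) d] by simp
  have copq: "cop True ?q = tens (R []) ?q" using cop_Delta(1)[OF pq] q(2) by simp
  have "contract L (weight s) (cop True (P_tree (Node I l r))) = contract L (weight s) (cop True (lcomb (map P_tree l) \<rhd> ?q))"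
    unfolding Pt
    by (rule lin_brace_top[OF lin_contract[OF lin_cop[OF lin_id]] l q(1) d])
       (rule contract_cop_True_uprec, auto intro: WQSym_pkd WQSym_pos)
  also have "cop True (lcomb (map P_tree l) \<rhd> ?q) = tprod usucc_word (cop False (lcomb (map P_tree l))) (cop True ?q)"
    using cop_usucc[OF pkd_lcomb[OF good_prim(2)[OF good]] pq, of True] by simp
  also have "\<dots> = (\<Sum>j\<le>length l. tens (lcomb (map P_tree (drop j l))) (lcomb (map P_tree (take j l)) \<rhd> ?q))"
    unfolding copq cop_lcomb[OF good_prim(1)[OF good]]
    by (simp add: lin_sum[OF tprod_lin(1)] tprod_tens bilinear_ext_ops take_map drop_map)
  also have "contract L (weight s) \<dots> = (\<Sum>j\<le>length l. if j = 0 then (if s = Node I [] r then P_forest (rev l) else 0) else 0)"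
    unfolding lin_sum[OF lin_contract[OF lin_id]]
  proof (rule sum.cong[OF refl])
    fix j assume j: "j \<in> {..length l}"
    show "contract L (weight s) (tens (lcomb (map P_tree (drop j l))) (lcomb (map P_tree (take j l)) \<rhd> ?q))
      = (if j = 0 then (if s = Node I [] r then P_forest (rev l) else 0) else 0)"
    proof (cases "j = 0")
      case True
      have "lcomb (map P_tree l) = (P_forest (rev l) :: 'k wqsym)"
        using P_forest_lcomb[of "rev l", where 'k = 'k] good by (simp add: good_rev)
      moreover have "contract L (weight s) (tens x ?q) = (if s = Node I [] r then x else 0)" for x
        unfolding Pq using coordinate_P_forest[of "[Node I [] r]" x] I0 by auto
      ultimately show ?thesis using True pq by simp
    next
      case False
      have W: "(lcomb (map P_tree (take j l)) :: 'k wqsym) \<in> WQSym (forest_weight (take j l))"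
        by (rule comb_WQSym(1)[OF good_take_drop(1)[OF good]])
      have "take j l \<noteq> []" using False j by auto
      then have "forest_weight (take j l) > 0"
        using forest_weight_pos[OF red_packed_forest_take_drop(1)[OF l]] by blast
      then have "L (lcomb (map P_tree (take j l)) \<rhd> ?q) = 0" if "forest_weight (take j l) + ?d = weight s"
        using coordinate_usucc[OF coord spanning left W q(1)] d that by simp
      then show ?thesis using contract_tens[OF linL' ops_WQSym(3)[OF W q(1)]] False by simp
    qed
  qed
  finally show ?thesis by simp
qed

end

end

section \<open>Independence in degree n\<close>

lemma lin_forest_sum:
  "(\<And>f. f \<in> F \<Longrightarrow> b f \<in> WQSym n) \<Longrightarrow> (\<Sum>f\<in>F. scale (c f) (b f)) \<in> WQSym n"
  by (intro WQSym_sum WQSym_scale)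

text \<open>The place of the maximum in \<open>phi I w\<close> is \<open>I\<close>, so this map
  separates the images of \<open>Phi I\<close> for different \<open>I\<close> and undoes
  \<open>Phi J\<close> where no word is sent to 0.\<close>

definition erase_max :: "nat set \<Rightarrow> 'k::field wqsym \<Rightarrow> 'k wqsym" where
  "erase_max J = linear_ext (\<lambda>w. if positions (wmax w) w = J then R (filter (\<lambda>a. a \<noteq> wmax w) w) else 0)"

lemma erase_max_Phi:
  assumes "y \<in> WQSym m" "I \<subseteq> {1..m + card I}" "I \<noteq> {}"
  shows "erase_max J (Phi I y) = (if I = J then y else 0)"
proof -
  have l: "lin (\<lambda>y. if I = J then y else 0)" by (simp add: lin_def)
  have fin: "finite I" using assms(2) finite_subset by blast
  show ?thesis
  proof (rule lin_eqI[OF _ l assms(1)[unfolded WQSym_iff]])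
    show "lin (\<lambda>y. erase_max J (Phi I y))" unfolding erase_max_def by (intro lin_intros)
    fix w assume "w \<in> PW m"
    then have w: "packed w" "length w = m" by (auto simp: PW_def)
    have "Max I \<le> m + card I" using assms fin by auto
    then show "erase_max J (Phi I (Poly_Mapping.single w 1)) = (if I = J then Poly_Mapping.single w 1 else 0)"
      using phi_packed(2-4)[OF w(1), of I] assms w by (cases "I = J") (simp_all add: single_R Phi_R erase_max_def)
  qed
qed

section \<open>The induction step, given the forest basis in all lower degrees\<close>

context
  fixes n :: nat and K :: "'k::field itself"
  assumes n: "n > 0"
    and basis: "\<And>k. k < n \<Longrightarrow> basis_family (P_forest :: _ \<Rightarrow> 'k wqsym) (rp_forests k) (WQSym k)"
begin

lemma lower_indep: "k < n \<Longrightarrow> indep_family (P_forest :: _ \<Rightarrow> 'k wqsym) (rp_forests k)"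
  and lower_span: "k < n \<Longrightarrow> (WQSym k :: 'k wqsym set) \<subseteq> free_vs.span (P_forest ` rp_forests k)"
  using basis by (auto simp: basis_family_iff)

text \<open>Stated for primitive \<open>x\<close> rather than for \<open>x = 0\<close>, to serve
  both independence and the description of \<open>Prim n\<close>. The coproduct of such an
  \<open>x\<close> has right degrees 0 and \<open>n\<close> only, while the last tree of a longer
  forest has a weight strictly between, so contracting along it gives 0.\<close>

lemma prim_kills_forests:
  fixes c :: "_ \<Rightarrow> 'k"
  assumes F: "finite F" "F \<subseteq> rp_forests n" and x: "x = (\<Sum>f\<in>F. scale (c f) (P_forest f))"
    and D: "Delta_prec x + Delta_succ x = 0" and f: "f \<in> F" "length f \<noteq> 1"
  shows "c f = 0"
proof -
  have fn: "f \<in> rp_forests n" using F f by auto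
  then obtain g t where gt: "f = g @ [t]" using n by (cases f rule: rev_cases) (auto simp: rp_forests_def)
  then have gne: "g \<noteq> []" using f by auto
  have rp: "red_packed_forest g" "red_packed t" "forest_weight g + weight t = n" using fn gt by (auto simp: rp_forests_def)
  have wt: "weight t < n" "weight t > 0" using rp forest_weight_pos[OF rp(1) gne] weight_pos[OF rp(2)] by auto
  obtain L :: "'k wqsym \<Rightarrow> 'k wqsym" where L: "coordinate L t"
    using coordinate_exists[OF rp(2) lower_indep[OF wt(1)]] .
  have xn: "x \<in> WQSym n" unfolding x by (rule lin_forest_sum) (use F P_forest_in in blast)
  have "cop False x = tens (R []) x + tens x (R [])"
    using cop_Delta(2)[OF WQSym_pos[OF xn n]] D by simp
  then have z: "contract L (weight t) (cop False x) = 0"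
    using contract_unit_left[OF L xn] contract_unit_right[OF L] wt by (simp add: lin_add[OF lin_contract[OF lin_id]])
  show ?thesis
  proof (rule indep_contract[where K = "\<lambda>x. contract L (weight t) (cop False x)" and h = "\<lambda>g. g @ [t]"
        and G = "rp_forests (n - weight t)" and e = P_forest and b = P_forest and S = "rp_forests n" and F = F])
    show "lin (\<lambda>x. contract L (weight t) (cop False x))" by (intro lin_intros)
    show "indep_family (P_forest :: _ \<Rightarrow> 'k wqsym) (rp_forests (n - weight t))" using lower_indep wt by simp
    show "contract L (weight t) (cop False (P_forest (g @ [t]))) = P_forest g" if "g \<in> rp_forests (n - weight t)" for g
      by (rule contract_cop_snoc[OF L]) (use that rp in \<open>simp add: rp_forests_def\<close>)
    show "contract L (weight t) (cop False (P_forest s)) = 0"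
      if "s \<in> rp_forests n" "s \<notin> (\<lambda>g. g @ [t]) ` rp_forests (n - weight t)" for s
    proof (rule contract_cop_other[OF L])
      show "red_packed_forest s" using that by (simp add: rp_forests_def)
      show "s \<noteq> g @ [t]" for g using that by (auto simp: rp_forests_def)
    qed
    show "f \<in> (\<lambda>g. g @ [t]) ` rp_forests (n - weight t)" using gt rp by (auto simp: rp_forests_def)
  qed (use F f z in \<open>auto simp: inj_on_def x\<close>)
qed

text \<open>The analogue for trees, again for \<open>x\<close> that may be nonzero: from
  \<open>Delta_succ x = 0\<close> it follows that \<open>cop True x\<close> is concentrated in right
  degree \<open>n\<close>.\<close>

lemma tprim_kills_trees:
  fixes c :: "_ \<Rightarrow> 'k"
  assumes F: "finite F" "F \<subseteq> {t. red_packed t \<and> weight t = n}" and x: "x = (\<Sum>t\<in>F. scale (c t) (P_tree t))"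
    and D: "Delta_succ x = 0" and t: "t \<in> F" "left_forest t \<noteq> []"
  shows "c t = 0"
proof -
  obtain I l r where tN: "t = Node I l r" by (cases t)
  \<comment> \<open>Removing the nonempty left forest makes \<open>s\<close> lighter than
    \<open>n\<close>, so a coordinate along \<open>s\<close> is available from the lower
    degrees.\<close>
  define s where "s = Node I [] r"
  have rpt: "red_packed (Node I l r)" "weight (Node I l r) = n" using F t tN by auto
  then have rps: "red_packed s" and l: "red_packed_forest l" unfolding s_def using red_packed_Node by blast+
  have "l \<noteq> []" using t tN by simp
  then have ws: "weight s < n" "forest_weight l = n - weight s"
    using forest_weight_pos[OF l] rpt(2) by (auto simp: s_def)
  obtain L :: "'k wqsym \<Rightarrow> 'k wqsym" where L: "coordinate L s"
    using coordinate_exists[OF rps lower_indep[OF ws(1)]] .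
  have span: "(WQSym k :: 'k wqsym set) \<subseteq> free_vs.span (P_forest ` rp_forests k)" if "k < weight s" for k
    using lower_span that ws by simp
  have left: "left_forest s = []" by (simp add: s_def)
  have cN: "contract L (weight s) (cop True (P_tree (Node I l r))) = (if s = Node I [] r then P_forest (rev l) else 0)"
    if "red_packed (Node I l r)" "weight s < weight (Node I l r)" for I l r
    by (rule contract_cop_True_Node[OF L span left that])
  have xn: "x \<in> WQSym n" unfolding x by (rule lin_forest_sum) (use F P_tree_in(1) in blast)
  have z: "contract L (weight s) (cop True x) = 0"
    using cop_Delta(1)[OF WQSym_pos[OF xn n]] D contract_unit_left[OF L xn] ws by simp
  show ?thesis
  proof (rule indep_contract[where K = "\<lambda>x. contract L (weight s) (cop True x)" and h = "\<lambda>g. Node I (rev g) r"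
        and G = "rp_forests (n - weight s)" and e = P_forest and b = P_tree
        and S = "{t. red_packed t \<and> weight t = n}" and F = F])
    show "lin (\<lambda>x. contract L (weight s) (cop True x))" by (intro lin_intros)
    have "weight s > 0" using weight_pos[OF rps] .
    then show "indep_family (P_forest :: _ \<Rightarrow> 'k wqsym) (rp_forests (n - weight s))" using lower_indep ws by simp
    show "contract L (weight s) (cop True (P_tree (Node I (rev g) r))) = P_forest g"
      if g: "g \<in> rp_forests (n - weight s)" for g
    proof -
      have "red_packed (Node I (rev g) r)"
        using red_packed_Node[of I "rev g" r] rps g by (auto simp: s_def rp_forests_def)
      moreover have "weight s < weight (Node I (rev g) r)" using g ws by (simp add: s_def rp_forests_def)
      ultimately show ?thesis using cN[of I "rev g" r] by (simp add: s_def)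
    qed
    show "contract L (weight s) (cop True (P_tree t')) = 0"
      if t': "t' \<in> {t. red_packed t \<and> weight t = n}" "t' \<notin> (\<lambda>g. Node I (rev g) r) ` rp_forests (n - weight s)" for t'
    proof -
      obtain I' l' r' where N: "t' = Node I' l' r'" by (cases t')
      have rp': "red_packed (Node I' l' r')" "weight (Node I' l' r') = n" using t'(1) N by auto
      have "s \<noteq> Node I' [] r'"
      proof
        assume "s = Node I' [] r'"
        then have "I' = I" "r' = r" by (auto simp: s_def)
        moreover have "rev l' \<in> rp_forests (n - weight s)"
          using rp'(2) red_packed_Node[of I' l' r'] rp'(1) \<open>I' = I\<close> \<open>r' = r\<close> by (auto simp: rp_forests_def s_def)
        ultimately have "t' \<in> (\<lambda>g. Node I (rev g) r) ` rp_forests (n - weight s)"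
          using N by (intro image_eqI[of _ _ "rev l'"]) auto
        then show False using t'(2) by simp
      qed
      then show ?thesis unfolding N using cN[OF rp'(1)] rp'(2) ws by simp
    qed
    show "t \<in> (\<lambda>g. Node I (rev g) r) ` rp_forests (n - weight s)"
      using l ws tN by (intro image_eqI[of _ _ "rev l"]) (auto simp: rp_forests_def)
  qed (use F t z in \<open>auto simp: inj_on_def x\<close>)
qed

text \<open>With an empty left forest the element is \<open>Phi I (P_forest r)\<close>. Applying
  \<open>erase_max J\<close> keeps the trees with root \<open>J\<close> and returns the elements of
  their right forests, which are independent in degree \<open>n - card J\<close>.\<close>

lemma indep_left_free:
  "indep_family (P_tree :: _ \<Rightarrow> 'k wqsym) {t. red_packed t \<and> weight t = n \<and> left_forest t = []}"
  unfolding indep_family_def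
proof safe
  fix F c t
  let ?S = "{t. red_packed t \<and> weight t = n \<and> left_forest t = []}"
  assume F: "finite F" "F \<subseteq> ?S" and z: "(\<Sum>t\<in>F. scale (c t) (P_tree t :: 'k wqsym)) = 0" and t: "t \<in> F"
  obtain J l r where tN: "t = Node J l r" by (cases t)
  have l0: "l = []" and rpt: "red_packed (Node J [] r)" "weight (Node J [] r) = n" using F t tN by auto
  let ?G = "{r. red_packed (Node J [] r) \<and> forest_weight r = n - card J}"
  have P: "(P_tree (Node I [] r) :: 'k wqsym) = Phi I (P_forest r)" if rp: "red_packed (Node I [] r)" for I r
  proof -
    note q = Phi_P_forest(1)[OF red_packed_good[OF red_packed_right[OF rp]] rp, where 'k = 'k]
    have "card I + forest_weight r > 0" using red_packed_range[OF rp] by (simp add: card_gt_0_iff)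
    then show ?thesis unfolding P_tree_Node[OF q \<open>card I + forest_weight r > 0\<close>]
      using brace_eq[of "[]" "Phi I (P_forest r) :: 'k wqsym"] WQSym_pos[OF q] by simp
  qed
  have E: "erase_max J (P_tree (Node I [] r) :: 'k wqsym) = (if I = J then P_forest r else 0)"
    if rp: "red_packed (Node I [] r)" for I r
    unfolding P[OF rp]
    by (rule erase_max_Phi[OF P_forest_WQSym[OF red_packed_good[OF red_packed_right[OF rp]]] red_packed_range(1,2)[OF rp]])
  have cJ: "card J > 0" using red_packed_range[OF rpt(1)] by (simp add: card_gt_0_iff)
  show "c t = 0"
  proof (rule indep_contract[where K = "erase_max J" and h = "\<lambda>r. Node J [] r" and G = ?G
        and e = P_forest and b = P_tree and S = ?S and F = F])
    show "lin (erase_max J :: 'k wqsym \<Rightarrow> _)" unfolding erase_max_def by simp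
    show "indep_family (P_forest :: _ \<Rightarrow> 'k wqsym) ?G"
      by (rule indep_family_mono[OF lower_indep[of "n - card J"]])
         (use n cJ red_packed_right in \<open>auto simp: rp_forests_def\<close>)
    show "erase_max J (P_tree (Node J [] g)) = (P_forest g :: 'k wqsym)" if "g \<in> ?G" for g
      using E[of J g] that by simp
    show "erase_max J (P_tree s :: 'k wqsym) = 0" if s: "s \<in> ?S" "s \<notin> Node J [] ` ?G" for s
    proof -
      obtain I l' r' where N: "s = Node I l' r'" by (cases s)
      have l'0: "l' = []" and rps: "red_packed (Node I [] r')" "weight (Node I [] r') = n" using s N by auto
      have "I \<noteq> J" using s(2) N l'0 rps by auto
      then show ?thesis unfolding N l'0 using E[OF rps(1)] by simp
    qed
    show "erase_max J (\<Sum>t\<in>F. scale (c t) (P_tree t :: 'k wqsym)) = 0"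
      unfolding z by (simp add: lin_0 erase_max_def)
    show "t \<in> Node J [] ` ?G" using tN l0 rpt by auto
  qed (use F t in \<open>auto simp: inj_on_def\<close>)
qed

lemma indep_trees:
  "indep_family (P_tree :: _ \<Rightarrow> 'k wqsym) {t. red_packed t \<and> weight t = n}"
  unfolding indep_family_def
proof safe
  fix F c t
  assume F: "finite F" "F \<subseteq> {t. red_packed t \<and> weight t = n}" and z: "(\<Sum>t\<in>F. scale (c t) (P_tree t :: 'k wqsym)) = 0" and t: "t \<in> F"
  have D: "Delta_succ (0 :: 'k wqsym) = 0" by (rule lin_0) (intro lin_intros)
  have 1: "c t = 0" if "t \<in> F" "left_forest t \<noteq> []" for t
    by (rule tprim_kills_trees[OF F z[symmetric] D that])
  let ?F = "{t \<in> F. left_forest t = []}"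
  have "(\<Sum>t\<in>?F. scale (c t) (P_tree t :: 'k wqsym)) = (\<Sum>t\<in>F. scale (c t) (P_tree t))"
    by (rule sum.mono_neutral_left) (use F 1 in auto)
  then have "c t = 0" if "t \<in> ?F" for t
    using indep_familyD[OF indep_left_free, of ?F c t] F that z by auto
  then show "c t = 0" using 1 t by blast
qed

lemma indep_forests:
  "indep_family (P_forest :: _ \<Rightarrow> 'k wqsym) (rp_forests n)"
  unfolding indep_family_def
proof safe
  fix F c f
  assume F: "finite F" "F \<subseteq> rp_forests n" and z: "(\<Sum>f\<in>F. scale (c f) (P_forest f :: 'k wqsym)) = 0" and f: "f \<in> F"
  have D: "Delta_prec (0 :: 'k wqsym) + Delta_succ 0 = 0"
    by (rule lin_0[of "\<lambda>x. Delta_prec x + Delta_succ x"]) (intro lin_intros)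
  have 1: "c f = 0" if "f \<in> F" "length f \<noteq> 1" for f
    by (rule prim_kills_forests[OF F z[symmetric] D that])
  let ?T = "{t. [t] \<in> F}"
  have inj: "inj_on (\<lambda>t. [t]) ?T" by (simp add: inj_on_def)
  have im: "(\<lambda>t. [t]) ` ?T = {f \<in> F. length f = 1}" by (auto simp: length_Suc_conv)
  then have finT: "finite ?T" using F(1) finite_image_iff[OF inj] by simp
  have T: "?T \<subseteq> {t. red_packed t \<and> weight t = n}" using F(2) by (auto simp: rp_forests_def)
  have "(\<Sum>t\<in>?T. scale (c [t]) (P_tree t :: 'k wqsym)) = (\<Sum>t\<in>?T. scale (c [t]) (P_forest [t]))"
    by (rule sum.cong[OF refl]) (use T in \<open>auto simp: P_forest_single\<close>)
  also have "\<dots> = (\<Sum>f\<in>{f \<in> F. length f = 1}. scale (c f) (P_forest f))"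
    unfolding im[symmetric] sum.reindex[OF inj] o_def ..
  also have "\<dots> = (\<Sum>f\<in>F. scale (c f) (P_forest f))"
    by (rule sum.mono_neutral_left) (use F 1 in auto)
  finally have "c [t] = 0" if "[t] \<in> F" for t
    using indep_familyD[OF indep_trees finT T, of "\<lambda>t. c [t]" t] z that by auto
  then show "c f = 0" using 1[OF f] f by (cases "length f = 1") (auto simp: length_Suc_conv)
qed

end

section \<open>Every packed word comes from a red-packed forest\<close>

text \<open>Each word is placed above all later ones, so every boundary between nonempty words is a
  global descent.\<close>

fun descending_cat :: "word list \<Rightarrow> word" where
  "descending_cat [] = []"
| "descending_cat (u # us) = shift (wmax (descending_cat us)) u @ descending_cat us"

text \<open>Serves only for counting. The shift of \<open>I\<close> leaves the whole word of
  \<open>l\<close> in front of the first maximal letter, and \<open>forest_word_surj\<close> uses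
  this to choose where a forest splits into \<open>l\<close> and \<open>r\<close>.\<close>

fun tree_word :: "nat set biplane \<Rightarrow> word" where
  "tree_word (Node I l r) =
     phi ((+) (forest_weight l) ` I) (descending_cat (map tree_word l @ map tree_word r))"

abbreviation forest_word :: "nat set biplane list \<Rightarrow> word" where
  "forest_word f \<equiv> descending_cat (map tree_word f)"

lemma length_shift [simp]: "length (shift k w) = length w"
  by (simp add: shift_def)

lemma shift_append [simp]: "shift k (u @ v) = shift k u @ shift k v"
  by (simp add: shift_def)

lemma shift_shift [simp]: "shift k (shift j u) = shift (k + j) u"
  by (simp add: shift_def add_ac)

lemma set_shift [simp]: "set (shift k u) = (+) k ` set u"
  by (auto simp: shift_def add.commute)

lemma wmax_shift_append: "wmax (shift (wmax v) u @ v) = wmax v + wmax u"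
proof (cases "u = []")
  case False
  show ?thesis
    by (rule wmax_eqI) (use wmax_in[OF False] in \<open>auto simp: wmax_ge trans_le_add1\<close>)
qed simp

lemma wmax_descending_cat_Cons:
  "wmax (descending_cat (u # us)) = wmax (descending_cat us) + wmax u"
  by (simp add: wmax_shift_append)

lemma wmax_descending_cat_append:
  "wmax (descending_cat (us @ vs)) = wmax (descending_cat vs) + wmax (descending_cat us)"
proof (induction us)
  case (Cons u us)
  then show ?case unfolding append_Cons wmax_descending_cat_Cons by simp
qed simp

lemma descending_cat_append:
  "descending_cat (us @ vs) = shift (wmax (descending_cat vs)) (descending_cat us) @ descending_cat vs"
proof (induction us)
  case (Cons u us)
  show ?case unfolding append_Cons descending_cat.simps wmax_descending_cat_append by (simp add: Cons.IH)
qed simp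

lemma packed_shift_append:
  assumes "packed u" "packed v"
  shows "packed (shift (wmax v) u @ v)"
proof -
  have "(+) (wmax v) ` {1..wmax u} \<union> {1..wmax v} = {1..wmax v + wmax u}"
    by (auto simp: image_iff)
  then show ?thesis
    using assms unfolding packed_def wmax_shift_append by simp
qed

lemma forest_word_PW:
  assumes "\<And>t. t \<in> set f \<Longrightarrow> tree_word t \<in> PW (weight t)"
  shows "forest_word f \<in> PW (forest_weight f)"
  using assms
proof (induction f)
  case (Cons t f)
  then have "tree_word t \<in> PW (weight t)" "forest_word f \<in> PW (forest_weight f)" by auto
  then show ?case by (simp add: PW_def packed_shift_append)
qed (simp add: PW_def)

lemma tree_word_PW: "red_packed t \<Longrightarrow> tree_word t \<in> PW (weight t)"
proof (induction t)
  case (Node I l r)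
  have rp: "red_packed_forest l" "red_packed_forest r"
    using Node.prems red_packed_Node red_packed_right by blast+
  have "forest_word (l @ r) \<in> PW (forest_weight (l @ r))"
    by (rule forest_word_PW) (use Node.IH rp in \<open>auto simp: red_packed_forest_def\<close>)
  then have w: "packed (forest_word (l @ r))" "length (forest_word (l @ r)) = forest_weight l + forest_weight r"
    by (auto simp: PW_def)
  have c: "card ((+) (forest_weight l) ` I) = card I" by (simp add: card_image)
  have "phi ((+) (forest_weight l) ` I) (forest_word (l @ r)) \<in> PW (length (forest_word (l @ r)) + card ((+) (forest_weight l) ` I))"
  proof (rule phi_packed(1)[OF w(1)])
    show "(+) (forest_weight l) ` I \<subseteq> {1..length (forest_word (l @ r)) + card ((+) (forest_weight l) ` I)}"
      using red_packed_range(1)[OF Node.prems] unfolding c w(2) by fastforce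
  qed (use red_packed_range(2)[OF Node.prems] in simp)
  then show ?case unfolding c w(2) by (simp add: add_ac)
qed

section \<open>From a packed word back to a red-packed forest\<close>

lemma split_forest_at:
  "\<exists>l r. f = l @ r \<and> forest_weight l \<le> c \<and> (r \<noteq> [] \<longrightarrow> c < forest_weight l + weight (hd r))"
proof (induction f arbitrary: c)
  case (Cons t f)
  show ?case
  proof (cases "c < weight t")
    case True
    then show ?thesis by (intro exI[of _ "[]"] exI[of _ "t # f"]) simp
  next
    case False
    obtain l r where "f = l @ r" "forest_weight l \<le> c - weight t"
      "r \<noteq> [] \<longrightarrow> c - weight t < forest_weight l + weight (hd r)"
      using Cons.IH[of "c - weight t"] by blast
    then show ?thesis using False by (intro exI[of _ "t # l"] exI[of _ r]) auto
  qed
qed simp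

text \<open>A packed word misses no letter up to its maximum, so the suffix uses exactly the letters
  up to its own maximum and the prefix uses all the remaining ones.\<close>

lemma global_descent_split:
  assumes w: "packed w" and k: "0 < k" "k < length w"
    and desc: "\<And>a b. a \<in> set (take k w) \<Longrightarrow> b \<in> set (drop k w) \<Longrightarrow> b < a"
  obtains u v where "packed u" "packed v" "w = shift (wmax v) u @ v" "length u = k" "length v = length w - k"
proof -
  define v where "v = drop k w"
  define u where "u = map (\<lambda>a. a - wmax v) (take k w)"
  have ne: "v \<noteq> []" using k by (simp add: v_def)
  have sw: "set w = {1..wmax w}" using w by (simp add: packed_def)
  have un: "set w = set (take k w) \<union> set v" unfolding v_def by (metis append_take_drop_id set_append)
  have gt: "wmax v < a" if "a \<in> set (take k w)" for a using desc[OF that] wmax_in[OF ne] v_def by simp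
  have wmw: "wmax v \<le> wmax w" by (rule wmax_ge) (use wmax_in[OF ne] in \<open>simp add: un\<close>)
  have sv: "set v = {1..wmax v}"
  proof
    show "set v \<subseteq> {1..wmax v}"
    proof
      fix x assume x: "x \<in> set v"
      then have "x \<in> {1..wmax w}" unfolding sw[symmetric] un by simp
      then show "x \<in> {1..wmax v}" using wmax_ge[OF x] by simp
    qed
    show "{1..wmax v} \<subseteq> set v"
    proof
      fix x assume x: "x \<in> {1..wmax v}"
      then have "x \<in> set w" unfolding sw using wmw by simp
      then show "x \<in> set v" unfolding un using gt[of x] x by auto
    qed
  qed
  have wu: "w = shift (wmax v) u @ v"
  proof -
    have "shift (wmax v) u = map (\<lambda>a. a) (take k w)"
      unfolding u_def shift_def map_map o_def by (rule map_cong[OF refl]) (simp add: gt less_imp_le)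
    then show ?thesis by (simp add: v_def)
  qed
  have mw: "wmax w = wmax v + wmax u" by (subst wu) (rule wmax_shift_append)
  have sep: "set w = set (shift (wmax v) u) \<union> set v" by (subst wu) simp
  have "set u = {1..wmax u}"
  proof
    show "set u \<subseteq> {1..wmax u}"
    proof
      fix x assume "x \<in> set u"
      moreover from this have "x \<ge> 1" using gt by (auto simp: u_def Suc_le_eq)
      ultimately show "x \<in> {1..wmax u}" using wmax_ge[of x u] by simp
    qed
    show "{1..wmax u} \<subseteq> set u"
    proof
      fix x assume x: "x \<in> {1..wmax u}"
      then have "wmax v + x \<in> set w" unfolding sw mw by simp
      moreover have "wmax v + x \<notin> set v" unfolding sv using x by simp
      ultimately have "wmax v + x \<in> set (shift (wmax v) u)" unfolding sep by blast
      then show "x \<in> set u" by auto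
    qed
  qed
  then have "packed u" "packed v" using sv by (simp_all add: packed_def)
  moreover have "length u = k" "length v = length w - k" using k by (simp_all add: u_def v_def)
  ultimately show ?thesis using that wu by blast
qed

lemma packed_remove_max:
  assumes "packed w" "w \<noteq> []"
  defines "w' \<equiv> filter (\<lambda>a. a \<noteq> wmax w) w"
  shows "packed w'" "phi (positions (wmax w) w) w' = w"
proof -
  have sw: "set w = {1..wmax w}" using assms by (simp add: packed_def)
  then have M: "wmax w \<ge> 1" using assms(2) wmax_in by fastforce
  have s: "set w' = {1..wmax w - 1}" using sw by (auto simp: w'_def)
  have m: "wmax w' = wmax w - 1"
  proof (cases "w' = []")
    case True
    then show ?thesis using s by auto
  next
    case False
    then have "wmax w - 1 \<ge> 1" using s by (metis set_empty atLeastatMost_empty_iff not_le)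
    then show ?thesis using s by (intro wmax_eqI) auto
  qed
  then show "packed w'" using s by (simp add: packed_def)
  show "phi (positions (wmax w) w) w' = w"
    unfolding phi_insert_letter m using insert_letter_positions[of "wmax w" w] M by (simp add: w'_def)
qed

text \<open>Without a global descent, the forest of the word with its maximum removed becomes the
  children of one new root. The choice of the split into \<open>l\<close> and \<open>r\<close> gives
  the lower bounds on \<open>I\<close>; the bound by the weight of the last tree is where the
  absence of global descents is used.\<close>

lemma forest_word_surj:
  assumes "packed w"
  shows "\<exists>f. red_packed_forest f \<and> forest_weight f = length w \<and> forest_word f = w"
  using assms
proof (induction "length w" arbitrary: w rule: less_induct)
  case less
  note w = less.prems
  show ?case
  proof (cases "w = []")
    case True
    then show ?thesis by (intro exI[of _ "[]"]) simp
  next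
    case ne: False
    show ?thesis
    proof (cases "\<exists>k. 0 < k \<and> k < length w \<and> (\<forall>a\<in>set (take k w). \<forall>b\<in>set (drop k w). b < a)")
      case True
      then obtain k u v where uv: "packed u" "packed v" "w = shift (wmax v) u @ v" "0 < k" "k < length w"
        "length u = k" "length v = length w - k"
        using global_descent_split[OF w] by metis
      obtain f g where f: "red_packed_forest f" "forest_weight f = length u" "forest_word f = u"
        and g: "red_packed_forest g" "forest_weight g = length v" "forest_word g = v"
      proof -
        have "length u < length w" "length v < length w" using uv(4-7) by simp_all
        then show ?thesis using less.hyps[of u] less.hyps[of v] uv(1,2) that by blast
      qed
      have "forest_word (f @ g) = w" unfolding map_append descending_cat_append f(3) g(3) by (rule uv(3)[symmetric])
      moreover have "forest_weight (f @ g) = length w" using f(2) g(2) uv(5-7) by simp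
      ultimately show ?thesis using f(1) g(1) by (intro exI[of _ "f @ g"]) (simp del: map_append)
    next
      case no_descent: False
      define M where "M = wmax w"
      define J where "J = positions M w"
      define w' where "w' = filter (\<lambda>a. a \<noteq> M) w"
      have w': "packed w'" "phi J w' = w"
        using packed_remove_max[OF w ne] by (simp_all add: M_def J_def w'_def)
      have J: "J \<subseteq> {1..length w}" "finite J" unfolding J_def by (rule positions_subset)+
      have lw: "length w = length w' + card J" using length_filter_positions[of M w] by (simp add: w'_def J_def)
      have "M \<in> set w" using wmax_in[OF ne] by (simp add: M_def)
      then obtain i where "i < length w" "w ! i = M" by (auto simp: in_set_conv_nth)
      then have "Suc i \<in> J" by (simp add: J_def positions_def)
      then have Jne: "J \<noteq> {}" by auto
      then have cJ: "card J > 0" using J(2) by (simp add: card_gt_0_iff)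
      have "length w' < length w" using lw cJ by simp
      then obtain f where f: "red_packed_forest f" "forest_weight f = length w'" "forest_word f = w'"
        using less.hyps[of w'] w'(1) by blast
      have MinJ: "Min J \<in> J" "\<And>j. j \<in> J \<Longrightarrow> Min J \<le> j" using J(2) Jne by auto
      have MaxJ: "Max J \<in> J" "\<And>j. j \<in> J \<Longrightarrow> j \<le> Max J" using J(2) Jne by auto
      \<comment> \<open>Exactly \<open>Min J - 1\<close> letters of \<open>w'\<close> precede the
        first maximal letter. The trees that end among them form \<open>l\<close>, so that letter
        falls no later than just before the end of \<open>hd r\<close>.\<close>
      obtain l r where lr: "f = l @ r" "forest_weight l \<le> Min J - 1"
        "r \<noteq> [] \<Longrightarrow> Min J - 1 < forest_weight l + weight (hd r)"
        using split_forest_at[of f "Min J - 1"] by blast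
      have Min1: "Min J \<ge> 1" using MinJ J by auto
      define I where "I = (\<lambda>j. j - forest_weight l) ` J"
      have jl: "forest_weight l < j" if "j \<in> J" for j using MinJ(2)[OF that] lr(2) Min1 by linarith
      have IJ: "(+) (forest_weight l) ` I = J"
        unfolding I_def image_image using jl by (force simp: image_iff)
      have inj: "inj_on (\<lambda>j. j - forest_weight l) J"
        by (rule inj_onI) (use jl in \<open>metis diff_is_0_eq eq_diff_iff less_imp_le\<close>)
      have cI: "card I = card J" unfolding I_def by (rule card_image[OF inj])
      have I: "finite I" "I \<noteq> {}" using J(2) Jne by (auto simp: I_def)
      have I0: "0 \<notin> I"
      proof
        assume "0 \<in> I"
        then obtain j where "j \<in> J" "j - forest_weight l = 0" by (auto simp: I_def)
        then show False using jl[of j] by simp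
      qed
      have MinI: "Min I = Min J - forest_weight l"
      proof (rule Min_eqI[OF I(1)])
        show "Min J - forest_weight l \<le> y" if "y \<in> I" for y
          using that MinJ(2) by (auto simp: I_def intro: diff_le_mono)
        show "Min J - forest_weight l \<in> I" unfolding I_def by (rule imageI[OF MinJ(1)])
      qed
      have MaxI: "Max I = Max J - forest_weight l"
      proof (rule Max_eqI[OF I(1)])
        show "y \<le> Max J - forest_weight l" if "y \<in> I" for y
          using that MaxJ(2) by (auto simp: I_def intro: diff_le_mono)
        show "Max J - forest_weight l \<in> I" unfolding I_def by (rule imageI[OF MaxJ(1)])
      qed
      have fw: "forest_weight l + forest_weight r = length w'" using lr(1) f(2) by simp
      have rpf: "red_packed_forest l" "red_packed_forest r" using f(1) lr(1) by auto
      have cond: "if r = [] then I = {1..card I}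
        else 1 \<le> Min I \<and> Min I \<le> weight (hd r) \<and>
           1 \<le> int (card I) + int (forest_weight r) + 1 - int (Max I) \<and>
           int (card I) + int (forest_weight r) + 1 - int (Max I) \<le> int (weight (last r))"
      proof (cases "r = []")
        case True
        \<comment> \<open>With \<open>r\<close> empty, all of \<open>w'\<close> stands before the
          first maximal letter, so the maximal letters fill the last \<open>card J\<close>
          positions.\<close>
        have "I \<subseteq> {1..card J}"
        proof
          fix y assume "y \<in> I"
          then obtain j where j: "j \<in> J" "y = j - forest_weight l" by (auto simp: I_def)
          have "j \<le> length w" using j J(1) by auto
          moreover have "forest_weight l = length w'" using fw True by simp
          ultimately have "1 \<le> y \<and> y \<le> card J" using j(2) jl[OF j(1)] lw by linarith
          then show "y \<in> {1..card J}" by simp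
        qed
        then have "I = {1..card J}" by (rule card_subset_eq[rotated]) (simp_all add: cI)
        then show ?thesis using True cI by simp
      next
        case False
        have "Max J \<le> length w" using MaxJ J by auto
        then have le: "int (Max I) \<le> int (card I) + int (forest_weight r)"
          using MaxI cI lw fw by linarith
        \<comment> \<open>Otherwise every maximal letter stands before the word of the last tree.
          That word then ends \<open>w\<close> intact, below all the letters in front of it, which
          is a global descent.\<close>
        have "int (card I) + int (forest_weight r) + 1 - int (Max I) \<le> int (weight (last r))"
        proof (rule ccontr)
          assume *: "\<not> ?thesis"
          have lJ: "forest_weight l < Max J" using jl MaxJ by simp
          have big: "Max J + weight (last r) \<le> length w" 
          proof -
            have "int (Max I) = int (Max J) - int (forest_weight l)" using MaxI lJ by simp
            then show ?thesis using * cI lw fw by linarith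
          qed
          let ?u = "forest_word (l @ butlast r)" and ?v = "tree_word (last r)"
          have rl: "red_packed (last r)" using rpf(2) False by (simp add: red_packed_forest_def)
          have v: "length ?v = weight (last r)" "weight (last r) > 0"
            using tree_word_PW[OF rl] weight_pos[OF rl] by (auto simp: PW_def)
          have feq: "f = (l @ butlast r) @ [last r]" using lr(1) False by simp
          have w'eq: "w' = shift (wmax ?v) ?u @ ?v"
            unfolding f(3)[symmetric] feq map_append[of _ "l @ butlast r"] descending_cat_append by simp
          have "forest_word (l @ butlast r) \<in> PW (forest_weight (l @ butlast r))"
            by (rule forest_word_PW, rule tree_word_PW)
               (use rpf in \<open>auto simp: red_packed_forest_def dest: in_set_butlastD\<close>)
          then have "set ?u = {1..wmax ?u}" unfolding PW_def packed_def by blast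
          then have u0: "0 \<notin> set ?u" by (metis atLeastAtMost_iff not_one_le_zero)
          have lenu: "length w = length ?u + card J + weight (last r)"
          proof -
            have "length w' = length ?u + weight (last r)" by (subst w'eq) (simp add: v)
            then show ?thesis using lw by simp
          qed
          have Ju: "J \<subseteq> {1..length (shift (wmax ?v) ?u) + card J}"
          proof
            fix x assume x: "x \<in> J"
            have "1 \<le> x" using x J(1) by auto
            moreover have "x \<le> length ?u + card J" using MaxJ(2)[OF x] big lenu by linarith
            ultimately show "x \<in> {1..length (shift (wmax ?v) ?u) + card J}" by simp
          qed
          let ?p = "insert_letter (wmax w' + 1) J (shift (wmax ?v) ?u)"
          have weq: "w = ?p @ ?v"
          proof -
            have "w = insert_letter (wmax w' + 1) J w'" using w'(2) unfolding phi_insert_letter by (rule sym)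
            also have "\<dots> = insert_letter (wmax w' + 1) J (shift (wmax ?v) ?u @ ?v)"
              by (rule arg_cong[OF w'eq])
            also have "\<dots> = ?p @ ?v" by (rule insert_letter_append[OF Ju])
            finally show ?thesis .
          qed
          let ?k = "length ?p"
          have "0 < ?k \<and> ?k < length w \<and> (\<forall>a\<in>set (take ?k w). \<forall>b\<in>set (drop ?k w). b < a)"
          proof (intro conjI ballI)
            show "0 < ?k" using cJ by simp
            show "?k < length w" using lenu v by simp
            fix a b assume "a \<in> set (take ?k w)" "b \<in> set (drop ?k w)"
            then have a: "a \<in> set ?p" and b: "b \<in> set ?v"
              by (subst (asm) weq, simp, subst (asm) (2) weq, simp)
            have "a = wmax w' + 1 \<or> a \<in> set (shift (wmax ?v) ?u)"
              using a Jne unfolding set_insert_letter[OF Ju] by (auto simp del: set_shift split: if_splits)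
            then show "b < a"
            proof
              assume "a = wmax w' + 1"
              moreover have "b \<le> wmax w'" by (rule wmax_ge) (subst w'eq, simp add: b)
              ultimately show ?thesis by simp
            next
              assume "a \<in> set (shift (wmax ?v) ?u)"
              then obtain c where "a = wmax ?v + c" "c \<in> set ?u" by auto
              moreover have "c > 0" using u0 \<open>c \<in> set ?u\<close> by (cases c) auto
              ultimately show ?thesis using wmax_ge[OF b] by simp
            qed
          qed
          then show False using no_descent by blast
        qed
        moreover have "1 \<le> Min I" using jl[OF MinJ(1)] MinI by simp
        moreover have "Min I \<le> weight (hd r)" using lr(3)[OF False] MinI Min1 by linarith
        ultimately show ?thesis using False le by simp
      qed
      let ?t = "Node I l r"
      have rpt: "red_packed ?t"
        using I I0 rpf cond unfolding red_packed.simps red_packed_forest_def by blast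
      have "tree_word ?t = w" using IJ f(3) lr(1) w'(2) by simp
      then show ?thesis
        using rpt lw fw cI by (intro exI[of _ "[?t]"]) (simp add: add_ac)
    qed
  qed
qed

lemma PW_subset_forest_word: "PW n \<subseteq> forest_word ` rp_forests n"
proof
  fix w assume "w \<in> PW n"
  then have "packed w" "length w = n" by (auto simp: PW_def)
  then obtain f where "red_packed_forest f" "forest_weight f = n" "forest_word f = w"
    using forest_word_surj by blast
  then show "w \<in> forest_word ` rp_forests n" by (auto simp: rp_forests_def)
qed

lemma finite_PW: "finite (PW n)"
proof (rule finite_subset)
  show "PW n \<subseteq> {w. set w \<subseteq> {1..n} \<and> length w = n}"
  proof
    fix w assume "w \<in> PW n"
    then have w: "packed w" "length w = n" by (auto simp: PW_def)
    have "card (set w) = wmax w" using arg_cong[OF w(1)[unfolded packed_def], of card] by simp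
    then have "wmax w \<le> n" using card_length[of w] w(2) by simp
    then show "w \<in> {w. set w \<subseteq> {1..n} \<and> length w = n}" using w by (auto simp: packed_def)
  qed
  show "finite {w. set w \<subseteq> {1..n} \<and> length w = n}" by (rule finite_lists_length_eq) simp
qed

section \<open>The bases\<close>

text \<open>By the preceding surjection there are at least as many red-packed forests as packed words, so
  independence suffices.\<close>

lemma basis_of_indep:
  assumes ind: "indep_family (P_forest :: _ \<Rightarrow> 'k::field wqsym) (rp_forests n)"
  shows "basis_family (P_forest :: _ \<Rightarrow> 'k wqsym) (rp_forests n) (WQSym n)"
proof -
  let ?B = "(P_forest :: _ \<Rightarrow> 'k wqsym) ` rp_forests n" and ?T = "(R :: _ \<Rightarrow> 'k wqsym) ` PW n"
  have inj: "inj_on (P_forest :: _ \<Rightarrow> 'k wqsym) (rp_forests n)" and indB: "free_vs.independent ?B"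
    using ind by (auto simp: indep_family_iff)
  have BW: "?B \<subseteq> WQSym n" using P_forest_in by blast
  \<comment> \<open>Exchange lemma against the words of \<open>PW n\<close>. It also provides the
    finiteness of \<open>rp_forests n\<close>, which is not read off from the definition.\<close>
  have bound: "finite S \<and> card S \<le> card (PW n)" if "free_vs.independent S" "S \<subseteq> WQSym n" for S :: "'k wqsym set"
    using free_vs.independent_span_bound[of ?T S] that finite_PW card_image_le[OF finite_PW, of "R :: _ \<Rightarrow> 'k wqsym"]
    unfolding WQSym_def by (metis finite_imageI order_trans)
  have finB: "finite ?B" using bound[OF indB BW] by simp
  then have fin: "finite (rp_forests n)" using finite_image_iff[OF inj] by simp
  have "card (PW n) \<le> card (forest_word ` rp_forests n)"
    by (rule card_mono[OF _ PW_subset_forest_word]) (simp add: fin)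
  also have "\<dots> \<le> card (rp_forests n)" by (rule card_image_le[OF fin])
  also have "\<dots> = card ?B" using card_image[OF inj] by simp
  finally have ge: "card (PW n) \<le> card ?B" .
  have "free_vs.span ?B = WQSym n"
  proof
    show "free_vs.span ?B \<subseteq> WQSym n" by (rule free_vs.span_minimal[OF BW subspace_WQSym])
    show "WQSym n \<subseteq> free_vs.span ?B"
    \<comment> \<open>A vector outside the span would enlarge \<open>?B\<close> to an independent
      set beyond this bound.\<close>
    proof (rule subsetI, rule ccontr)
      fix x assume x: "x \<in> WQSym n" "x \<notin> free_vs.span ?B"
      then have "x \<notin> ?B" using free_vs.span_base by blast
      moreover have "free_vs.independent (insert x ?B)" by (rule free_vs.independent_insertI[OF x(2) indB])
      ultimately show False using bound[of "insert x ?B"] x(1) BW finB ge by simp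
    qed
  qed
  then show ?thesis using ind by (simp add: basis_family_iff)
qed

lemma basis_forests: "basis_family (P_forest :: _ \<Rightarrow> 'k::field wqsym) (rp_forests n) (WQSym n)"
proof (induction n rule: less_induct)
  case (less n)
  show ?case
  proof (cases "n = 0")
    case True
    have "rp_forests 0 = {[]}" using forest_weight_0_iff by (auto simp: rp_forests_def)
    then have "indep_family (P_forest :: _ \<Rightarrow> 'k wqsym) (rp_forests n)"
      using True by (simp add: indep_family_iff)
    then show ?thesis by (rule basis_of_indep)
  next
    case False
    then have "n > 0" by simp
    show ?thesis by (rule basis_of_indep, rule indep_forests[OF \<open>n > 0\<close>], rule less.IH)
  qed
qed

lemma P_tree_Prim:
  assumes "red_packed t"
  shows "(P_tree t :: 'k::field wqsym) \<in> Prim (weight t)"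
proof -
  note p = P_tree_in[OF assms, where 'k = 'k]
  show ?thesis using p prim_iff[OF prim_pos[OF p(2)]] by (simp add: Prim_def)
qed

lemma subspace_WQSym_kernel:
  assumes "lin F"
  shows "free_vs.subspace {x \<in> WQSym n. F x = 0}"
  unfolding free_vs.subspace_def
  by (auto simp: lin_0[OF assms] lin_add[OF assms] lin_scale[OF assms] intro: WQSym_add WQSym_scale)

lemma subspace_Prim: "free_vs.subspace (Prim n)"
  unfolding Prim_def by (rule subspace_WQSym_kernel) (intro lin_intros)

lemma subspace_TPrim: "free_vs.subspace (TPrim n :: 'k::field wqsym set)"
proof -
  have "(TPrim n :: 'k wqsym set) = {x \<in> WQSym n. Delta_prec x = 0} \<inter> {x \<in> WQSym n. Delta_succ x = 0}"
    by (auto simp: TPrim_def)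
  then show ?thesis
    by (simp only:) (intro free_vs.subspace_inter subspace_WQSym_kernel lin_Delta[OF lin_id])
qed

theorem mainTheorem3:
  fixes n :: nat
  assumes "n \<ge> 1"
  shows "basis_family (P_forest :: nat set biplane list \<Rightarrow> 'k::field wqsym)
           {f. red_packed_forest f \<and> forest_weight f = n} (WQSym n)
       \<and> basis_family (P_tree :: nat set biplane \<Rightarrow> 'k wqsym)
           {t. red_packed t \<and> weight t = n} (Prim n)
       \<and> basis_family (P_tree :: nat set biplane \<Rightarrow> 'k wqsym)
           {t. red_packed t \<and> weight t = n \<and> left_forest t = []} (TPrim n)"
proof (intro conjI)
  have n: "n > 0" using assms by simp
  let ?P = "P_tree :: nat set biplane \<Rightarrow> 'k wqsym"
  let ?T = "{t. red_packed t \<and> weight t = n}" and ?S = "{t. red_packed t \<and> weight t = n \<and> left_forest t = []}"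
  show "basis_family (P_forest :: nat set biplane list \<Rightarrow> 'k wqsym)
      {f. red_packed_forest f \<and> forest_weight f = n} (WQSym n)"
    using basis_forests by (simp add: rp_forests_def)
  have indT: "indep_family ?P ?T" and indT0: "indep_family ?P ?S"
    using indep_trees[OF n basis_forests] indep_left_free[OF n basis_forests] by auto
  have sp: "free_vs.span (?P ` ?T) = Prim n"
  proof
    show "free_vs.span (?P ` ?T) \<subseteq> Prim n"
      by (rule free_vs.span_minimal[OF _ subspace_Prim]) (use P_tree_Prim in auto)
    show "Prim n \<subseteq> free_vs.span (?P ` ?T)"
    proof
      fix x :: "'k wqsym" assume x: "x \<in> Prim n"
      then have "x \<in> free_vs.span (P_forest ` rp_forests n)"
        using basis_forests[of n, where 'k = 'k] by (simp add: Prim_def basis_family_iff)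
      then obtain F c where F: "finite F" "F \<subseteq> rp_forests n" "x = (\<Sum>f\<in>F. scale (c f) (P_forest f))"
        by (rule span_family_expand)
      have D: "Delta_prec x + Delta_succ x = 0" using x by (simp add: Prim_def)
      \<comment> \<open>Here \<open>prim_kills_forests\<close> is applied to an element that need
        not vanish: only forests of one tree keep a coefficient.\<close>
      have "scale (c f) (P_forest f) \<in> free_vs.span (?P ` ?T)" if "f \<in> F" for f
      proof (cases "length f = 1")
        case True
        then obtain t where t: "f = [t]" by (auto simp: length_Suc_conv)
        then have "red_packed t" "weight t = n" using that F(2) by (auto simp: rp_forests_def)
        then show ?thesis unfolding t P_forest_single[OF \<open>red_packed t\<close>]
          by (intro free_vs.span_scale free_vs.span_base) auto
      next
        case False
        then show ?thesis using prim_kills_forests[OF n basis_forests F D that] by (simp add: free_vs.span_zero)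
      qed
      then show "x \<in> free_vs.span (?P ` ?T)" unfolding F(3) by (rule free_vs.span_sum)
    qed
  qed
  then show "basis_family ?P ?T (Prim n)" using indT by (simp add: basis_family_iff)
  have "free_vs.span (?P ` ?S) = TPrim n"
  proof
    show "free_vs.span (?P ` ?S) \<subseteq> TPrim n"
    proof (rule free_vs.span_minimal[OF _ subspace_TPrim], rule image_subsetI)
      fix t assume "t \<in> ?S"
      then obtain I r where t: "t = Node I [] r" "red_packed (Node I [] r)" "weight (Node I [] r) = n" by (cases t) auto
      note q = Phi_P_forest[OF red_packed_good[OF red_packed_right[OF t(2)]] t(2), where 'k = 'k]
      have d: "card I + forest_weight r > 0" using t(3) n by simp
      have "?P t = Phi I (P_forest r)"
        unfolding t(1) P_tree_Node[OF q(1) d] using brace_eq[of "[]" "Phi I (P_forest r) :: 'k wqsym"] WQSym_pos[OF q(1) d] by simp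
      then show "?P t \<in> TPrim n" using q t(3) by (simp add: TPrim_def)
    qed
    show "TPrim n \<subseteq> free_vs.span (?P ` ?S)"
    proof
      fix x :: "'k wqsym" assume x: "x \<in> TPrim n"
      then have "x \<in> Prim n" by (simp add: Prim_def TPrim_def)
      then have "x \<in> free_vs.span (?P ` ?T)" unfolding sp .
      then obtain F c where F: "finite F" "F \<subseteq> ?T" "x = (\<Sum>t\<in>F. scale (c t) (?P t))"
        by (rule span_family_expand)
      have D: "Delta_succ x = 0" using x by (simp add: TPrim_def)
      \<comment> \<open>In the same way, only trees with empty left forest keep a
        coefficient.\<close>
      have "scale (c t) (?P t) \<in> free_vs.span (?P ` ?S)" if "t \<in> F" for t
      proof (cases "left_forest t = []")
        case True
        then show ?thesis using that F(2) by (intro free_vs.span_scale free_vs.span_base) auto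
      next
        case False
        then show ?thesis using tprim_kills_trees[OF n basis_forests F D that] by (simp add: free_vs.span_zero)
      qed
      then show "x \<in> free_vs.span (?P ` ?S)" unfolding F(3) by (rule free_vs.span_sum)
    qed
  qed
  then show "basis_family ?P ?S (TPrim n)" using indT0 by (simp add: basis_family_iff)
qed

end
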